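(* Let $X$ be an injective C*-correspondence over a C*-algebra $A$. Then its Pimsner dilation $X_\infty$ (over $A_\infty$) is a minimal Hilbert bimodule that contains $X$ as a subcorrespondence. Explicitly: $X_\infty$ is a Hilbert bimodule containing (a copy of) ${}_AX_A$ as a subcorrespondence, and if $B$ is a C*-algebra with $A\subseteq B\subseteq A_\infty$ and ${}_BY_B$ is a subcorrespondence of $X_\infty$ with $X\subseteq Y\subseteq X_\infty$ such that ${}_BY_B$ is a Hilbert bimodule, then $Y=X_\infty$.
   Context: A C*-correspondence $X$ over a C*-algebra $A$ is a right Hilbert $A$-module with a $*$-homomorphism $\phi_X\colon A\to\mathcal L(X)$ (adjointable operators); it is injective if $\phi_X$ is. $\mathcal K(X)$ denotes the compact operators, the closed span of $\Theta_{\xi,\eta}\colon\zeta\mapsto\xi\langle\eta,\zeta\rangle$. A subspace $Y$ of a C*-correspondence $Z$ over $D$ is a subcorrespondence if, with the inherited operations, it is a C*-correspondence over some C*-subalgebra of $D$. A Hilbert bimodule over $B$ is a C*-correspondence $Y$ over $B$ with a left $B$-valued inner product $[\cdot,\cdot]$ satisfying $[\xi,\eta]\cdot\zeta=\xi\cdot\langle\eta,\zeta\rangle$. Equality $Y=X_\infty$ is as correspondences (with $B=A_\infty$). Pimsner dilation. A representation $(\pi,t)$ of $X$ in a C*-algebra consists of a $*$-homomorphism $\pi$ of $A$ and a linear map $t$ on $X$ with $\pi(a)t(\xi)=t(\phi_X(a)\xi)$ and $t(\xi)^*t(\eta)=\pi(\langle\xi,\eta\rangle)$; it induces $\psi_t\colon\mathcal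 K(X)\to C^*(\pi,t)$ with $\psi_t(\Theta_{\xi,\eta})=t(\xi)t(\eta)^*$, and $t^n(\xi_1\otimes\cdots\otimes\xi_n)=t(\xi_1)\cdots t(\xi_n)$ on $X^{\otimes n}$ (interior tensor power) with corresponding $\psi_{t^n}$. It is covariant if $\psi_t(\phi_X(a))=\pi(a)$ for all $a\in J_X:=(\ker\phi_X)^\perp\cap\phi_X^{-1}(\mathcal K(X))$. The Cuntz–Pimsner algebra $\mathcal O_X$ is the universal C*-algebra for covariant representations. For $X$ injective, take an injective covariant $(\pi,t)$ admitting a gauge action, so $\mathcal O_X=C^*(\pi,t)$; let $A_\infty$ be the closed linear span of $\pi(A)$ and all $\psi_{t^n}(\mathcal K(X^{\otimes n}))$, $n\ge1$ (the fixed point algebra of the gauge action), and $X_\infty=\overline{\mathrm{span}}\,t(X)A_\infty$, a C*-correspondence over $A_\infty$ with actions given by multiplication and $\langle x,y\rangle=x^*y$. $X_\infty$ is the Pimsner dilation of $X$; it does not depend on $(\pi,t)$ up to isomorphism. $A$ and $X$ are identified with $\pi(A)\subseteq A_\infty$ and $t(X)\subseteq X_\infty$. *)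

theory Defs
  imports "HOL-Analysis.Analysis" "HOL-Library.Function_Algebras"
begin

section \<open>Complex vector spaces and C*-algebras\<close>

class complex_vector = ab_group_add +
  fixes scaleC :: "complex \<Rightarrow> 'a \<Rightarrow> 'a" (infixr "*\<^sub>C" 75)
  assumes scaleC_add_right: "c *\<^sub>C (x + y) = c *\<^sub>C x + c *\<^sub>C y"
    and scaleC_add_left: "(c + d) *\<^sub>C x = c *\<^sub>C x + d *\<^sub>C x"
    and scaleC_scaleC: "c *\<^sub>C d *\<^sub>C x = (c * d) *\<^sub>C x"
    and scaleC_one: "1 *\<^sub>C x = x"

abbreviation csubspace :: "'a::complex_vector set \<Rightarrow> bool"
  where "csubspace \<equiv> module.subspace scaleC"

abbreviation cspan :: "'a::complex_vector set \<Rightarrow> 'a set"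
  where "cspan \<equiv> module.span scaleC"

instantiation "fun" :: (type, complex_vector) complex_vector
begin

definition scaleC_fun :: "complex \<Rightarrow> ('a \<Rightarrow> 'b) \<Rightarrow> 'a \<Rightarrow> 'b"
  where "scaleC_fun c f = (\<lambda>x. c *\<^sub>C f x)"

instance
  by standard
    (auto simp: scaleC_fun_def fun_eq_iff scaleC_add_right scaleC_add_left scaleC_scaleC scaleC_one)

end

text \<open>C*-algebras are not assumed to be unital (or nonzero).\<close>

class cstar_algebra = complex_vector + real_normed_algebra + banach +
  fixes star :: "'a \<Rightarrow> 'a"
  assumes scaleR_scaleC: "r *\<^sub>R x = complex_of_real r *\<^sub>C x"
    and scaleC_mult_left: "(c *\<^sub>C x) * y = c *\<^sub>C (x * y)"
    and scaleC_mult_right: "x * (c *\<^sub>C y) = c *\<^sub>C (x * y)"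
    and norm_scaleC: "norm (c *\<^sub>C x) = cmod c * norm x"
    and star_star: "star (star x) = x"
    and star_add: "star (x + y) = star x + star y"
    and star_scaleC: "star (c *\<^sub>C x) = cnj c *\<^sub>C star x"
    and star_mult: "star (x * y) = star y * star x"
    and cstar_identity: "norm (star x * x) = (norm x)\<^sup>2"

text \<open>Positivity of an element of a C*-subalgebra does not depend on whether it is tested in the
  subalgebra or in the ambient C*-algebra; it is always tested in the ambient one.\<close>

definition cpositive :: "'a::cstar_algebra \<Rightarrow> bool"
  where "cpositive a \<longleftrightarrow> (\<exists>b. a = star b * b)"

definition cstar_subalgebra :: "'a::cstar_algebra set \<Rightarrow> bool"
  where "cstar_subalgebra B \<longleftrightarrow> csubspace B \<and> closed B \<and>
    (\<forall>a\<in>B. \<forall>b\<in>B. a * b \<in> B) \<and> (\<forall>a\<in>B. star a \<in> B)"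

definition cstar_generated :: "'a::cstar_algebra set \<Rightarrow> 'a set"
  where "cstar_generated S = \<Inter>{B. cstar_subalgebra B \<and> S \<subseteq> B}"

definition clinear_on :: "'x::complex_vector set \<Rightarrow> ('x \<Rightarrow> 'y::complex_vector) \<Rightarrow> bool"
  where "clinear_on S f \<longleftrightarrow>
    (\<forall>x\<in>S. \<forall>y\<in>S. f (x + y) = f x + f y) \<and> (\<forall>c. \<forall>x\<in>S. f (c *\<^sub>C x) = c *\<^sub>C f x)"

definition star_hom_on :: "'a::cstar_algebra set \<Rightarrow> ('a \<Rightarrow> 'b::cstar_algebra) \<Rightarrow> bool"
  where "star_hom_on B \<sigma> \<longleftrightarrow> clinear_on B \<sigma> \<and>
    (\<forall>a\<in>B. \<forall>b\<in>B. \<sigma> (a * b) = \<sigma> a * \<sigma> b) \<and> (\<forall>a\<in>B. \<sigma> (star a) = star (\<sigma> a))"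


section \<open>C*-correspondences and Hilbert bimodules\<close>

text \<open>The vectors form a subset of a complex vector space and the coefficients a C*-subalgebra of a
  C*-algebra; the operations are only meaningful on these sets.\<close>

record ('x, 'a) corr =
  corr_space :: "'x set"
  corr_alg :: "'a set"
  corr_ract :: "'x \<Rightarrow> 'a \<Rightarrow> 'x"
  corr_ip :: "'x \<Rightarrow> 'x \<Rightarrow> 'a"
  corr_lact :: "'a \<Rightarrow> 'x \<Rightarrow> 'x"

definition corr_norm :: "('x, 'a::cstar_algebra) corr \<Rightarrow> 'x \<Rightarrow> real"
  where "corr_norm E x = sqrt (norm (corr_ip E x x))"

locale hilbert_module =
  fixes E :: "('x::complex_vector, 'a::cstar_algebra) corr"
  assumes alg: "cstar_subalgebra (corr_alg E)"
    and space: "csubspace (corr_space E)"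
    and ract_closed: "\<And>x a. x \<in> corr_space E \<Longrightarrow> a \<in> corr_alg E \<Longrightarrow> corr_ract E x a \<in> corr_space E"
    and ract_linear_left: "\<And>a. a \<in> corr_alg E \<Longrightarrow> clinear_on (corr_space E) (\<lambda>x. corr_ract E x a)"
    and ract_linear_right: "\<And>x. x \<in> corr_space E \<Longrightarrow> clinear_on (corr_alg E) (corr_ract E x)"
    and ract_mult: "\<And>x a b. x \<in> corr_space E \<Longrightarrow> a \<in> corr_alg E \<Longrightarrow> b \<in> corr_alg E \<Longrightarrow>
          corr_ract E x (a * b) = corr_ract E (corr_ract E x a) b"
    and ip_closed: "\<And>x y. x \<in> corr_space E \<Longrightarrow> y \<in> corr_space E \<Longrightarrow> corr_ip E x y \<in> corr_alg E"
    and ip_linear: "\<And>x. x \<in> corr_space E \<Longrightarrow> clinear_on (corr_space E) (corr_ip E x)"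
    and ip_ract: "\<And>x y a. x \<in> corr_space E \<Longrightarrow> y \<in> corr_space E \<Longrightarrow> a \<in> corr_alg E \<Longrightarrow>
          corr_ip E x (corr_ract E y a) = corr_ip E x y * a"
    and ip_star: "\<And>x y. x \<in> corr_space E \<Longrightarrow> y \<in> corr_space E \<Longrightarrow>
          star (corr_ip E x y) = corr_ip E y x"
    and ip_positive: "\<And>x. x \<in> corr_space E \<Longrightarrow> cpositive (corr_ip E x x)"
    and ip_definite: "\<And>x. x \<in> corr_space E \<Longrightarrow> corr_ip E x x = 0 \<Longrightarrow> x = 0"
    and complete: "\<And>s. (\<And>k::nat. s k \<in> corr_space E) \<Longrightarrow>
          (\<And>e. e > 0 \<Longrightarrow> \<exists>N. \<forall>j\<ge>N. \<forall>k\<ge>N. corr_norm E (s j - s k) < e) \<Longrightarrow>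
          \<exists>x\<in>corr_space E. (\<lambda>k. corr_norm E (s k - x)) \<longlonglongrightarrow> 0"

text \<open>The left action is a *-homomorphism into the adjointable operators; adjointability of each
  operator is part of \<open>lact_adjoint\<close>.\<close>

locale cstar_correspondence = hilbert_module E
  for E :: "('x::complex_vector, 'a::cstar_algebra) corr" +
  assumes lact_closed: "\<And>a x. a \<in> corr_alg E \<Longrightarrow> x \<in> corr_space E \<Longrightarrow> corr_lact E a x \<in> corr_space E"
    and lact_linear: "\<And>x. x \<in> corr_space E \<Longrightarrow> clinear_on (corr_alg E) (\<lambda>a. corr_lact E a x)"
    and lact_mult: "\<And>a b x. a \<in> corr_alg E \<Longrightarrow> b \<in> corr_alg E \<Longrightarrow> x \<in> corr_space E \<Longrightarrow>
          corr_lact E (a * b) x = corr_lact E a (corr_lact E b x)"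
    and lact_adjoint: "\<And>a x y. a \<in> corr_alg E \<Longrightarrow> x \<in> corr_space E \<Longrightarrow> y \<in> corr_space E \<Longrightarrow>
          corr_ip E (corr_lact E a x) y = corr_ip E x (corr_lact E (star a) y)"

definition hilbert_bimodule :: "('x::complex_vector, 'a::cstar_algebra) corr \<Rightarrow> bool"
  where "hilbert_bimodule E \<longleftrightarrow> cstar_correspondence E \<and>
    (\<exists>lip. (\<forall>x\<in>corr_space E. \<forall>y\<in>corr_space E. lip x y \<in> corr_alg E) \<and>
      (\<forall>y\<in>corr_space E. clinear_on (corr_space E) (\<lambda>x. lip x y)) \<and>
      (\<forall>a\<in>corr_alg E. \<forall>x\<in>corr_space E. \<forall>y\<in>corr_space E.
         lip (corr_lact E a x) y = a * lip x y) \<and>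
      (\<forall>x\<in>corr_space E. \<forall>y\<in>corr_space E. star (lip x y) = lip y x) \<and>
      (\<forall>x\<in>corr_space E. cpositive (lip x x) \<and> (lip x x = 0 \<longrightarrow> x = 0)) \<and>
      (\<forall>x\<in>corr_space E. \<forall>y\<in>corr_space E. \<forall>z\<in>corr_space E.
         corr_lact E (lip x y) z = corr_ract E x (corr_ip E y z)))"

definition subcorr :: "('x, 'a) corr \<Rightarrow> 'x set \<Rightarrow> 'a set \<Rightarrow> ('x, 'a) corr"
  where "subcorr Z Y B = Z\<lparr>corr_space := Y, corr_alg := B\<rparr>"

definition is_subcorrespondence ::
    "'x::complex_vector set \<Rightarrow> 'a::cstar_algebra set \<Rightarrow> ('x, 'a) corr \<Rightarrow> bool"
  where "is_subcorrespondence Y B Z \<longleftrightarrow>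
    Y \<subseteq> corr_space Z \<and> B \<subseteq> corr_alg Z \<and> cstar_correspondence (subcorr Z Y B)"

definition corr_isomorphism ::
    "('x::complex_vector, 'a::cstar_algebra) corr \<Rightarrow> ('y::complex_vector, 'b::cstar_algebra) corr \<Rightarrow>
     ('a \<Rightarrow> 'b) \<Rightarrow> ('x \<Rightarrow> 'y) \<Rightarrow> bool"
  where "corr_isomorphism E F \<sigma> u \<longleftrightarrow>
    star_hom_on (corr_alg E) \<sigma> \<and> bij_betw \<sigma> (corr_alg E) (corr_alg F) \<and>
    clinear_on (corr_space E) u \<and> bij_betw u (corr_space E) (corr_space F) \<and>
    (\<forall>x\<in>corr_space E. \<forall>a\<in>corr_alg E. u (corr_ract E x a) = corr_ract F (u x) (\<sigma> a)) \<and>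
    (\<forall>x\<in>corr_space E. \<forall>y\<in>corr_space E. corr_ip F (u x) (u y) = \<sigma> (corr_ip E x y)) \<and>
    (\<forall>a\<in>corr_alg E. \<forall>x\<in>corr_space E. u (corr_lact E a x) = corr_lact F (\<sigma> a) (u x))"


section \<open>Adjointable and compact operators\<close>

text \<open>An operator on \<open>E\<close> is a function that vanishes outside \<open>corr_space E\<close>, so that two operators
  are equal iff they agree on \<open>E\<close>.\<close>

definition adjointables :: "('x::complex_vector, 'a) corr \<Rightarrow> ('x \<Rightarrow> 'x) set"
  where "adjointables E = {T. (\<forall>x\<in>corr_space E. T x \<in> corr_space E) \<and>
    (\<forall>x. x \<notin> corr_space E \<longrightarrow> T x = 0) \<and>
    (\<exists>T'. (\<forall>x\<in>corr_space E. T' x \<in> corr_space E) \<and>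
       (\<forall>x\<in>corr_space E. \<forall>y\<in>corr_space E. corr_ip E (T x) y = corr_ip E x (T' y)))}"

definition phi :: "('x::complex_vector, 'a) corr \<Rightarrow> 'a \<Rightarrow> 'x \<Rightarrow> 'x"
  where "phi E a = (\<lambda>x. if x \<in> corr_space E then corr_lact E a x else 0)"

definition theta :: "('x::complex_vector, 'a) corr \<Rightarrow> 'x \<Rightarrow> 'x \<Rightarrow> 'x \<Rightarrow> 'x"
  where "theta E x y = (\<lambda>z. if z \<in> corr_space E then corr_ract E x (corr_ip E y z) else 0)"

text \<open>Convergence in operator norm.\<close>

definition op_tendsto ::
    "('x::complex_vector, 'a::cstar_algebra) corr \<Rightarrow> (nat \<Rightarrow> 'x \<Rightarrow> 'x) \<Rightarrow> ('x \<Rightarrow> 'x) \<Rightarrow> bool"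
  where "op_tendsto E S T \<longleftrightarrow> (\<forall>e>0. \<exists>N. \<forall>k\<ge>N. \<forall>x\<in>corr_space E.
    corr_norm E (S k x - T x) \<le> e * corr_norm E x)"

definition compacts :: "('x::complex_vector, 'a::cstar_algebra) corr \<Rightarrow> ('x \<Rightarrow> 'x) set"
  where "compacts E = {T \<in> adjointables E. \<exists>S.
    (\<forall>k. S k \<in> cspan {theta E x y |x y. x \<in> corr_space E \<and> y \<in> corr_space E}) \<and> op_tendsto E S T}"

definition injective_corr :: "('x::complex_vector, 'a) corr \<Rightarrow> bool"
  where "injective_corr E \<longleftrightarrow> inj_on (phi E) (corr_alg E)"

definition ker_phi :: "('x::complex_vector, 'a) corr \<Rightarrow> 'a set"
  where "ker_phi E = {a \<in> corr_alg E. phi E a = 0}"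

definition katsura_ideal :: "('x::complex_vector, 'a::cstar_algebra) corr \<Rightarrow> 'a set"
  where "katsura_ideal E =
    {a \<in> corr_alg E. (\<forall>b\<in>ker_phi E. a * b = 0) \<and> phi E a \<in> compacts E}"


section \<open>Representations\<close>

definition corr_representation ::
    "('x::complex_vector, 'a::cstar_algebra) corr \<Rightarrow> ('a \<Rightarrow> 'd::cstar_algebra) \<Rightarrow> ('x \<Rightarrow> 'd) \<Rightarrow> bool"
  where "corr_representation X \<pi> t \<longleftrightarrow>
    star_hom_on (corr_alg X) \<pi> \<and> clinear_on (corr_space X) t \<and>
    (\<forall>a\<in>corr_alg X. \<forall>x\<in>corr_space X. \<pi> a * t x = t (phi X a x)) \<and>
    (\<forall>x\<in>corr_space X. \<forall>y\<in>corr_space X. star (t x) * t y = \<pi> (corr_ip X x y))"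

text \<open>The induced map \<open>\<psi>\<^sub>t\<close> on the compact operators: if \<open>T\<close> is the norm limit of the finite sums
  \<open>\<Sum>i. \<Theta> (x i) (y i)\<close> then \<open>\<psi>\<^sub>t T\<close> is the limit of \<open>\<Sum>i. t (x i) * star (t (y i))\<close>. A sum of this
  kind is encoded by the list of pairs \<open>(x i, y i)\<close>; scalars are absorbed into \<open>x i\<close>.\<close>

definition psi :: "('x::complex_vector, 'a::cstar_algebra) corr \<Rightarrow> ('x \<Rightarrow> 'd::cstar_algebra) \<Rightarrow>
     ('x \<Rightarrow> 'x) \<Rightarrow> 'd"
  where "psi E t T = (THE d. \<exists>s :: nat \<Rightarrow> ('x \<times> 'x) list.
    (\<forall>k. set (s k) \<subseteq> corr_space E \<times> corr_space E) \<and>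
    op_tendsto E (\<lambda>k. \<Sum>(x, y)\<leftarrow>s k. theta E x y) T \<and>
    (\<lambda>k. \<Sum>(x, y)\<leftarrow>s k. t x * star (t y)) \<longlonglongrightarrow> d)"

definition covariant ::
    "('x::complex_vector, 'a::cstar_algebra) corr \<Rightarrow> ('a \<Rightarrow> 'd::cstar_algebra) \<Rightarrow> ('x \<Rightarrow> 'd) \<Rightarrow> bool"
  where "covariant X \<pi> t \<longleftrightarrow> (\<forall>a\<in>katsura_ideal X. psi X t (phi X a) = \<pi> a)"

definition cstar_of_rep ::
    "('x, 'a) corr \<Rightarrow> ('a \<Rightarrow> 'd::cstar_algebra) \<Rightarrow> ('x \<Rightarrow> 'd) \<Rightarrow> 'd set"
  where "cstar_of_rep X \<pi> t = cstar_generated (\<pi> ` corr_alg X \<union> t ` corr_space X)"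

text \<open>The *-endomorphisms \<open>\<beta>\<close> below are determined by their values on generators, so they
  automatically depend multiplicatively and strongly continuously on \<open>z\<close> and are automorphisms.\<close>

definition admits_gauge_action ::
    "('x, 'a) corr \<Rightarrow> ('a \<Rightarrow> 'd::cstar_algebra) \<Rightarrow> ('x \<Rightarrow> 'd) \<Rightarrow> bool"
  where "admits_gauge_action X \<pi> t \<longleftrightarrow> (\<forall>z. cmod z = 1 \<longrightarrow>
    (\<exists>\<beta>. star_hom_on (cstar_of_rep X \<pi> t) \<beta> \<and> \<beta> ` cstar_of_rep X \<pi> t \<subseteq> cstar_of_rep X \<pi> t \<and>
       (\<forall>a\<in>corr_alg X. \<beta> (\<pi> a) = \<pi> a) \<and> (\<forall>x\<in>corr_space X. \<beta> (t x) = z *\<^sub>C t x)))"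


section \<open>Interior tensor powers\<close>

definition tuples :: "('x, 'a) corr \<Rightarrow> nat \<Rightarrow> 'x list set"
  where "tuples X n = {u. length u = n \<and> set u \<subseteq> corr_space X}"

text \<open>The inner product of the elementary tensors \<open>u\<^sub>1 \<otimes> \<dots> \<otimes> u\<^sub>n\<close> and \<open>v\<^sub>1 \<otimes> \<dots> \<otimes> v\<^sub>n\<close>, from
  \<open>\<langle>u \<otimes> u', v \<otimes> v'\<rangle> = \<langle>u', \<phi>(\<langle>u, v\<rangle>) v'\<rangle>\<close>.\<close>

fun tensor_ip :: "('x, 'a::zero) corr \<Rightarrow> 'x list \<Rightarrow> 'x list \<Rightarrow> 'a"
  where
    "tensor_ip X [u] [v] = corr_ip X u v"
  | "tensor_ip X (u # u' # us) (v # v' # vs) =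
       tensor_ip X (u' # us) (corr_lact X (corr_ip X u v) v' # vs)"
  | "tensor_ip X _ _ = 0"

text \<open>The interior tensor power is the completion of the algebraic one modulo vectors of length zero.
  Finite sums of elementary tensors are encoded by lists of \<open>n\<close>-tuples (scalars are absorbed into the
  tuples). A vector \<open>\<zeta>\<close> of the completion is represented by the function
  \<open>(u\<^sub>1, \<dots>, u\<^sub>n) \<mapsto> \<langle>u\<^sub>1 \<otimes> \<dots> \<otimes> u\<^sub>n, \<zeta>\<rangle>\<close>, which determines \<open>\<zeta>\<close> because the elementary tensors are total;
  thus \<open>\<langle>\<Sum>\<^sub>u u\<^sub>1 \<otimes> \<dots> \<otimes> u\<^sub>n, \<zeta>\<rangle> = \<Sum>\<^sub>u \<zeta> u\<close>.\<close>

definition tensor_vec :: "('x, 'a::cstar_algebra) corr \<Rightarrow> nat \<Rightarrow> 'x list list \<Rightarrow> 'x list \<Rightarrow> 'a"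
  where "tensor_vec X n s = (\<lambda>u. if u \<in> tuples X n then \<Sum>v\<leftarrow>s. tensor_ip X u v else 0)"

definition tensor_dist :: "('x, 'a::cstar_algebra) corr \<Rightarrow> nat \<Rightarrow> 'x list list \<Rightarrow> 'x list list \<Rightarrow> real"
  where "tensor_dist X n s r = (let \<delta> = tensor_vec X n s - tensor_vec X n r in
    sqrt (norm ((\<Sum>u\<leftarrow>s. \<delta> u) - (\<Sum>u\<leftarrow>r. \<delta> u))))"

definition tensor_tendsto ::
    "('x, 'a::cstar_algebra) corr \<Rightarrow> nat \<Rightarrow> (nat \<Rightarrow> 'x list list) \<Rightarrow> ('x list \<Rightarrow> 'a) \<Rightarrow> bool"
  where "tensor_tendsto X n s \<zeta> \<longleftrightarrow>
    (\<forall>k. set (s k) \<subseteq> tuples X n) \<and>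
    (\<forall>e>0. \<exists>N. \<forall>j\<ge>N. \<forall>k\<ge>N. tensor_dist X n (s j) (s k) < e) \<and>
    (\<forall>u. (\<lambda>k. tensor_vec X n (s k) u) \<longlonglongrightarrow> \<zeta> u)"

definition tensor_power ::
    "('x, 'a::cstar_algebra) corr \<Rightarrow> nat \<Rightarrow> ('x list \<Rightarrow> 'a, 'a) corr"
  where "tensor_power X n = \<lparr>
    corr_space = {\<zeta>. \<exists>s. tensor_tendsto X n s \<zeta>},
    corr_alg = corr_alg X,
    corr_ract = (\<lambda>\<zeta> a u. \<zeta> u * a),
    corr_ip = (\<lambda>\<zeta> \<omega>. THE a. \<exists>s. tensor_tendsto X n s \<zeta> \<and> (\<lambda>k. \<Sum>u\<leftarrow>s k. \<omega> u) \<longlonglongrightarrow> a),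
    corr_lact = (\<lambda>a \<zeta> u. if u \<in> tuples X n then \<zeta> (corr_lact X (star a) (hd u) # tl u) else 0)\<rparr>"

fun elementary_map :: "('x \<Rightarrow> 'd::cstar_algebra) \<Rightarrow> 'x list \<Rightarrow> 'd"
  where
    "elementary_map t [] = 0"
  | "elementary_map t [u] = t u"
  | "elementary_map t (u # u' # us) = t u * elementary_map t (u' # us)"

text \<open>The map \<open>t\<^sup>n\<close>, by linearity and continuity from
  \<open>t\<^sup>n (u\<^sub>1 \<otimes> \<dots> \<otimes> u\<^sub>n) = t u\<^sub>1 \<cdots> t u\<^sub>n\<close>.\<close>

definition rep_power :: "('x, 'a::cstar_algebra) corr \<Rightarrow> ('x \<Rightarrow> 'd::cstar_algebra) \<Rightarrow> nat \<Rightarrow>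
     ('x list \<Rightarrow> 'a) \<Rightarrow> 'd"
  where "rep_power X t n \<zeta> = (THE d. \<exists>s. tensor_tendsto X n s \<zeta> \<and>
    (\<lambda>k. \<Sum>u\<leftarrow>s k. elementary_map t u) \<longlonglongrightarrow> d)"


section \<open>The Pimsner dilation\<close>

definition A_inf ::
    "('x, 'a::cstar_algebra) corr \<Rightarrow> ('a \<Rightarrow> 'd::cstar_algebra) \<Rightarrow> ('x \<Rightarrow> 'd) \<Rightarrow> 'd set"
  where "A_inf X \<pi> t = closure (cspan (\<pi> ` corr_alg X \<union>
    (\<Union>n\<in>{1..}. psi (tensor_power X n) (rep_power X t n) ` compacts (tensor_power X n))))"

definition X_inf ::
    "('x, 'a::cstar_algebra) corr \<Rightarrow> ('a \<Rightarrow> 'd::cstar_algebra) \<Rightarrow> ('x \<Rightarrow> 'd) \<Rightarrow> 'd set"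
  where "X_inf X \<pi> t = closure (cspan {t x * a |x a. x \<in> corr_space X \<and> a \<in> A_inf X \<pi> t})"

definition pimsner_dilation ::
    "('x, 'a::cstar_algebra) corr \<Rightarrow> ('a \<Rightarrow> 'd::cstar_algebra) \<Rightarrow> ('x \<Rightarrow> 'd) \<Rightarrow> ('d, 'd) corr"
  where "pimsner_dilation X \<pi> t = \<lparr>
    corr_space = X_inf X \<pi> t,
    corr_alg = A_inf X \<pi> t,
    corr_ract = (*),
    corr_ip = (\<lambda>x y. star x * y),
    corr_lact = (*)\<rparr>"

end

theory Submission
  imports Defs "HOL-Complex_Analysis.Cauchy_Integral_Formula" "HOL-Computational_Algebra.Polynomial"
begin

text \<open>The algebra \<open>A\<^sub>\<infinity>\<close> is the closed span of \<open>\<pi>(A)\<close> and of the products \<open>t(u) t(v)*\<close> for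
  tuples \<open>u, v\<close> of equal positive length; hence \<open>X\<^sub>\<infinity> X\<^sub>\<infinity>* \<subseteq> A\<^sub>\<infinity>\<close> and \<open>[x, y] = x y*\<close> makes
  \<open>X\<^sub>\<infinity>\<close> a Hilbert bimodule. For minimality, the left inner product of a Hilbert bimodule \<open>Y\<close>
  with \<open>X \<subseteq> Y \<subseteq> X\<^sub>\<infinity>\<close> must satisfy \<open>[x, y] z = x y* z\<close> for \<open>z \<in> t(X)\<close>. Since \<open>A\<^sub>\<infinity>\<close> acts
  injectively on \<open>t(X)\<close>, this forces \<open>x y* \<in> B\<close>, and by induction on the length all products
  \<open>t(u) t(v)*\<close> lie in \<open>B\<close>.

  Injectivity of the action is where covariance enters. If \<open>d \<in> A\<^sub>\<infinity>\<close> annihilates \<open>t(X)\<close> and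
  \<open>d \<approx> \<pi>(a) + l\<close>, with \<open>l\<close> a sum of products \<open>t(u) t(v)*\<close>, then an approximate unit \<open>-u\<close> of
  \<open>\<psi>\<^sub>t(K(X))\<close> acts as a unit on \<open>l\<close> and is annihilated by \<open>d\<close>, so that
  \<open>d \<approx> \<pi>(a) + u \<pi>(a) \<in> \<pi>(A) + \<psi>\<^sub>t(K(X))\<close>. On the latter algebra the action is injective by
  covariance, hence isometric, and \<open>d = 0\<close>.

  The C*-algebraic tools (contractivity and isometry of *-homomorphisms, approximate units) rest
  on the bound \<open>\<parallel>p(c)\<parallel> \<le> sup \<bar>p\<bar>\<close> for real polynomials and self-adjoint \<open>c\<close>. Writing
  \<open>c = (U + U*)/2\<close> with \<open>U\<close> unitary bounds \<open>\<parallel>p(c)\<parallel>\<close> by the Fourier coefficients of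
  \<open>p(cos \<theta>)\<close>, up to a factor linear in the degree; applying this to the powers of \<open>p\<close> removes the
  factor.\<close>

section \<open>Polynomials acting on vectors\<close>

text \<open>All estimates concern left multiplication by a self-adjoint c on a closed invariant
  subspace V of the ambient algebra. For V the whole algebra they bound elements in norm; for V =
  t(X) they only see the operator norm on X, which a priori may be smaller than the norm of c.
  Comparing the two is the main difficulty. Operators on X are plain functions and not elements of a
  type of class \<open>cstar_algebra\<close>, and \<pi>(A) + K1 is handled only as a *-algebra, so
  the isometry theorem for injective *-homomorphisms does not apply to the action on t(X). Its proof
  is carried out there once more, with the same polynomials applied to an element and to its part in
  \<pi>(A). Compact operators and tensor powers are transported into the ambient algebra as well:
  the n-th tensor power becomes the closed span of the products t(x_1) ... t(x_n), and a compact
  operator becomes the element with the same action in the closed span of the products x y*. That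
  this element is unique is another instance of the norm comparison, now on the closed span
  itself.\<close>

interpretation cvec: module "scaleC :: complex \<Rightarrow> 'a::complex_vector \<Rightarrow> 'a"
  by standard (simp_all add: scaleC_add_right scaleC_add_left scaleC_scaleC scaleC_one)

lemma clinear_onD:
  assumes "clinear_on S f" "csubspace S"
  shows "\<And>x y. x \<in> S \<Longrightarrow> y \<in> S \<Longrightarrow> f (x + y) = f x + f y"
    "\<And>c x. x \<in> S \<Longrightarrow> f (c *\<^sub>C x) = c *\<^sub>C f x"
    "f 0 = 0"
    "\<And>x. x \<in> S \<Longrightarrow> f (- x) = - f x"
    "\<And>x y. x \<in> S \<Longrightarrow> y \<in> S \<Longrightarrow> f (x - y) = f x - f y"
proof -
  show add: "f (x + y) = f x + f y" if "x \<in> S" "y \<in> S" for x y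
    using assms that by (auto simp: clinear_on_def)
  show sc: "f (c *\<^sub>C x) = c *\<^sub>C f x" if "x \<in> S" for c x
    using assms that by (auto simp: clinear_on_def)
  show "f 0 = 0"
    using sc[OF cvec.subspace_0[OF assms(2)], of 0] by simp
  show neg: "f (- x) = - f x" if "x \<in> S" for x
    using sc[OF that, of "-1"] by (simp add: scaleC_one)
  show "f (x - y) = f x - f y" if "x \<in> S" "y \<in> S" for x y
    using add[OF that(1) cvec.subspace_neg[OF assms(2) that(2)]] neg[OF that(2)] by simp
qed

lemma csubspace_sum_list:
  assumes "csubspace S" "\<And>x. x \<in> set xs \<Longrightarrow> f x \<in> S"
  shows "(\<Sum>x\<leftarrow>xs. f x) \<in> S"
  using assms(2) by (induction xs) (auto intro: cvec.subspace_0 cvec.subspace_add assms(1))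

lemma clinear_on_sum_list:
  assumes "clinear_on S f" "csubspace S" "\<And>x. x \<in> set xs \<Longrightarrow> g x \<in> S"
  shows "f (\<Sum>x\<leftarrow>xs. g x) = (\<Sum>x\<leftarrow>xs. f (g x))"
  using assms(3)
  by (induction xs) (auto simp: clinear_onD[OF assms(1,2)] csubspace_sum_list[OF assms(2)])

section \<open>Involution and norm\<close>

lemma star_zero [simp]: "star (0::'a::cstar_algebra) = 0"
  using star_scaleC[of 0 "0::'a"] by simp

lemma star_minus [simp]: "star (- x) = - star (x::'a::cstar_algebra)"
  using star_scaleC[of "-1" x] by (simp add: scaleC_one)

lemma star_diff: "star (x - y) = star x - star (y::'a::cstar_algebra)"
  using star_add[of x "- y"] by simp

lemma star_scaleR: "star (r *\<^sub>R x) = r *\<^sub>R star (x::'a::cstar_algebra)"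
  by (simp add: scaleR_scaleC star_scaleC)

lemma star_sum_list: "star (\<Sum>x\<leftarrow>xs. f x) = (\<Sum>x\<leftarrow>xs. star (f x :: 'a::cstar_algebra))"
  by (induction xs) (auto simp: star_add)

lemma norm_star [simp]: "norm (star x) = norm (x::'a::cstar_algebra)"
proof -
  have le: "norm x \<le> norm (star x)" for x :: 'a
  proof (cases "x = 0")
    case False
    have "norm x * norm x \<le> norm (star x) * norm x"
      using cstar_identity[of x] norm_mult_ineq[of "star x" x] by (simp add: power2_eq_square)
    thus ?thesis using False by simp
  qed simp
  show ?thesis using le[of x] le[of "star x"] by (simp add: star_star)
qed

lemma norm_mult_star: "norm (x * star x) = (norm (x::'a::cstar_algebra))\<^sup>2"
  using cstar_identity[of "star x"] by (simp add: star_star)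

lemma star_mult_eq_0: "star x * x = 0 \<Longrightarrow> x = (0::'a::cstar_algebra)"
  using cstar_identity[of x] by simp

lemma bounded_linear_star: "bounded_linear (star :: 'a::cstar_algebra \<Rightarrow> 'a)"
  by (rule bounded_linear_intro[of _ 1]) (simp_all add: star_add star_scaleR)

lemmas tendsto_star = bounded_linear.tendsto[OF bounded_linear_star]

lemma bounded_linear_scaleC: "bounded_linear ((*\<^sub>C) c :: 'a::cstar_algebra \<Rightarrow> 'a)"
  by (rule bounded_linear_intro[of _ "cmod c"])
    (simp_all add: scaleC_add_right scaleR_scaleC scaleC_scaleC norm_scaleC mult.commute)

lemmas tendsto_scaleC = bounded_linear.tendsto[OF bounded_linear_scaleC]

lemma closed_csubspace_closure:
  assumes "csubspace (S::'a::cstar_algebra set)"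
  shows "csubspace (closure S)"
proof (rule cvec.subspaceI)
  show "0 \<in> closure S" using cvec.subspace_0[OF assms] closure_subset by blast
next
  fix x y assume "x \<in> closure S" "y \<in> closure S"
  then obtain f g where "\<And>n. f n \<in> S" "f \<longlonglongrightarrow> x" "\<And>n. g n \<in> S" "g \<longlonglongrightarrow> y"
    by (auto simp: closure_sequential)
  thus "x + y \<in> closure S"
    unfolding closure_sequential
    by (intro exI[of _ "\<lambda>n. f n + g n"]) (auto intro!: tendsto_add cvec.subspace_add[OF assms])
next
  fix c x assume "x \<in> closure S"
  then obtain f where "\<And>n. f n \<in> S" "f \<longlonglongrightarrow> x"
    by (auto simp: closure_sequential)
  thus "c *\<^sub>C x \<in> closure S"
    unfolding closure_sequential
    by (intro exI[of _ "\<lambda>n. c *\<^sub>C f n"]) (auto intro!: tendsto_scaleC cvec.subspace_scale[OF assms])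
qed

lemma csubspace_closure_cspan [simp]: "csubspace (closure (cspan (S::'a::cstar_algebra set)))"
  by (intro closed_csubspace_closure cvec.subspace_span)

text \<open>The polynomial acts on vectors rather than being evaluated at \<open>c\<close> because there is no unit.\<close>

definition poly_act :: "real poly \<Rightarrow> 'a::cstar_algebra \<Rightarrow> 'a \<Rightarrow> 'a"
  where "poly_act p c v = fold_coeffs (\<lambda>a w. a *\<^sub>R v + c * w) p 0"

lemma poly_act_0 [simp]: "poly_act 0 c v = 0"
  by (simp add: poly_act_def)

lemma poly_act_pCons [simp]: "poly_act (pCons a p) c v = a *\<^sub>R v + c * poly_act p c v"
  by (cases "pCons a p = 0") (auto simp: poly_act_def)

lemma poly_act_1 [simp]: "poly_act 1 c v = v"
  by (simp add: one_pCons)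

lemma poly_act_add: "poly_act (p + q) c v = poly_act p c v + poly_act q c v"
  by (induction p q rule: poly_induct2) (auto simp: algebra_simps)

lemma poly_act_smult: "poly_act (smult r p) c v = r *\<^sub>R poly_act p c v"
  by (induction p) (auto simp: algebra_simps)

lemma poly_act_minus: "poly_act (- p) c v = - poly_act p c v"
  by (induction p) (auto simp: algebra_simps)

lemma poly_act_diff: "poly_act (p - q) c v = poly_act p c v - poly_act q c v"
  using poly_act_add[of p "-q"] by (simp add: poly_act_minus)

lemma poly_act_zero_right [simp]: "poly_act p c 0 = 0"
  by (induction p) auto

lemma poly_act_add_right: "poly_act p c (v + w) = poly_act p c v + poly_act p c w"
  by (induction p) (auto simp: algebra_simps)

lemma poly_act_scaleR_right: "poly_act p c (r *\<^sub>R v) = r *\<^sub>R poly_act p c v"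
  by (induction p) (auto simp: algebra_simps)

lemma poly_act_scaleC_right: "poly_act p c (r *\<^sub>C v) = r *\<^sub>C poly_act p c v"
  by (induction p) (auto simp: scaleC_add_right scaleC_mult_right scaleC_scaleC scaleR_scaleC mult.commute)

lemma poly_act_diff_right: "poly_act p c (v - w) = poly_act p c v - poly_act p c w"
  using poly_act_add_right[of p c "v - w" w] by simp

lemma poly_act_mult_self: "poly_act p c (c * v) = c * poly_act p c v"
  by (induction p) (auto simp: algebra_simps)

lemma poly_act_mult: "poly_act (p * q) c v = poly_act p c (poly_act q c v)"
  by (induction p) (auto simp: poly_act_add poly_act_smult)

lemma poly_act_mult_right: "poly_act p c (v * w) = poly_act p c v * w"
  by (induction p) (auto simp: algebra_simps)

text \<open>When p has a constant term there is no element p(c) that could be self-adjoint; moving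
  the action across the pairing \<open>star v * w\<close> takes the place of p(c)* = p(c).\<close>

lemma poly_act_star:
  assumes "star c = c"
  shows "star (poly_act p c v) * w = star v * poly_act p c w"
proof (induction p arbitrary: w)
  case (pCons a p)
  have "star (c * poly_act p c v) * w = star (poly_act p c v) * (c * w)"
    by (simp add: star_mult assms mult.assoc)
  also have "\<dots> = star v * (c * poly_act p c w)"
    by (simp add: pCons.IH poly_act_mult_self)
  finally show ?case
    by (simp add: star_add star_scaleR distrib_left distrib_right)
qed simp

text \<open>One factor c makes up for the missing unit: \<open>poly_act p c c\<close> is c p(c), a
  genuine element, self-adjoint because c commutes with polynomials in c.\<close>

lemma poly_act_self_star:
  assumes "star c = c"
  shows "star (poly_act p c c) = poly_act p c c"
proof -
  have "poly_act p c c * c = c * poly_act p c c" for p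
    by (simp add: poly_act_mult_right[symmetric] poly_act_mult_self)
  thus ?thesis
    by (induction p) (auto simp: star_add star_scaleR star_mult assms)
qed

lemma poly_act_closed:
  assumes "csubspace V" "\<And>v. v \<in> V \<Longrightarrow> c * v \<in> V" "v \<in> V"
  shows "poly_act p c v \<in> V"
  by (induction p)
    (auto simp: scaleR_scaleC intro!: cvec.subspace_0 cvec.subspace_add cvec.subspace_scale assms)

lemma poly_act_scaleR_left:
  "poly_act p (r *\<^sub>R c) v = poly_act (p \<circ>\<^sub>p [:0, r:]) c v"
  by (induction p) (auto simp: pcompose_pCons poly_act_add poly_act_smult)

lemma star_hom_poly_act:
  assumes "star_hom_on A \<sigma>" "cstar_subalgebra A" "c \<in> A" "v \<in> A"
  shows "\<sigma> (poly_act p c v) = poly_act p (\<sigma> c) (\<sigma> v)"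
proof -
  have sub: "csubspace A" and lin: "clinear_on A \<sigma>"
    using assms by (auto simp: cstar_subalgebra_def star_hom_on_def)
  have cl: "poly_act p c v \<in> A" for p
    using assms by (intro poly_act_closed) (auto simp: cstar_subalgebra_def)
  show ?thesis
  proof (induction p)
    case 0 show ?case using clinear_onD(3)[OF lin sub] by simp
  next
    case (pCons a p)
    have "c * poly_act p c v \<in> A" "a *\<^sub>R v \<in> A"
      using assms cl[of p] cvec.subspace_scale[OF sub] by (auto simp: cstar_subalgebra_def scaleR_scaleC)
    moreover have "\<sigma> (c * poly_act p c v) = \<sigma> c * \<sigma> (poly_act p c v)"
      using assms cl[of p] by (auto simp: star_hom_on_def)
    ultimately show ?case
      using clinear_onD(1,2)[OF lin sub] assms pCons by (auto simp: scaleR_scaleC)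
  qed
qed

section \<open>Norm bounds for polynomials in a self-adjoint element\<close>

text \<open>Iterating the squaring inequality gives a_1^(2^k) \<le> a_(2^k) \<le> C (2^k + 1)
  r^(2^k), and a linear factor cannot keep up with the powers of a_1 / r > 1.\<close>

lemma doubling_sequence_le:
  fixes a :: "nat \<Rightarrow> real"
  assumes nonneg: "\<And>n. 0 \<le> a n"
    and double: "\<And>n. (a n)\<^sup>2 \<le> a (2 * n)"
    and bound: "\<And>n. a n \<le> C * real (n + 1) * r ^ n"
    and r: "0 \<le> r"
  shows "a 1 \<le> r"
proof (rule ccontr)
  assume "\<not> a 1 \<le> r"
  hence less: "r < a 1" by simp
  have pow: "a 1 ^ (2 ^ k) \<le> a (2 ^ k)" for k
  proof (induction k)
    case (Suc k)
    have "a 1 ^ (2 ^ Suc k) = (a 1 ^ (2 ^ k))\<^sup>2"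
      by (metis mult.commute power_Suc power_mult)
    also have "\<dots> \<le> (a (2 ^ k))\<^sup>2"
      using Suc nonneg by (intro power_mono) auto
    also have "\<dots> \<le> a (2 ^ Suc k)"
      using double[of "2 ^ k"] by simp
    finally show ?case .
  qed simp
  show False
  proof (cases "r = 0")
    case True
    have "a 1 ^ (2 ^ 0) \<le> C * real (2 ^ 0 + 1) * r ^ (2 ^ 0)"
      using pow[of 0] bound[of "2 ^ 0"] by linarith
    thus False using True less by simp
  next
    case False
    define q where "q = a 1 / r"
    have q: "q > 1" using False r less by (simp add: q_def)
    have le: "q ^ (2 ^ k) \<le> C * (real (2 ^ k) + 1)" for k
    proof -
      have "a 1 ^ (2 ^ k) \<le> C * real (2 ^ k + 1) * r ^ (2 ^ k)"
        using pow[of k] bound[of "2 ^ k"] by linarith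
      thus ?thesis using False r by (simp add: q_def power_divide divide_le_eq add_ac)
    qed
    have q1: "norm (1 / q) < 1" using q by simp
    have "(\<lambda>n. C * (real n * (1 / q) ^ n + (1 / q) ^ n)) \<longlonglongrightarrow> C * (0 + 0)"
      by (intro tendsto_mult_left tendsto_add powser_times_n_limit_0[OF q1] LIMSEQ_power_zero[OF q1])
    hence "(\<lambda>n. C * (real n + 1) / q ^ n) \<longlonglongrightarrow> 0"
      by (simp add: algebra_simps divide_inverse power_inverse)
    moreover have "filterlim (\<lambda>k. 2 ^ k :: nat) at_top sequentially"
      by (rule filterlim_subseq) (auto simp: strict_mono_def)
    ultimately have "(\<lambda>k. C * (real (2 ^ k) + 1) / q ^ (2 ^ k)) \<longlonglongrightarrow> 0"
      by (rule filterlim_compose)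
    hence "eventually (\<lambda>k. C * (real (2 ^ k) + 1) / q ^ (2 ^ k) < 1) sequentially"
      by (rule order_tendstoD) simp
    then obtain k where "C * (real (2 ^ k) + 1) / q ^ (2 ^ k) < 1"
      by (auto simp: eventually_sequentially)
    thus False using le[of k] q by (simp add: divide_less_eq)
  qed
qed

text \<open>By the C*-identity and symmetry, the square of norm(S^n v) is the norm of v* S^(2n) v,
  hence at most norm v times norm(S^(2n) v). This is the spectral radius argument at a single
  vector, for a map S that need not be a multiplication.\<close>

lemma norm_self_adjoint_le:
  fixes S :: "'a::cstar_algebra \<Rightarrow> 'a"
  assumes S: "\<And>v. v \<in> V \<Longrightarrow> S v \<in> V"
    and adj: "\<And>v w. v \<in> V \<Longrightarrow> w \<in> V \<Longrightarrow> star (S v) * w = star v * S w"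
    and bound: "\<And>n v. v \<in> V \<Longrightarrow> norm ((S ^^ n) v) \<le> C * real (n + 1) * r ^ n * norm v"
    and r: "0 \<le> r" and v: "v \<in> V"
  shows "norm (S v) \<le> r * norm v"
proof (cases "v = 0")
  case True
  thus ?thesis using bound[OF v, of 1] by simp
next
  case False
  have pS: "(S ^^ n) w \<in> V" if "w \<in> V" for n w
    using that by (induction n) (auto intro: S)
  have padj: "star ((S ^^ n) w) * x = star w * (S ^^ n) x" if "w \<in> V" "x \<in> V" for n w x
    using that
  proof (induction n arbitrary: x)
    case (Suc n)
    have "star ((S ^^ Suc n) w) * x = star ((S ^^ n) w) * S x"
      using Suc.prems by (simp add: adj pS)
    also have "\<dots> = star w * (S ^^ n) (S x)"
      using Suc S by simp
    finally show ?case by (simp only: funpow_Suc_right o_apply)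
  qed simp
  define a where "a n = norm ((S ^^ n) v) / norm v" for n
  have "a 1 \<le> r"
  proof (rule doubling_sequence_le)
    show "0 \<le> a n" for n by (simp add: a_def)
    show "a n \<le> C * real (n + 1) * r ^ n" for n
      using bound[OF v, of n] False by (simp add: a_def divide_le_eq)
    show "(a n)\<^sup>2 \<le> a (2 * n)" for n
    proof -
      have "(norm ((S ^^ n) v))\<^sup>2 = norm (star v * (S ^^ n) ((S ^^ n) v))"
        using padj[OF v pS[OF v], of n n] by (simp flip: cstar_identity)
      also have "(S ^^ n) ((S ^^ n) v) = (S ^^ (2 * n)) v"
        by (simp add: mult_2 funpow_add)
      finally have "(norm ((S ^^ n) v))\<^sup>2 \<le> norm v * norm ((S ^^ (2 * n)) v)"
        using norm_mult_ineq[of "star v" "(S ^^ (2 * n)) v"] by simp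
      thus ?thesis using False by (simp add: a_def field_simps power2_eq_square)
    qed
  qed (rule r)
  thus ?thesis using False by (simp add: a_def divide_le_eq)
qed

text \<open>Cauchy's estimate on the unit disc for the k-th derivative at 0.\<close>

lemma coeff_le_sup_circle:
  fixes P :: "complex poly"
  assumes "\<And>z. cmod z = 1 \<Longrightarrow> cmod (poly P z) \<le> M"
  shows "cmod (coeff P k) \<le> M"
proof -
  have deriv: "(deriv ^^ n) (poly P) = poly ((pderiv ^^ n) P)" for n
    by (induction n) (auto intro!: ext DERIV_imp_deriv poly_DERIV)
  have "cmod ((deriv ^^ k) (poly P) 0) \<le> fact k * M / 1 ^ k"
    by (rule Cauchy_inequality)
      (auto intro!: holomorphic_intros continuous_intros assms simp: poly_DERIV)
  moreover have "(deriv ^^ k) (poly P) 0 = fact k * coeff P k"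
    by (simp add: deriv poly_0_coeff_0 coeff_higher_pderiv pochhammer_fact)
  ultimately show ?thesis by (simp add: norm_mult)
qed

text \<open>Fixed point iteration for y = (x^2 + y^2)/2, whose solution with y(0) = 0 is y = 1 -
  sqrt(1 - x^2). All iterates vanish at 0.\<close>

primrec sqrt_poly :: "nat \<Rightarrow> real poly" where
  "sqrt_poly 0 = 0"
| "sqrt_poly (Suc n) = [:0, 0, 1/2:] + smult (1/2) (sqrt_poly n * sqrt_poly n)"

text \<open>The number \<open>\<rho>\<close> bounds only the action on V; the norm of c itself may
  be larger. Strictness of \<open>\<rho> < 1\<close> gives geometric convergence of the square root
  iteration.\<close>

locale self_adjoint_action =
  fixes V :: "'a::cstar_algebra set" and c :: 'a and \<rho> :: real
  assumes sub: "csubspace V" and closed: "closed V"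
    and inv: "\<And>v. v \<in> V \<Longrightarrow> c * v \<in> V"
    and self_adjoint: "star c = c"
    and bound: "\<And>v. v \<in> V \<Longrightarrow> norm (c * v) \<le> \<rho> * norm v"
    and rho: "0 \<le> \<rho>" "\<rho> < 1"
begin

lemma act_closed: "v \<in> V \<Longrightarrow> poly_act p c v \<in> V"
  by (intro poly_act_closed sub inv)

text \<open>The square of a map bounded by \<open>\<rho>\<close> is bounded by \<rho>^2 \<le>
  \<rho>, and each iterate is the mean of two such squares.\<close>

lemma sqrt_poly_bound: "v \<in> V \<Longrightarrow> norm (poly_act (sqrt_poly n) c v) \<le> \<rho> * norm v"
proof (induction n arbitrary: v)
  case 0
  thus ?case using rho by simp
next
  case (Suc n)
  let ?Q = "poly_act (sqrt_poly n) c"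
  have two: "norm (T (T v)) \<le> \<rho> * norm v"
    if "\<And>w. w \<in> V \<Longrightarrow> norm (T w) \<le> \<rho> * norm w" "T v \<in> V" for T
  proof -
    have "norm (T (T v)) \<le> \<rho> * norm (T v)" using that by blast
    also have "\<dots> \<le> 1 * norm (T v)" using rho by (intro mult_right_mono) auto
    also have "\<dots> \<le> \<rho> * norm v" using that Suc.prems by simp
    finally show ?thesis .
  qed
  have "poly_act (sqrt_poly (Suc n)) c v = (1/2) *\<^sub>R (c * (c * v)) + (1/2) *\<^sub>R ?Q (?Q v)"
    by (simp add: poly_act_add poly_act_smult poly_act_mult)
  also have "norm \<dots> \<le> (1/2) * norm (c * (c * v)) + (1/2) * norm (?Q (?Q v))"
    by (rule order_trans[OF norm_triangle_ineq]) simp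
  also have "\<dots> \<le> \<rho> * norm v"
  proof -
    have "norm (c * (c * v)) \<le> \<rho> * norm v"
      by (rule two[of "(*) c"]) (simp_all add: bound inv Suc.prems)
    moreover have "norm (?Q (?Q v)) \<le> \<rho> * norm v"
      by (rule two) (simp_all add: Suc.IH act_closed Suc.prems)
    ultimately show ?thesis by simp
  qed
  finally show ?case .
qed

text \<open>Half the difference of two consecutive squares is the previous difference times the mean
  of two iterates, each bounded by \<open>\<rho>\<close> on V.\<close>

lemma sqrt_poly_diff_bound:
  "v \<in> V \<Longrightarrow> norm (poly_act (sqrt_poly (Suc n) - sqrt_poly n) c v) \<le> \<rho> ^ n * norm v"
proof (induction n arbitrary: v)
  case 0
  have "norm (poly_act (sqrt_poly (Suc 0)) c v) \<le> \<rho> * norm v"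
    using 0 by (rule sqrt_poly_bound)
  also have "\<dots> \<le> 1 * norm v" using rho by (intro mult_right_mono) auto
  finally show ?case by simp
next
  case (Suc n)
  let ?d = "sqrt_poly (Suc n) - sqrt_poly n"
  have eq: "sqrt_poly (Suc (Suc n)) - sqrt_poly (Suc n) =
      smult (1/2) (sqrt_poly (Suc n) * sqrt_poly (Suc n) - sqrt_poly n * sqrt_poly n)"
    by (subst sqrt_poly.simps(2), subst (3) sqrt_poly.simps(2))
      (simp only: add_diff_cancel_left smult_diff_right)
  have "sqrt_poly (Suc (Suc n)) - sqrt_poly (Suc n) =
      smult (1/2) (?d * sqrt_poly (Suc n) + ?d * sqrt_poly n)"
    unfolding eq by (rule arg_cong[where f = "smult (1/2)"]) (simp only: algebra_simps)
  hence "norm (poly_act (sqrt_poly (Suc (Suc n)) - sqrt_poly (Suc n)) c v) =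
      norm (poly_act ?d c (poly_act (sqrt_poly (Suc n)) c v) +
            poly_act ?d c (poly_act (sqrt_poly n) c v)) / 2"
    by (simp only: poly_act_smult poly_act_add poly_act_mult) simp
  also have "\<dots> \<le> (\<rho> ^ n * (\<rho> * norm v) + \<rho> ^ n * (\<rho> * norm v)) / 2"
  proof -
    have "norm (poly_act ?d c (poly_act (sqrt_poly m) c v)) \<le> \<rho> ^ n * (\<rho> * norm v)" for m
      using Suc.IH[OF act_closed[OF Suc.prems, of "sqrt_poly m"]] sqrt_poly_bound[OF Suc.prems, of m] rho
      by (meson mult_left_mono order_trans zero_le_power)
    note B = this[of n] this[of "Suc n"]
    show ?thesis
      by (intro divide_right_mono order_trans[OF norm_triangle_ineq] add_mono B) simp
  qed
  also have "\<dots> = \<rho> ^ Suc n * norm v" by simp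
  finally show ?case .
qed

lemma sqrt_poly_convergent:
  assumes "v \<in> V"
  shows "convergent (\<lambda>n. poly_act (sqrt_poly n) c v)"
proof -
  have "summable (\<lambda>n. poly_act (sqrt_poly (Suc n) - sqrt_poly n) c v)"
  proof (rule summable_comparison_test)
    show "summable (\<lambda>n. \<rho> ^ n * norm v)"
      using rho by (intro summable_mult2 summable_geometric) auto
    show "\<exists>N. \<forall>n\<ge>N. norm (poly_act (sqrt_poly (Suc n) - sqrt_poly n) c v) \<le> \<rho> ^ n * norm v"
      using sqrt_poly_diff_bound[OF assms] by blast
  qed
  hence "convergent (\<lambda>n. \<Sum>i<n. poly_act (sqrt_poly (Suc i)) c v - poly_act (sqrt_poly i) c v)"
    by (simp only: summable_iff_convergent poly_act_diff)
  thus ?thesis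
    by (simp only: sum_lessThan_telescope[of "\<lambda>i. poly_act (sqrt_poly i) c v"]) simp
qed

text \<open>h is (1 - c^2)^(1/2), obtained as 1 - y from the limit y of the iteration. Without a
  unit it is a map and not an element, so linearity, symmetry and commutation with c and with right
  multiplications are listed one by one.\<close>

lemma ex_sqrt:
  obtains h where "\<And>v. v \<in> V \<Longrightarrow> h v \<in> V"
    "\<And>v w. v \<in> V \<Longrightarrow> w \<in> V \<Longrightarrow> h (v + w) = h v + h w"
    "\<And>z v. v \<in> V \<Longrightarrow> h (z *\<^sub>C v) = z *\<^sub>C h v"
    "\<And>v. v \<in> V \<Longrightarrow> h (h v) = v - c * (c * v)"
    "\<And>v. v \<in> V \<Longrightarrow> h (c * v) = c * h v"
    "\<And>v w. v \<in> V \<Longrightarrow> w \<in> V \<Longrightarrow> star (h v) * w = star v * h w"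
    "\<And>v x. v \<in> V \<Longrightarrow> v * x \<in> V \<Longrightarrow> h (v * x) = h v * x"
    "c \<in> V \<Longrightarrow> star (h c) = h c"
proof -
  define y where "y v = lim (\<lambda>n. poly_act (sqrt_poly n) c v)" for v
  have lim: "(\<lambda>n. poly_act (sqrt_poly n) c v) \<longlonglongrightarrow> y v" if "v \<in> V" for v
    using sqrt_poly_convergent[OF that] by (simp add: y_def convergent_LIMSEQ_iff)
  have eqI: "y v = l" if "v \<in> V" "(\<lambda>n. poly_act (sqrt_poly n) c v) \<longlonglongrightarrow> l" for v l
    using LIMSEQ_unique[OF lim[OF that(1)] that(2)] .
  have y_closed: "y v \<in> V" if "v \<in> V" for v
    using closed_sequentially[OF closed _ lim[OF that]] act_closed[OF that] by blast
  have y_add: "y (v + w) = y v + y w" if "v \<in> V" "w \<in> V" for v w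
    by (rule eqI) (auto simp: poly_act_add_right that cvec.subspace_add[OF sub] intro!: tendsto_add lim)
  have y_scale: "y (z *\<^sub>C v) = z *\<^sub>C y v" if "v \<in> V" for z v
    by (rule eqI) (auto simp: poly_act_scaleC_right that cvec.subspace_scale[OF sub] intro!: tendsto_scaleC lim)
  have y_mult: "y (c * v) = c * y v" if "v \<in> V" for v
    by (rule eqI) (auto simp: poly_act_mult_self that inv intro!: tendsto_mult lim)
  have y_adj: "star (y v) * w = star v * y w" if "v \<in> V" "w \<in> V" for v w
  proof (rule LIMSEQ_unique)
    show "(\<lambda>n. star (poly_act (sqrt_poly n) c v) * w) \<longlonglongrightarrow> star (y v) * w"
      by (intro tendsto_intros tendsto_star lim that)
    show "(\<lambda>n. star (poly_act (sqrt_poly n) c v) * w) \<longlonglongrightarrow> star v * y w"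
      by (simp only: poly_act_star[OF self_adjoint]) (intro tendsto_intros lim that)
  qed
  have y_right: "y (v * x) = y v * x" if "v \<in> V" "v * x \<in> V" for v x
    by (rule eqI) (auto simp: poly_act_mult_right that intro!: tendsto_mult lim)
  have y_self: "star (y c) = y c" if "c \<in> V"
  proof (rule LIMSEQ_unique)
    show "(\<lambda>n. star (poly_act (sqrt_poly n) c c)) \<longlonglongrightarrow> star (y c)"
      by (intro tendsto_star lim that)
    show "(\<lambda>n. star (poly_act (sqrt_poly n) c c)) \<longlonglongrightarrow> y c"
      by (simp only: poly_act_self_star[OF self_adjoint]) (intro lim that)
  qed
  have y_y: "y (y v) = 2 *\<^sub>R y v - c * (c * v)" if v: "v \<in> V" for v
  proof -
    let ?Q = "\<lambda>n. poly_act (sqrt_poly n) c"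
    \<comment> \<open>The operator and its argument vary together; a bound on \<open>?Q n\<close>
      that is uniform in n separates the two limits.\<close>
    have diff: "(\<lambda>n. ?Q n (?Q n v - y v)) \<longlonglongrightarrow> 0"
    proof (rule Lim_null_comparison)
      show "\<forall>\<^sub>F n in sequentially. norm (?Q n (?Q n v - y v)) \<le> \<rho> * norm (?Q n v - y v)"
        by (intro always_eventually allI sqrt_poly_bound cvec.subspace_diff[OF sub] act_closed y_closed v)
      show "(\<lambda>n. \<rho> * norm (?Q n v - y v)) \<longlonglongrightarrow> 0"
        using tendsto_mult_right_zero[OF tendsto_norm_zero[OF LIM_zero[OF lim[OF v]]]] .
    qed
    have "(\<lambda>n. ?Q n (?Q n v - y v) + ?Q n (y v)) \<longlonglongrightarrow> 0 + y (y v)"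
      by (intro tendsto_add diff lim y_closed v)
    \<comment> \<open>The two terms add up to \<open>?Q n (?Q n v)\<close>, which the recursion
      expresses by the next iterate.\<close>
    moreover have "?Q n (?Q n v - y v) + ?Q n (y v) = 2 *\<^sub>R ?Q (Suc n) v - c * (c * v)" for n
      by (simp add: poly_act_diff_right poly_act_add poly_act_smult poly_act_mult algebra_simps)
    ultimately have "(\<lambda>n. 2 *\<^sub>R ?Q (Suc n) v - c * (c * v)) \<longlonglongrightarrow> y (y v)"
      by (simp only:) simp
    moreover have "(\<lambda>n. 2 *\<^sub>R ?Q (Suc n) v - c * (c * v)) \<longlonglongrightarrow> 2 *\<^sub>R y v - c * (c * v)"
      using LIMSEQ_Suc[OF lim[OF v]] by (intro tendsto_intros)
    ultimately show ?thesis by (rule LIMSEQ_unique)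
  qed
  have y_minus: "y (- v) = - y v" if "v \<in> V" for v
    using y_scale[OF that, of "-1"] by (simp add: scaleC_one)
  have y_diff: "y (v - w) = y v - y w" if "v \<in> V" "w \<in> V" for v w
    using y_add[OF that(1) cvec.subspace_neg[OF sub that(2)]] y_minus[OF that(2)] by simp
  show ?thesis
  proof (rule that[of "\<lambda>v. v - y v"])
    fix v assume v: "v \<in> V"
    show "v - y v - y (v - y v) = v - c * (c * v)"
      using y_diff[OF v y_closed[OF v]] y_y[OF v] by (simp add: scaleR_2)
  qed (auto simp: self_adjoint y_closed y_add y_scale y_mult y_adj y_right y_self star_diff
      cvec.scale_right_diff_distrib left_diff_distrib right_diff_distrib
      intro: cvec.subspace_diff[OF sub])
qed

text \<open>U = c + i (1 - c^2)^(1/2). The last property is c = (U + U^(-1))/2 multiplied by U, so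
  that no inverse of U has to be constructed.\<close>

lemma ex_unitary:
  obtains U where "\<And>v. v \<in> V \<Longrightarrow> U v \<in> V"
    "\<And>v w. v \<in> V \<Longrightarrow> w \<in> V \<Longrightarrow> U (v + w) = U v + U w"
    "\<And>z v. v \<in> V \<Longrightarrow> U (z *\<^sub>C v) = z *\<^sub>C U v"
    "\<And>v. v \<in> V \<Longrightarrow> norm (U v) = norm v"
    "\<And>v. v \<in> V \<Longrightarrow> U (c * v) = (1/2) *\<^sub>C (U (U v) + v)"
proof -
  obtain h where h: "\<And>v. v \<in> V \<Longrightarrow> h v \<in> V"
    "\<And>v w. v \<in> V \<Longrightarrow> w \<in> V \<Longrightarrow> h (v + w) = h v + h w"
    "\<And>z v. v \<in> V \<Longrightarrow> h (z *\<^sub>C v) = z *\<^sub>C h v"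
    "\<And>v. v \<in> V \<Longrightarrow> h (h v) = v - c * (c * v)"
    "\<And>v. v \<in> V \<Longrightarrow> h (c * v) = c * h v"
    "\<And>v w. v \<in> V \<Longrightarrow> w \<in> V \<Longrightarrow> star (h v) * w = star v * h w"
    "\<And>v x. v \<in> V \<Longrightarrow> v * x \<in> V \<Longrightarrow> h (v * x) = h v * x"
    "c \<in> V \<Longrightarrow> star (h c) = h c"
    by (fact ex_sqrt)
  define U where "U v = c * v + \<i> *\<^sub>C h v" for v
  show ?thesis
  proof (rule that[of U])
    show U: "U v \<in> V" if "v \<in> V" for v
      unfolding U_def by (intro cvec.subspace_add[OF sub] cvec.subspace_scale[OF sub] inv h that)
    show "U (v + w) = U v + U w" if "v \<in> V" "w \<in> V" for v w
      by (simp add: U_def h that distrib_left scaleC_add_right)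
    show "U (z *\<^sub>C v) = z *\<^sub>C U v" if "v \<in> V" for z v
      by (simp add: U_def h that scaleC_mult_right scaleC_add_right scaleC_scaleC mult.commute)
    show "norm (U v) = norm v" if v: "v \<in> V" for v
    proof -
      have expand: "star (x + \<i> *\<^sub>C y) * (x + \<i> *\<^sub>C y) =
          star x * x + star y * y + (\<i> *\<^sub>C (star x * y) - \<i> *\<^sub>C (star y * x))" for x y :: 'a
        by (simp add: star_add star_scaleC distrib_left distrib_right scaleC_mult_left
            scaleC_mult_right scaleC_scaleC cvec.scale_minus_left scaleC_one left_diff_distrib
            cvec.scale_right_diff_distrib)
      have 1: "star (c * v) * w = star v * (c * w)" for w
        by (simp add: star_mult self_adjoint mult.assoc)
      have 2: "star (h v) * h v = star v * v - star v * (c * (c * v))"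
        using h v by (simp add: right_diff_distrib)
      have 3: "star (h v) * (c * v) = star v * (c * h v)"
        using h v inv by simp
      \<comment> \<open>The cross terms cancel because h commutes with c; what remains is c^2 + (1 -
        c^2) = 1.\<close>
      have "star (U v) * U v = star v * v"
        unfolding U_def expand 1 2 3 by simp
      hence "(norm (U v))\<^sup>2 = (norm v)\<^sup>2"
        by (simp flip: cstar_identity)
      thus ?thesis by simp
    qed
    show "U (c * v) = (1/2) *\<^sub>C (U (U v) + v)" if v: "v \<in> V" for v
    proof -
      have "h (U v) = c * h v + \<i> *\<^sub>C (v - c * (c * v))"
        unfolding U_def by (simp add: h v inv cvec.subspace_scale[OF sub])
      moreover have "c * U v = c * (c * v) + \<i> *\<^sub>C (c * h v)"
        by (simp add: U_def distrib_left scaleC_mult_right)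
      ultimately have "U (U v) + v = (c * (c * v) + \<i> *\<^sub>C (c * h v)) + (c * (c * v) + \<i> *\<^sub>C (c * h v))"
        unfolding U_def[of "U v"]
        by (simp add: scaleC_add_right scaleC_scaleC cvec.scale_minus_left scaleC_one)
      also have "\<dots> = 2 *\<^sub>C U (c * v)"
        using scaleC_add_left[of 1 1 "U (c * v)"] by (simp add: U_def h v scaleC_one)
      finally show ?thesis by (simp add: scaleC_scaleC scaleC_one)
    qed
  qed
qed

text \<open>With \<open>c = (U + U*)/2\<close>, the operator \<open>U^d p(c)\<close> is a polynomial in \<open>U\<close> whose
  coefficients are the Fourier coefficients of \<open>p (cos \<theta>)\<close>.\<close>

lemma poly_act_coarse_bound:
  assumes M: "\<And>s. \<bar>s\<bar> \<le> 1 \<Longrightarrow> \<bar>poly p s\<bar> \<le> M" and d: "degree p \<le> d" and v: "v \<in> V"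
  shows "norm (poly_act p c v) \<le> real (2 * d + 1) * M * norm v"
proof -
  obtain U where U: "\<And>v. v \<in> V \<Longrightarrow> U v \<in> V"
    "\<And>v w. v \<in> V \<Longrightarrow> w \<in> V \<Longrightarrow> U (v + w) = U v + U w"
    "\<And>z v. v \<in> V \<Longrightarrow> U (z *\<^sub>C v) = z *\<^sub>C U v"
    "\<And>v. v \<in> V \<Longrightarrow> norm (U v) = norm v"
    "\<And>v. v \<in> V \<Longrightarrow> U (c * v) = (1/2) *\<^sub>C (U (U v) + v)"
    by (fact ex_unitary)
  have U0: "U 0 = 0" using U(3)[OF cvec.subspace_0[OF sub], of 0] by simp
  \<comment> \<open>\<open>L P\<close> is the complex polynomial P evaluated at U.\<close>
  define L where "L P v = fold_coeffs (\<lambda>a w. a *\<^sub>C v + U w) P 0" for P v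
  have L_0: "L 0 v = 0" for v by (simp add: L_def)
  have L_pCons: "L (pCons a P) v = a *\<^sub>C v + U (L P v)" for a P v
    by (cases "pCons a P = 0") (auto simp: L_def U0)
  have L_closed: "L P v \<in> V" if "v \<in> V" for P v
    using that
    by (induction P) (auto simp: L_0 L_pCons intro!: U cvec.subspace_0 cvec.subspace_add cvec.subspace_scale sub)
  have L_add: "L (P + Q) v = L P v + L Q v" if "v \<in> V" for P Q v
    by (induction P Q rule: poly_induct2)
      (auto simp: L_0 L_pCons U L_closed that scaleC_add_left)
  have L_smult: "L (smult a P) v = a *\<^sub>C L P v" if "v \<in> V" for a P v
    by (induction P) (auto simp: L_0 L_pCons U L_closed that scaleC_add_right scaleC_scaleC)
  \<comment> \<open>U is isometric and there are degree + 1 coefficients; this crude count is the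
    factor that \<open>poly_act_bound\<close> removes.\<close>
  have L_bound: "norm (L P v) \<le> real (degree P + 1) * K * norm v"
    if "\<And>k. cmod (coeff P k) \<le> K" "v \<in> V" for P K v
    using that
  proof (induction P)
    case 0
    thus ?case using order_trans[OF norm_ge_zero, of _ K] by (simp add: L_0)
  next
    case (pCons a P)
    have a: "cmod a \<le> K" using pCons.prems(1)[of 0] by simp
    have "norm (L P v) \<le> real (degree P + 1) * K * norm v"
      using pCons.prems(1)[of "Suc k" for k] pCons.prems(2) by (intro pCons.IH) auto
    moreover have "norm (L (pCons a P) v) \<le> K * norm v + norm (L P v)"
      using norm_triangle_ineq[of "a *\<^sub>C v" "U (L P v)"] mult_right_mono[OF a, of "norm v"] pCons.prems(2)
      by (simp add: L_pCons U L_closed norm_scaleC)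
    ultimately show ?case by (cases "P = 0") (auto simp: algebra_simps L_0)
  qed
  have powU: "(U ^^ n) v \<in> V" "norm ((U ^^ n) v) = norm v" if "v \<in> V" for n v
    using that by (induction n) (auto simp: U)
  have powU_add: "(U ^^ n) (v + w) = (U ^^ n) v + (U ^^ n) w" if "v \<in> V" "w \<in> V" for n v w
    using that by (induction n) (auto simp: U powU)
  have powU_scale: "(U ^^ n) (z *\<^sub>C v) = z *\<^sub>C (U ^^ n) v" if "v \<in> V" for n z v
    using that by (induction n) (auto simp: U powU)
  have L_monom: "L (monom a n) v = a *\<^sub>C (U ^^ n) v" if "v \<in> V" for a n v
    by (induction n) (auto simp: monom_0 monom_Suc L_0 L_pCons U0 U that powU)
  \<comment> \<open>On the unit circle U becomes z and c becomes Re z. The factor z^d clears the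
    negative powers in p(cos \<theta>), whose frequencies range from -d to d; hence the degree
    2d.\<close>
  have "\<exists>Q. degree Q \<le> 2 * d \<and> (\<forall>v\<in>V. (U ^^ d) (poly_act p c v) = L Q v) \<and>
      (\<forall>z. cmod z = 1 \<longrightarrow> poly Q z = z ^ d * complex_of_real (poly p (Re z)))"
    using d
  proof (induction d arbitrary: p)
    case 0
    then obtain a where p: "p = [:a:]" by (metis degree_eq_zeroE le_zero_eq)
    show ?case
      by (rule exI[of _ "[:complex_of_real a:]"]) (simp add: p L_pCons L_0 U0 scaleR_scaleC)
  next
    case (Suc d)
    obtain a p' where p: "p = pCons a p'" by (rule pCons_cases)
    have "degree p' \<le> d" using Suc.prems by (cases "p' = 0") (auto simp: p)
    then obtain Q where Q: "degree Q \<le> 2 * d" "\<And>v. v \<in> V \<Longrightarrow> (U ^^ d) (poly_act p' c v) = L Q v"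
      "\<And>z. cmod z = 1 \<Longrightarrow> poly Q z = z ^ d * complex_of_real (poly p' (Re z))"
      using Suc.IH by blast
    \<comment> \<open>From z^(d+1) (a + Re z p'(Re z)) = a z^(d+1) + (z^2 + 1)/2 Q(z), since z Re z
      = (z^2 + 1)/2 on the circle.\<close>
    define R where "R = monom (complex_of_real a) (Suc d) + smult (1/2) (pCons 0 (pCons 0 Q) + Q)"
    have "degree R \<le> 2 * Suc d"
      unfolding R_def
      by (intro degree_add_le order_trans[OF degree_smult_le] order_trans[OF degree_monom_le]
          order_trans[OF degree_pCons_le]) (use Q(1) in auto)
    moreover have "(U ^^ Suc d) (poly_act p c v) = L R v" if v: "v \<in> V" for v
    proof -
      let ?w = "poly_act p' c v"
      have w: "?w \<in> V" by (rule act_closed[OF v])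
      have "(U ^^ Suc d) (poly_act p c v) = a *\<^sub>C (U ^^ Suc d) v + (U ^^ d) (U (c * ?w))"
        using v w
        by (simp only: p poly_act_pCons scaleR_scaleC powU_add powU_scale cvec.subspace_scale[OF sub] inv)
          (simp only: funpow_Suc_right o_apply)
      also have "(U ^^ d) (U (c * ?w)) = (1/2) *\<^sub>C ((U ^^ d) (U (U ?w)) + (U ^^ d) ?w)"
        using w by (simp add: U powU_scale powU_add cvec.subspace_add[OF sub])
      also have "(U ^^ d) (U (U ?w)) = U (U ((U ^^ d) ?w))"
        by (simp add: funpow_swap1)
      also have "a *\<^sub>C (U ^^ Suc d) v + (1/2) *\<^sub>C (U (U ((U ^^ d) ?w)) + (U ^^ d) ?w) = L R v"
        using v by (simp only: R_def L_add L_smult L_monom L_pCons Q(2)) simp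
      finally show ?thesis .
    qed
    moreover have "poly R z = z ^ Suc d * complex_of_real (poly p (Re z))" if z: "cmod z = 1" for z
    proof -
      have "z * cnj z = 1" using z by (simp add: complex_norm_square[symmetric])
      hence "z * z + 1 = 2 * (z * complex_of_real (Re z))"
        by (metis complex_add_cnj distrib_left mult.left_commute of_real_mult of_real_numeral)
      hence "(z * z + 1) / 2 = z * complex_of_real (Re z)" by simp
      moreover have "poly R z = a * z ^ Suc d + (z * z + 1) / 2 * poly Q z"
        by (simp add: R_def poly_monom algebra_simps)
      ultimately show ?thesis by (simp add: Q(3)[OF z] p algebra_simps)
    qed
    ultimately show ?case by blast
  qed
  then obtain Q where Q: "degree Q \<le> 2 * d" "\<And>v. v \<in> V \<Longrightarrow> (U ^^ d) (poly_act p c v) = L Q v"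
      "\<And>z. cmod z = 1 \<Longrightarrow> poly Q z = z ^ d * complex_of_real (poly p (Re z))"
    by blast
  have "cmod (poly Q z) \<le> M" if "cmod z = 1" for z
    using M[of "Re z"] abs_Re_le_cmod[of z] that by (simp add: Q(3) norm_mult norm_power)
  hence "norm (L Q v) \<le> real (degree Q + 1) * M * norm v"
    by (intro L_bound coeff_le_sup_circle v)
  also have "\<dots> \<le> real (2 * d + 1) * M * norm v"
    using Q(1) M[of 0] by (intro mult_right_mono) auto
  finally show ?thesis
    using Q(2)[OF v] powU(2)[OF act_closed[OF v], of d p] by simp
qed

end

text \<open>Applied to the powers of \<open>p\<close>, the coarse bound loses only a factor that is linear in the
  exponent, and this factor disappears on taking roots.\<close>

lemma poly_act_bound:
  fixes V :: "'a::cstar_algebra set"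
  assumes "csubspace V" "closed V" "\<And>v. v \<in> V \<Longrightarrow> c * v \<in> V" "star c = c"
    and bound: "\<And>v. v \<in> V \<Longrightarrow> norm (c * v) \<le> \<delta> * norm v" and r: "0 \<le> \<delta>" "\<delta> < r"
    and M: "\<And>s. \<bar>s\<bar> \<le> r \<Longrightarrow> \<bar>poly p s\<bar> \<le> M" and v: "v \<in> V"
  shows "norm (poly_act p c v) \<le> M * norm v"
proof -
  \<comment> \<open>Scaling by 1/r turns \<delta> < r into an action bound below 1, as
    \<open>self_adjoint_action\<close> requires.\<close>
  define b where "b = (1 / r) *\<^sub>R c"
  define q where "q = p \<circ>\<^sub>p [:0, r:]"
  have M0: "0 \<le> M" using M[of 0] r by simp
  have q: "poly_act q b w = poly_act p c w" for w
    using poly_act_scaleR_left[of p r b w] r by (simp add: q_def b_def)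
  interpret self_adjoint_action V b "\<delta> / r"
  proof
    fix v assume v: "v \<in> V"
    show "b * v \<in> V"
      using assms v cvec.subspace_scale[OF assms(1)] by (simp add: b_def scaleR_scaleC scaleC_mult_left)
    show "norm (b * v) \<le> \<delta> / r * norm v"
      using bound[OF v] r by (simp add: b_def divide_right_mono)
  qed (use assms in \<open>auto simp: b_def star_scaleR\<close>)
  have powact: "poly_act (q ^ n) b w = (poly_act q b ^^ n) w" for n w
    by (induction n) (auto simp: poly_act_mult)
  have "norm (poly_act q b v) \<le> M * norm v"
  proof (rule norm_self_adjoint_le[where V = V and C = "2 * real (degree q) + 1"])
    show "norm ((poly_act q b ^^ n) w) \<le> (2 * real (degree q) + 1) * real (n + 1) * M ^ n * norm w"
      if w: "w \<in> V" for n w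
    proof -
      have "norm (poly_act (q ^ n) b w) \<le> real (2 * (degree q * n) + 1) * M ^ n * norm w"
      proof (rule poly_act_coarse_bound[OF _ degree_power_le w])
        fix s :: real assume "\<bar>s\<bar> \<le> 1"
        hence "\<bar>poly q s\<bar> \<le> M" using r by (auto simp: q_def poly_pcompose abs_mult intro!: M)
        thus "\<bar>poly (q ^ n) s\<bar> \<le> M ^ n" by (simp add: poly_power power_abs power_mono)
      qed
      also have "\<dots> \<le> (2 * real (degree q) + 1) * real (n + 1) * M ^ n * norm w"
        using M0 by (intro mult_right_mono) (auto simp: algebra_simps)
      finally show ?thesis by (simp only: powact)
    qed
  qed (use act_closed M0 v self_adjoint in \<open>auto simp: poly_act_star\<close>)
  thus ?thesis by (simp add: q)
qed

text \<open>For e = c q(c), the polynomial s q(s) acts on the vector e as multiplication by e, so e*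
  e has norm at most M norm(e); the C*-identity then cancels one factor.\<close>

lemma poly_act_self_bound:
  fixes c :: "'a::cstar_algebra"
  assumes c: "star c = c" "norm c < r" and M: "\<And>s. \<bar>s\<bar> \<le> r \<Longrightarrow> \<bar>s * poly q s\<bar> \<le> M"
  shows "norm (poly_act q c c) \<le> M"
proof -
  let ?e = "poly_act q c c"
  have "norm (poly_act (pCons 0 q) c ?e) \<le> M * norm ?e"
    by (rule poly_act_bound[of UNIV c "norm c" r])
      (use c M in \<open>auto intro: cvec.subspaceI norm_mult_ineq\<close>)
  also have "poly_act (pCons 0 q) c ?e = star ?e * ?e"
    using poly_act_mult_self[of q c ?e] by (simp add: poly_act_self_star[OF c(1)] flip: poly_act_mult_right)
  finally have "norm ?e * norm ?e \<le> M * norm ?e"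
    by (simp add: cstar_identity power2_eq_square)
  moreover have "0 \<le> M" using M[of 0] order.strict_trans1[OF norm_ge_zero c(2)] by simp
  ultimately show ?thesis by (cases "norm ?e = 0") auto
qed

section \<open>*-homomorphisms and approximate units\<close>

lemma cstar_subalgebraD:
  assumes "cstar_subalgebra A"
  shows "csubspace A" "closed A" "\<And>a b. a \<in> A \<Longrightarrow> b \<in> A \<Longrightarrow> a * b \<in> A"
    "\<And>a. a \<in> A \<Longrightarrow> star a \<in> A"
  using assms by (auto simp: cstar_subalgebra_def)

lemma star_hom_onD:
  assumes "star_hom_on A \<sigma>"
  shows "clinear_on A \<sigma>" "\<And>a b. a \<in> A \<Longrightarrow> b \<in> A \<Longrightarrow> \<sigma> (a * b) = \<sigma> a * \<sigma> b"
    "\<And>a. a \<in> A \<Longrightarrow> \<sigma> (star a) = star (\<sigma> a)"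
  using assms by (auto simp: star_hom_on_def)

text \<open>For \<open>k = a (1 - a\<^sup>2)\<^sup>1\<^sup>/\<^sup>2\<close> the element \<open>w = \<sigma>(a)\<^sup>2 + \<i> \<sigma>(k)\<close> satisfies
  \<open>w* w = \<sigma>(a)\<^sup>2\<close>.\<close>

lemma star_hom_contractive_self_adjoint:
  fixes \<sigma> :: "'a::cstar_algebra \<Rightarrow> 'b::cstar_algebra"
  assumes \<sigma>: "star_hom_on A \<sigma>" and A: "cstar_subalgebra A"
    and a: "a \<in> A" "star a = a" "norm a < 1"
  shows "norm (\<sigma> a) \<le> 1"
proof -
  note A' = cstar_subalgebraD[OF A]
  note \<sigma>' = star_hom_onD[OF \<sigma>]
  note lin = clinear_onD[OF \<sigma>'(1) A'(1)]
  interpret self_adjoint_action A a "norm a"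
    by standard (use A' a norm_mult_ineq in auto)
  obtain h where h: "\<And>v. v \<in> A \<Longrightarrow> h v \<in> A"
    "\<And>v w. v \<in> A \<Longrightarrow> w \<in> A \<Longrightarrow> h (v + w) = h v + h w"
    "\<And>z v. v \<in> A \<Longrightarrow> h (z *\<^sub>C v) = z *\<^sub>C h v"
    "\<And>v. v \<in> A \<Longrightarrow> h (h v) = v - a * (a * v)"
    "\<And>v. v \<in> A \<Longrightarrow> h (a * v) = a * h v"
    "\<And>v w. v \<in> A \<Longrightarrow> w \<in> A \<Longrightarrow> star (h v) * w = star v * h w"
    "\<And>v x. v \<in> A \<Longrightarrow> v * x \<in> A \<Longrightarrow> h (v * x) = h v * x"
    "a \<in> A \<Longrightarrow> star (h a) = h a"
    by (fact ex_sqrt)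
  define k where "k = h a"
  have k: "k \<in> A" "star k = k" using h a by (auto simp: k_def)
  have comm: "k * a = a * k"
    using h(7)[of a a] h(5)[of a] a A'(3) by (simp add: k_def)
  have sq: "k * k = a * (a - a * (a * a))"
    using h(6)[of a "h a"] h(1,4,8) a by (simp add: k_def)
  define b \<kappa> where "b = \<sigma> a" and "\<kappa> = \<sigma> k"
  have b: "star b = b" "star \<kappa> = \<kappa>"
    using \<sigma>'(3)[OF a(1)] \<sigma>'(3)[OF k(1)] a k by (auto simp: b_def \<kappa>_def)
  have comm': "\<kappa> * b = b * \<kappa>"
    using comm \<sigma>'(2) a k by (metis b_def \<kappa>_def)
  have sq': "\<kappa> * \<kappa> = b * b - b * (b * (b * b))"
  proof -
    have "\<sigma> (k * k) = \<sigma> a * \<sigma> (a - a * (a * a))"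
      unfolding sq using a A'(3) cvec.subspace_diff[OF A'(1)] by (intro \<sigma>'(2)) auto
    also have "\<sigma> (a - a * (a * a)) = \<sigma> a - \<sigma> a * (\<sigma> a * \<sigma> a)"
      using a A'(3) lin(5) \<sigma>'(2) by simp
    finally show ?thesis using k by (simp add: \<sigma>'(2) b_def \<kappa>_def right_diff_distrib)
  qed
  define w where "w = b * b + \<i> *\<^sub>C \<kappa>"
  have star_w: "star w = b * b - \<i> *\<^sub>C \<kappa>"
    by (simp add: w_def star_add star_mult star_scaleC b cvec.scale_minus_left)
  have "star w * w = b * b * (b * b) + \<kappa> * \<kappa> + (\<i> *\<^sub>C (b * b * \<kappa>) - \<i> *\<^sub>C (\<kappa> * (b * b)))"
    unfolding star_w unfolding w_def
    by (simp add: distrib_left distrib_right left_diff_distrib right_diff_distrib scaleC_mult_left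
        scaleC_mult_right scaleC_scaleC cvec.scale_minus_left scaleC_one cvec.scale_right_diff_distrib)
  also have "\<kappa> * (b * b) = b * b * \<kappa>"
    using comm' by (metis mult.assoc)
  finally have "star w * w = b * b"
    by (simp add: sq' mult.assoc)
  hence "(norm w)\<^sup>2 = (norm b)\<^sup>2"
    using cstar_identity[of w] cstar_identity[of b] b by simp
  hence w: "norm w = norm b" by simp
  \<comment> \<open>The real part of w is b^2 while norm w = norm b, so the square of norm b is at
    most norm b.\<close>
  have "2 * norm b * norm b = norm (w + star w)"
  proof -
    have "w + star w = 2 *\<^sub>R (b * b)"
      by (simp only: star_w) (simp add: w_def scaleR_2)
    moreover have "norm (b * b) = norm b * norm b"
      using cstar_identity[of b] b by (simp add: power2_eq_square)
    ultimately show ?thesis by simp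
  qed
  also have "\<dots> \<le> norm b + norm b"
    using norm_triangle_ineq[of w "star w"] w by simp
  finally have "norm b * norm b \<le> 1 * norm b" by simp
  thus ?thesis unfolding b_def[symmetric]
    by (cases "norm b = 0") (simp, metis mult_le_cancel_right norm_ge_zero order_le_less)
qed

lemma star_hom_contractive:
  fixes \<sigma> :: "'a::cstar_algebra \<Rightarrow> 'b::cstar_algebra"
  assumes \<sigma>: "star_hom_on A \<sigma>" and A: "cstar_subalgebra A" and a: "a \<in> A"
  shows "norm (\<sigma> a) \<le> norm a"
proof -
  note A' = cstar_subalgebraD[OF A]
  note \<sigma>' = star_hom_onD[OF \<sigma>]
  have sa: "norm (\<sigma> c) \<le> norm c" if c: "c \<in> A" "star c = c" for c
  proof (rule dense_ge)
    fix r assume r: "norm c < r"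
    hence r0: "0 < r" by (rule order.strict_trans1[OF norm_ge_zero])
    have mem: "(1 / r) *\<^sub>R c \<in> A"
      using cvec.subspace_scale[OF A'(1) c(1)] by (simp add: scaleR_scaleC)
    have "norm ((1 / r) *\<^sub>R c) < 1"
      using r r0 by (simp add: divide_less_eq)
    moreover have "star ((1 / r) *\<^sub>R c) = (1 / r) *\<^sub>R c"
      by (simp add: star_scaleR c(2))
    ultimately have "norm (\<sigma> ((1 / r) *\<^sub>R c)) \<le> 1"
      by (intro star_hom_contractive_self_adjoint[OF \<sigma> A mem])
    also have "\<sigma> ((1 / r) *\<^sub>R c) = (1 / r) *\<^sub>R \<sigma> c"
      unfolding scaleR_scaleC by (rule clinear_onD(2)[OF \<sigma>'(1) A'(1) c(1)])
    finally show "norm (\<sigma> c) \<le> r" using r0 by (simp add: divide_le_eq)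
  qed
  have aa: "star a * a \<in> A" "star (star a * a) = star a * a"
    using A'(3)[OF A'(4)[OF a] a] by (simp_all add: star_mult star_star)
  have "(norm (\<sigma> a))\<^sup>2 = norm (\<sigma> (star a * a))"
    by (simp only: \<sigma>'(2)[OF A'(4)[OF a] a] \<sigma>'(3)[OF a] cstar_identity)
  also have "\<dots> \<le> (norm a)\<^sup>2"
    using sa[OF aa] by (simp only: cstar_identity)
  finally show ?thesis by (rule power2_le_imp_le) simp
qed

text \<open>The limit function vanishes on \<open>[-r, r]\<close> and has slope one elsewhere; the factor \<open>s\<close> in
  front of \<open>q\<^sub>n(s)\<close> makes the polynomials applicable without a unit.\<close>

lemma ex_cutoff_polys:
  fixes r m :: real
  assumes r: "0 \<le> r" "r \<le> m"
  obtains q :: "nat \<Rightarrow> real poly" where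
    "\<And>n s. \<bar>s\<bar> \<le> m \<Longrightarrow> \<bar>s * poly (q n) s - (s - max (- r) (min r s))\<bar> \<le> 1 / real (n + 1)"
proof -
  define f where "f s = s - max (- r) (min r s)" for s :: real
  have "\<exists>q. \<forall>s. \<bar>s\<bar> \<le> m \<longrightarrow> \<bar>s * poly q s - f s\<bar> \<le> 1 / real (n + 1)" for n
  proof -
    \<comment> \<open>Half of the tolerance only: the approximant loses its constant term, which is
      itself within the other half of f 0 = 0.\<close>
    obtain g where g: "real_polynomial_function g"
      "\<And>s. s \<in> {-m..m} \<Longrightarrow> \<bar>f s - g s\<bar> < 1 / real (n + 1) / 2"
      by (rule Stone_Weierstrass_real_polynomial_function[of "{-m..m}" f "1 / real (n + 1) / 2"])
        (auto intro!: continuous_intros simp: f_def)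
    obtain a N where ga: "g = (\<lambda>x. \<Sum>i\<le>N. a i * x ^ i)"
      using g(1) by (auto simp: real_polynomial_function_iff_sum)
    define P where "P = (\<Sum>i\<le>N. monom (a i) i)"
    have P: "g s = poly P s" for s
      by (simp add: ga P_def poly_sum poly_monom)
    obtain c q where q: "P = pCons c q" by (rule pCons_cases)
    have "\<bar>s * poly q s - f s\<bar> \<le> 1 / real (n + 1)" if s: "\<bar>s\<bar> \<le> m" for s
    proof -
      have "\<bar>f s - g s\<bar> < 1 / real (n + 1) / 2" using s by (intro g) auto
      moreover have "\<bar>f 0 - g 0\<bar> < 1 / real (n + 1) / 2" using r by (intro g) auto
      moreover have "f 0 = 0" using r by (simp add: f_def)
      moreover have "g 0 = c" "g s = c + s * poly q s" by (simp_all add: P q)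
      moreover have "\<bar>u - fs\<bar> \<le> d"
        if "\<bar>fs - gs\<bar> < d / 2" "\<bar>0 - b\<bar> < d / 2" "gs = b + u" for d fs gs b u :: real
        using that by linarith
      ultimately show ?thesis by metis
    qed
    thus ?thesis by blast
  qed
  hence "\<exists>q. \<forall>n s. \<bar>s\<bar> \<le> m \<longrightarrow> \<bar>s * poly (q n) s - f s\<bar> \<le> 1 / real (n + 1)"
    by (rule choice[OF allI])
  then obtain q where "\<And>n s. \<bar>s\<bar> \<le> m \<Longrightarrow> \<bar>s * poly (q n) s - f s\<bar> \<le> 1 / real (n + 1)"
    by blast
  thus ?thesis using that unfolding f_def by blast
qed

text \<open>Uniform convergence on [-m, m] with m > norm c makes the elements c q_n(c) a Cauchy
  sequence. Its limit l is the cutoff function applied to c, and c - l is c truncated to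
  [-r, r].\<close>

lemma cutoff_convergent:
  fixes c :: "'a::cstar_algebra"
  assumes r: "0 \<le> r" and c: "star c = c" "norm c < m"
    and q: "\<And>n s. \<bar>s\<bar> \<le> m \<Longrightarrow> \<bar>s * poly (q n) s - (s - max (- r) (min r s))\<bar> \<le> 1 / real (n + 1)"
  obtains l where "(\<lambda>n. poly_act (q n) c c) \<longlonglongrightarrow> l" "norm (c - l) \<le> r"
proof -
  have diff: "norm (poly_act (q n) c c - poly_act (q k) c c) \<le> 1 / real (n + 1) + 1 / real (k + 1)" for n k
    unfolding poly_act_diff[symmetric]
  proof (rule poly_act_self_bound[OF c])
    fix s assume "\<bar>s\<bar> \<le> m"
    from q[OF this, of n] q[OF this, of k]
    show "\<bar>s * poly (q n - q k) s\<bar> \<le> 1 / real (n + 1) + 1 / real (k + 1)"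
      by (simp only: poly_diff right_diff_distrib)
  qed
  have lim0: "(\<lambda>n. 1 / real (n + 1)) \<longlonglongrightarrow> 0"
    using LIMSEQ_inverse_real_of_nat unfolding inverse_eq_divide Suc_eq_plus1 .
  have "Cauchy (\<lambda>n. poly_act (q n) c c)"
  proof (rule CauchyI)
    fix e :: real assume "0 < e"
    hence "\<forall>\<^sub>F n in sequentially. 1 / real (n + 1) < e / 2"
      by (intro order_tendstoD(2)[OF lim0]) simp
    then obtain N where N: "\<And>n. n \<ge> N \<Longrightarrow> 1 / real (n + 1) < e / 2"
      by (auto simp: eventually_sequentially)
    have "norm (poly_act (q n) c c - poly_act (q k) c c) < e" if "n \<ge> N" "k \<ge> N" for n k
      using diff[of n k] N[OF that(1)] N[OF that(2)] by linarith
    thus "\<exists>M. \<forall>n\<ge>M. \<forall>k\<ge>M. norm (poly_act (q n) c c - poly_act (q k) c c) < e" by blast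
  qed
  then obtain l where l: "(\<lambda>n. poly_act (q n) c c) \<longlonglongrightarrow> l"
    unfolding Cauchy_convergent_iff convergent_def by blast
  have "norm (c - poly_act (q n) c c) \<le> r + 1 / real (n + 1)" for n
  proof -
    have "norm (poly_act (1 - q n) c c) \<le> r + 1 / real (n + 1)"
    proof (rule poly_act_self_bound[OF c])
      fix s assume "\<bar>s\<bar> \<le> m"
      from q[OF this, of n] r show "\<bar>s * poly (1 - q n) s\<bar> \<le> r + 1 / real (n + 1)"
        by (simp only: poly_diff right_diff_distrib poly_1 mult_1_right)
    qed
    thus ?thesis by (simp add: poly_act_diff)
  qed
  moreover have "(\<lambda>n. norm (c - poly_act (q n) c c)) \<longlonglongrightarrow> norm (c - l)"
    by (intro tendsto_intros l)
  moreover have "(\<lambda>n. r + 1 / real (n + 1)) \<longlonglongrightarrow> r + 0"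
    by (intro tendsto_intros lim0)
  ultimately have "norm (c - l) \<le> r + 0"
    by (intro LIMSEQ_le) auto
  thus ?thesis using that l by simp
qed

text \<open>If norm(\<sigma> c) < r, the cutoff at r annihilates \<sigma> c. As \<sigma> is
  continuous, respects polynomials and is injective, the cutoff annihilates c too, whence norm c
  \<le> r.\<close>

lemma star_hom_isometric:
  fixes \<sigma> :: "'a::cstar_algebra \<Rightarrow> 'b::cstar_algebra"
  assumes \<sigma>: "star_hom_on A \<sigma>" and A: "cstar_subalgebra A" and inj: "inj_on \<sigma> A" and a: "a \<in> A"
  shows "norm (\<sigma> a) = norm a"
proof -
  note A' = cstar_subalgebraD[OF A]
  note \<sigma>' = star_hom_onD[OF \<sigma>]
  note lin = clinear_onD[OF \<sigma>'(1) A'(1)]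
  have sa: "norm c \<le> norm (\<sigma> c)" if c: "c \<in> A" "star c = c" for c
  proof (rule dense_ge)
    fix r assume r: "norm (\<sigma> c) < r"
    hence r0: "0 \<le> r" by (intro less_imp_le order.strict_trans1[OF norm_ge_zero])
    \<comment> \<open>The polynomials must be controlled on [-r, r] for \<sigma> c and beyond norm c
      for c.\<close>
    define m where "m = max r (norm c + 1)"
    obtain q where q: "\<And>n s. \<bar>s\<bar> \<le> m \<Longrightarrow> \<bar>s * poly (q n) s - (s - max (- r) (min r s))\<bar> \<le> 1 / real (n + 1)"
      by (rule ex_cutoff_polys[of r m]) (auto simp: m_def r0)
    have "norm c < m" by (simp add: m_def)
    then obtain l where l: "(\<lambda>n. poly_act (q n) c c) \<longlonglongrightarrow> l" "norm (c - l) \<le> r"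
      using cutoff_convergent[OF r0 c(2) _ q] by blast
    have mem: "poly_act (q n) c c \<in> A" for n
      by (rule poly_act_closed) (use A' c in auto)
    hence lA: "l \<in> A" using closed_sequentially[OF A'(2) _ l(1)] by blast
    have small: "norm (\<sigma> (poly_act (q n) c c)) \<le> 1 / real (n + 1)" for n
      unfolding star_hom_poly_act[OF \<sigma> A c(1) c(1)]
    proof (rule poly_act_self_bound[OF _ r])
      show "star (\<sigma> c) = \<sigma> c" using \<sigma>'(3)[OF c(1)] c(2) by simp
      fix s assume s: "\<bar>s\<bar> \<le> r"
      have "\<bar>s\<bar> \<le> m" using s by (simp add: m_def)
      from q[OF this, of n] s show "\<bar>s * poly (q n) s\<bar> \<le> 1 / real (n + 1)" by linarith
    qed
    have "norm (\<sigma> l) \<le> 0"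
    proof (rule LIMSEQ_le[of "\<lambda>_. norm (\<sigma> l)" _ "\<lambda>n. 1 / real (n + 1) + norm (poly_act (q n) c c - l)"])
      have "(\<lambda>n. 1 / real (n + 1)) \<longlonglongrightarrow> 0"
        using LIMSEQ_inverse_real_of_nat unfolding inverse_eq_divide Suc_eq_plus1 .
      from tendsto_add[OF this tendsto_norm_zero[OF LIM_zero[OF l(1)]]]
      show "(\<lambda>n. 1 / real (n + 1) + norm (poly_act (q n) c c - l)) \<longlonglongrightarrow> 0" by simp
      have "norm (\<sigma> l) \<le> 1 / real (n + 1) + norm (poly_act (q n) c c - l)" for n
      proof -
        have "norm (\<sigma> (poly_act (q n) c c) - \<sigma> l) \<le> norm (poly_act (q n) c c - l)"
          using star_hom_contractive[OF \<sigma> A cvec.subspace_diff[OF A'(1) mem[of n] lA]] lin(5)[OF mem[of n] lA] by simp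
        thus ?thesis using small[of n] norm_triangle_ineq2[of "\<sigma> l" "\<sigma> (poly_act (q n) c c)"]
          by (simp add: norm_minus_commute)
      qed
      thus "\<exists>N. \<forall>n\<ge>N. norm (\<sigma> l) \<le> 1 / real (n + 1) + norm (poly_act (q n) c c - l)" by blast
    qed auto
    hence "\<sigma> l = \<sigma> 0" using lin(3) by simp
    hence "l = 0" using inj lA cvec.subspace_0[OF A'(1)] by (auto dest: inj_onD)
    thus "norm c \<le> r" using l(2) by simp
  qed
  have aa: "star a * a \<in> A" "star (star a * a) = star a * a"
    using A'(3)[OF A'(4)[OF a] a] by (simp_all add: star_mult star_star)
  have "(norm a)\<^sup>2 \<le> norm (\<sigma> (star a * a))"
    using sa[OF aa] by (simp only: cstar_identity)
  also have "\<dots> = (norm (\<sigma> a))\<^sup>2"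
    by (simp only: \<sigma>'(2)[OF A'(4)[OF a] a] \<sigma>'(3)[OF a] cstar_identity)
  finally have "norm a \<le> norm (\<sigma> a)" by (rule power2_le_imp_le) simp
  thus ?thesis using star_hom_contractive[OF \<sigma> A a] by simp
qed

section \<open>Approximate units\<close>

lemma ex_poly_peak:
  fixes e :: real
  assumes "0 < e"
  obtains p :: "real poly" where "poly p 0 = 1"
    "\<And>s. \<bar>s\<bar> \<le> 1 \<Longrightarrow> \<bar>poly p s\<bar> \<le> 1" "\<And>s. \<bar>s\<bar> \<le> 1 \<Longrightarrow> \<bar>s * poly p s * poly p s\<bar> \<le> e"
proof -
  \<comment> \<open>For \<bar>s\<bar> > e this gives N s^2 \<ge> 1/e, and Bernoulli's inequality for
    (1 + s^2)^N then yields (1 - s^2)^N \<le> e.\<close>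
  obtain N :: nat where N: "1 / e ^ 3 < real N" using reals_Archimedean2 by blast
  let ?p = "[:1, 0, -1:] ^ N :: real poly"
  have p: "poly ?p s = (1 - s\<^sup>2) ^ N" for s
    by (simp add: poly_power power2_eq_square)
  have sq: "0 \<le> 1 - s\<^sup>2" "1 - s\<^sup>2 \<le> 1" if "\<bar>s\<bar> \<le> 1" for s :: real
    using that by (auto simp: abs_square_le_1)
  have le1: "\<bar>poly ?p s\<bar> \<le> 1" if "\<bar>s\<bar> \<le> 1" for s
    unfolding p using sq[OF that] by (simp add: power_le_one del: power_abs)
  have "\<bar>s * poly ?p s * poly ?p s\<bar> \<le> e" if s: "\<bar>s\<bar> \<le> 1" for s
  proof (cases "\<bar>s\<bar> \<le> e")
    case True
    have "\<bar>s\<bar> * \<bar>poly ?p s\<bar> * \<bar>poly ?p s\<bar> \<le> e * 1 * 1"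
      using True assms le1[OF s] by (intro mult_mono) auto
    thus ?thesis by (simp add: abs_mult)
  next
    case False
    have "(1 + real N * s\<^sup>2) * (1 - s\<^sup>2) ^ N \<le> (1 + s\<^sup>2) ^ N * (1 - s\<^sup>2) ^ N"
      using sq[OF s] by (intro mult_right_mono Bernoulli_inequality) (auto simp: order_trans[OF _ zero_le_power2])
    also have "\<dots> = ((1 + s\<^sup>2) * (1 - s\<^sup>2)) ^ N" by (simp add: power_mult_distrib)
    also have "\<dots> \<le> 1"
    proof (rule power_le_one)
      show "0 \<le> (1 + s\<^sup>2) * (1 - s\<^sup>2)" using sq[OF s] by (intro mult_nonneg_nonneg) auto
      show "(1 + s\<^sup>2) * (1 - s\<^sup>2) \<le> 1"
        using zero_le_power2[of "s\<^sup>2"] by (simp add: algebra_simps power2_eq_square del: zero_le_power2)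
    qed
    finally have 1: "(1 + real N * s\<^sup>2) * (1 - s\<^sup>2) ^ N \<le> 1" .
    have "1 / e = 1 / e ^ 3 * e\<^sup>2" using assms by (simp add: field_simps power3_eq_cube power2_eq_square)
    also have "\<dots> \<le> real N * s\<^sup>2"
    proof (intro mult_mono)
      have "e\<^sup>2 \<le> \<bar>s\<bar>\<^sup>2" using False assms by (intro power_mono) auto
      thus "e\<^sup>2 \<le> s\<^sup>2" by simp
    qed (use N assms in auto)
    finally have "1 / e * (1 - s\<^sup>2) ^ N \<le> (1 + real N * s\<^sup>2) * (1 - s\<^sup>2) ^ N"
      using sq[OF s] by (intro mult_right_mono) auto
    hence "1 / e * (1 - s\<^sup>2) ^ N \<le> 1" using 1 by (rule order_trans)
    hence "(1 - s\<^sup>2) ^ N \<le> e" using assms by (simp add: divide_le_eq)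
    hence "\<bar>poly ?p s\<bar> \<le> e" unfolding p using sq[OF s] by simp
    hence "\<bar>s\<bar> * \<bar>poly ?p s\<bar> * \<bar>poly ?p s\<bar> \<le> 1 * e * 1"
      using s le1[OF s] assms by (intro mult_mono) auto
    thus ?thesis by (simp add: abs_mult)
  qed
  thus ?thesis using that[of ?p] le1 by (auto simp: p)
qed

text \<open>A polynomial with value 1 at 0 acts as v + q(k) k v, so that -q(k) k plays the role of a
  unit. Since k = y y*, the vector p(k) y times its adjoint is k p(k)^2, which is small because s
  p(s)^2 is.\<close>

lemma ex_approx_unit:
  fixes y :: "'a::cstar_algebra"
  assumes e: "0 < e"
  defines "k \<equiv> y * star y"
  obtains p where "\<And>v. norm (v + poly_act p k k * v) \<le> norm v" "norm (y + poly_act p k k * y) \<le> e"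
proof -
  \<comment> \<open>Scales y to norm below 1, so that the bounds on [-1, 1] apply to l; the summand
    1 covers y = 0.\<close>
  define s where "s = 1 / (norm y + 1)"
  have s: "0 < s" using norm_ge_zero[of y] unfolding s_def by (intro divide_pos_pos) linarith+
  define x where "x = s *\<^sub>R y"
  have x1: "norm x < 1"
    using norm_ge_zero[of y] by (simp add: x_def s_def divide_less_eq add_nonneg_pos)
  define l where "l = x * star x"
  have l: "star l = l" by (simp add: l_def star_mult star_star)
  have l_k: "l = s\<^sup>2 *\<^sub>R k" by (simp add: l_def x_def k_def star_scaleR power2_eq_square)
  have nl: "norm l < 1" using x1 by (simp add: l_def norm_mult_star power_less_one_iff)
  \<comment> \<open>The fourth power compensates for two uses of the C*-identity, first on w and
    then on \<open>star x * z\<close>.\<close>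
  have pos: "0 < (s * e) ^ 4" using s e by simp
  obtain p where p: "poly p 0 = 1" "\<And>s. \<bar>s\<bar> \<le> 1 \<Longrightarrow> \<bar>poly p s\<bar> \<le> 1"
    "\<And>z. \<bar>z\<bar> \<le> 1 \<Longrightarrow> \<bar>z * poly p z * poly p z\<bar> \<le> (s * e) ^ 4"
    by (fact ex_poly_peak[OF pos])
  have bnd: "norm (poly_act f l v) \<le> M * norm v"
    if "\<And>s. \<bar>s\<bar> \<le> 1 \<Longrightarrow> \<bar>poly f s\<bar> \<le> M" for f M and v :: 'a
    by (rule poly_act_bound[of UNIV l "norm l" 1])
      (use that l nl in \<open>auto intro: cvec.subspaceI norm_mult_ineq\<close>)
  have contr: "norm (poly_act p l v) \<le> norm v" for v
    using bnd[of p 1 v] p by simp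
  define w where "w = poly_act p l x"
  define z where "z = poly_act p l w"
  have z: "norm z \<le> norm x" using contr[of w] contr[of x] by (simp add: z_def w_def)
  have "norm (poly_act ([:0, 1:] * p * p) l x) \<le> (s * e) ^ 4 * norm x"
    using p(3) by (intro bnd) (simp add: mult.assoc)
  also have "poly_act ([:0, 1:] * p * p) l x = l * z"
    by (simp add: z_def w_def poly_act_mult)
  also have "(s * e) ^ 4 * norm x \<le> (s * e) ^ 4"
    using x1 s e by (simp add: mult_left_le)
  finally have lz: "norm (l * z) \<le> (s * e) ^ 4" .
  have "(norm w)\<^sup>2 = norm (star x * z)"
    by (simp add: w_def z_def poly_act_star[OF l] flip: cstar_identity)
  moreover have "(norm w) ^ 4 = ((norm w)\<^sup>2)\<^sup>2"
    by (simp flip: power_mult)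
  ultimately have "(norm w) ^ 4 = (norm (star x * z))\<^sup>2"
    by simp
  also have "\<dots> = norm (star z * (l * z))"
    by (simp add: star_mult star_star l_def mult.assoc flip: cstar_identity)
  also have "\<dots> \<le> norm z * norm (l * z)"
    using norm_mult_ineq[of "star z" "l * z"] by simp
  also have "\<dots> \<le> 1 * (s * e) ^ 4"
    using z x1 lz by (intro mult_mono) auto
  finally have "norm w \<le> s * e"
    using s e by (simp add: power_mono_iff)
  have w_y: "w = s *\<^sub>R poly_act p l y" by (simp add: w_def x_def poly_act_scaleR_right)
  have small: "norm (poly_act p l y) \<le> e"
    using \<open>norm w \<le> s * e\<close> s by (simp add: w_y)
  define q where "q = p \<circ>\<^sub>p [:0, s\<^sup>2:]"
  have q: "poly_act q k v = poly_act p l v" for v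
    by (simp add: q_def l_k poly_act_scaleR_left)
  obtain a q' where q': "q = pCons a q'" by (rule pCons_cases)
  have "poly q 0 = 1" by (simp add: q_def poly_pcompose p)
  hence a: "a = 1" by (simp add: q')
  have "poly_act q k v = v + poly_act q' k k * v" for v
    by (simp add: q' a flip: poly_act_mult_right poly_act_mult_self)
  thus ?thesis using that[of q'] contr small by (simp flip: q)
qed

section \<open>Ternary spaces and the induced map on compact operators\<close>

lemma closed_span_mult:
  fixes C :: "'a::cstar_algebra set"
  assumes C: "csubspace C" "closed C" and SR: "\<And>a b. a \<in> S \<Longrightarrow> b \<in> R \<Longrightarrow> a * b \<in> C"
    and a: "a \<in> closure (cspan S)" and b: "b \<in> closure (cspan R)"
  shows "a * b \<in> C"
proof -
  have 1: "x * y \<in> C" if "x \<in> S" "y \<in> cspan R" for x y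
    using that(2)
    by (induction rule: cvec.span_induct_alt)
      (auto simp: distrib_left scaleC_mult_right intro!: cvec.subspace_0 cvec.subspace_add
        cvec.subspace_scale C SR that)
  have 2: "x * y \<in> C" if "x \<in> cspan S" "y \<in> cspan R" for x y
    using that(1)
    by (induction rule: cvec.span_induct_alt)
      (auto simp: distrib_right scaleC_mult_left intro!: cvec.subspace_0 cvec.subspace_add
        cvec.subspace_scale C 1 that)
  obtain f g where "\<And>n. f n \<in> cspan S" "f \<longlonglongrightarrow> a" "\<And>n. g n \<in> cspan R" "g \<longlonglongrightarrow> b"
    using a b by (auto simp: closure_sequential)
  thus ?thesis
    using closed_sequentially[OF C(2) _ tendsto_mult[of f a sequentially g b]] 2 by blast
qed

lemma closed_span_star:
  fixes S :: "'a::cstar_algebra set"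
  assumes C: "csubspace C" "closed C" and S: "\<And>a. a \<in> S \<Longrightarrow> star a \<in> C"
    and a: "a \<in> closure (cspan S)"
  shows "star a \<in> C"
proof -
  have 1: "star x \<in> C" if "x \<in> cspan S" for x
    using that
    by (induction rule: cvec.span_induct_alt)
      (auto simp: star_add star_scaleC intro!: cvec.subspace_0 cvec.subspace_add
        cvec.subspace_scale C S)
  obtain f where "\<And>n. f n \<in> cspan S" "f \<longlonglongrightarrow> a"
    using a by (auto simp: closure_sequential)
  thus ?thesis
    using closed_sequentially[OF C(2) _ tendsto_star[of f a sequentially]] 1 by blast
qed

lemma closed_span_least:
  fixes C :: "'a::cstar_algebra set"
  assumes "csubspace C" "closed C" "S \<subseteq> C"
  shows "closure (cspan S) \<subseteq> C"
  using assms by (intro closure_minimal cvec.span_minimal)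

lemma closed_span_base: "x \<in> S \<Longrightarrow> x \<in> closure (cspan S)" for S :: "'a::cstar_algebra set"
  using closure_subset cvec.span_base by blast

text \<open>For T = t(X) these are the elements that represent the rank one operators
  \<open>theta\<close>.\<close>

definition ketbras :: "'a::cstar_algebra set \<Rightarrow> 'a set"
  where "ketbras T = {x * star y |x y. x \<in> T \<and> y \<in> T}"

text \<open>A Hilbert module realized inside a C*-algebra, with inner product x* y; K is its algebra
  of compact operators. The instances are t(X) and the closed spans of n-fold products of its
  elements.\<close>

locale ternary_space =
  fixes T :: "'a::cstar_algebra set"
  assumes sub: "csubspace T" and closed: "closed T"
    and triple: "\<And>x y z. x \<in> T \<Longrightarrow> y \<in> T \<Longrightarrow> z \<in> T \<Longrightarrow> x * star y * z \<in> T"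
begin

definition K :: "'a set"
  where "K = closure (cspan (ketbras T))"

lemma K_subspace: "csubspace K" and K_closed: "closed K"
  by (simp_all add: K_def)

lemma ketbra_in_K: "x \<in> T \<Longrightarrow> y \<in> T \<Longrightarrow> x * star y \<in> K"
  unfolding K_def by (rule closed_span_base) (auto simp: ketbras_def)

lemma K_mult_T: "b \<in> K \<Longrightarrow> z \<in> T \<Longrightarrow> b * z \<in> T"
  unfolding K_def
  by (rule closed_span_mult[OF sub closed, of "ketbras T" T])
    (auto simp: ketbras_def triple intro: closed_span_base)

lemma K_star: "b \<in> K \<Longrightarrow> star b \<in> K"
proof -
  assume "b \<in> K"
  moreover have "star a \<in> K" if "a \<in> ketbras T" for a
    using that ketbra_in_K by (auto simp: ketbras_def star_mult star_star)
  ultimately show ?thesis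
    using closed_span_star[OF K_subspace K_closed] unfolding K_def by blast
qed

lemma K_mult: "b \<in> K \<Longrightarrow> c \<in> K \<Longrightarrow> b * c \<in> K"
proof -
  assume "b \<in> K" "c \<in> K"
  moreover have "a * d \<in> K" if "a \<in> ketbras T" "d \<in> ketbras T" for a d
    using that ketbra_in_K triple by (auto simp: ketbras_def mult.assoc[symmetric])
  ultimately show ?thesis
    using closed_span_mult[OF K_subspace K_closed] unfolding K_def by blast
qed

text \<open>The power trick for \<open>b b*\<close>: although \<open>b\<close> is only controlled on \<open>T\<close>, the range of \<open>b\<close> lies in
  the right ideal generated by \<open>T\<close>.\<close>

lemma span_ketbras_norm_le:
  assumes b: "b \<in> cspan (ketbras T)" and e: "0 < e"
    and bound: "\<And>z. z \<in> T \<Longrightarrow> norm (b * z) \<le> e * norm z"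
  shows "norm b \<le> e"
proof -
  have bK: "b \<in> K" using b closure_subset by (auto simp: K_def)
  define a where "a = b * star b"
  have a: "star a = a" by (simp add: a_def star_mult star_star)
  \<comment> \<open>The bound passes to the adjoint because \<open>star b\<close> maps T into T,
    where the bound for b applies again.\<close>
  have star_b: "norm (star b * w) \<le> e * norm w" if w: "w \<in> T" for w
  proof -
    have bw: "star b * w \<in> T" by (intro K_mult_T K_star bK w)
    have "(norm (star b * w))\<^sup>2 = norm (star w * (b * (star b * w)))"
      by (simp add: star_mult star_star mult.assoc flip: cstar_identity)
    also have "\<dots> \<le> norm w * norm (b * (star b * w))"
      using norm_mult_ineq[of "star w" "b * (star b * w)"] by simp
    also have "\<dots> \<le> norm w * (e * norm (star b * w))"
      using bound[OF bw] by (rule mult_left_mono) simp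
    finally have "norm (star b * w) * norm (star b * w) \<le> e * norm w * norm (star b * w)"
      by (simp add: power2_eq_square mult_ac)
    thus ?thesis using e by (cases "norm (star b * w) = 0") auto
  qed
  have aT: "a * z \<in> T" "norm (a * z) \<le> e\<^sup>2 * norm z" if z: "z \<in> T" for z
  proof -
    have bz: "star b * z \<in> T" by (intro K_mult_T K_star bK z)
    show "a * z \<in> T" unfolding a_def mult.assoc by (intro K_mult_T bK bz)
    have "norm (a * z) \<le> e * norm (star b * z)"
      using bound[OF bz] by (simp add: a_def mult.assoc)
    also have "\<dots> \<le> e * (e * norm z)"
      using star_b[OF z] e by (intro mult_left_mono) auto
    finally show "norm (a * z) \<le> e\<^sup>2 * norm z" by (simp add: power2_eq_square)
  qed
  let ?m = "\<lambda>n. monom 1 n :: real poly"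
  have pow: "poly_act (?m n) a z \<in> T \<and> norm (poly_act (?m n) a z) \<le> (e\<^sup>2) ^ n * norm z"
    if z: "z \<in> T" for n z
  proof (induction n)
    case 0
    show ?case using z by (simp add: monom_0)
  next
    case (Suc n)
    have "norm (a * poly_act (?m n) a z) \<le> e\<^sup>2 * norm (poly_act (?m n) a z)"
      using Suc by (intro aT) auto
    also have "\<dots> \<le> e\<^sup>2 * ((e\<^sup>2) ^ n * norm z)"
      using Suc by (intro mult_left_mono) auto
    finally show ?case using Suc aT by (simp add: monom_Suc)
  qed
  \<comment> \<open>b is a finite sum of products u v*, so p(a) b d is controlled by p(a) on the
    finitely many u in T. The constant depends on b only.\<close>
  have "\<exists>C\<ge>0. \<forall>p r d. (\<forall>z\<in>T. norm (poly_act p a z) \<le> r * norm z) \<longrightarrow>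
      norm (poly_act p a (b * d)) \<le> C * r * norm d"
    using b
  proof (induction rule: cvec.span_induct_alt)
    case base
    show ?case by (intro exI[of _ 0]) simp
  next
    case (step c x y)
    obtain u v where x: "x = u * star v" "u \<in> T" "v \<in> T"
      using step by (auto simp: ketbras_def)
    obtain C where C: "0 \<le> C" "\<And>p r d. (\<forall>z\<in>T. norm (poly_act p a z) \<le> r * norm z) \<Longrightarrow>
      norm (poly_act p a (y * d)) \<le> C * r * norm d"
      using step.IH by blast
    have "norm (poly_act p a ((c *\<^sub>C x + y) * d)) \<le> (cmod c * norm u * norm v + C) * r * norm d"
      if r: "\<forall>z\<in>T. norm (poly_act p a z) \<le> r * norm z" for p r d
    proof -
      have "norm (poly_act p a u * (star v * d)) \<le> norm (poly_act p a u) * norm (star v * d)"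
        by (rule norm_mult_ineq)
      also have "\<dots> \<le> (r * norm u) * (norm v * norm d)"
        using r x(2) norm_mult_ineq[of "star v" d] order_trans[OF norm_ge_zero bspec[OF r x(2)]]
        by (intro mult_mono) auto
      finally have A: "cmod c * norm (poly_act p a u * (star v * d)) \<le>
          cmod c * ((r * norm u) * (norm v * norm d))"
        by (rule mult_left_mono) simp
      have "poly_act p a ((c *\<^sub>C x + y) * d) =
          c *\<^sub>C (poly_act p a u * (star v * d)) + poly_act p a (y * d)"
        by (simp add: x distrib_right scaleC_mult_left poly_act_add_right poly_act_scaleC_right
            poly_act_mult_right mult.assoc)
      hence "norm (poly_act p a ((c *\<^sub>C x + y) * d)) \<le>
          cmod c * norm (poly_act p a u * (star v * d)) + norm (poly_act p a (y * d))"
        using norm_triangle_ineq[of "c *\<^sub>C (poly_act p a u * (star v * d))" "poly_act p a (y * d)"]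
        by (simp add: norm_scaleC)
      also have "\<dots> \<le> cmod c * ((r * norm u) * (norm v * norm d)) + C * r * norm d"
        using A C(2)[OF r] by (rule add_mono)
      finally show ?thesis by (simp add: algebra_simps)
    qed
    thus ?case using C(1) by (intro exI[of _ "cmod c * norm u * norm v + C"]) simp
  qed
  then obtain C where C: "0 \<le> C" "\<And>p r d. (\<forall>z\<in>T. norm (poly_act p a z) \<le> r * norm z) \<Longrightarrow>
      norm (poly_act p a (b * d)) \<le> C * r * norm d"
    by blast
  \<comment> \<open>a^(k+1) v is a^k b applied to b* v: one factor a is spent on reaching the range
    of b, which costs the division by e^2. The maximum with 1 covers exponent 0.\<close>
  define C' where "C' = max 1 (C * norm b / e\<^sup>2)"
  have "norm (a * a) \<le> e\<^sup>2 * norm a"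
  proof (rule norm_self_adjoint_le[where V = UNIV and C = C' and S = "(*) a" and v = a])
    show "norm ((((*) a) ^^ n) v) \<le> C' * real (n + 1) * (e\<^sup>2) ^ n * norm v" for n v
    proof (cases n)
      case 0
      have "1 * norm v \<le> C' * norm v" by (rule mult_right_mono) (simp_all add: C'_def)
      thus ?thesis using 0 by simp
    next
      case (Suc k)
      have "((*) a ^^ n) v = poly_act (?m k) a (b * (star b * v))"
      proof -
        have "((*) a ^^ k) w = poly_act (?m k) a w" for w
          by (induction k) (auto simp: monom_0 monom_Suc)
        from this[of "a * v"] show ?thesis
          by (simp only: Suc funpow_Suc_right o_apply) (simp only: a_def mult.assoc)
      qed
      also have "norm \<dots> \<le> C * (e\<^sup>2) ^ k * norm (star b * v)"
        by (rule C(2)) (use pow in blast)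
      also have "\<dots> \<le> C * (e\<^sup>2) ^ k * (norm b * norm v)"
        using norm_mult_ineq[of "star b" v] C(1) by (intro mult_left_mono) auto
      also have "\<dots> = (C * norm b / e\<^sup>2) * (e\<^sup>2) ^ n * norm v"
        using e by (simp add: Suc)
      also have "\<dots> \<le> (C' * real (n + 1)) * (e\<^sup>2) ^ n * norm v"
      proof (intro mult_right_mono)
        have "C * norm b / e\<^sup>2 \<le> C' * 1" "1 \<le> C'" by (simp_all add: C'_def)
        moreover have "C' * 1 \<le> C' * real (n + 1)" using \<open>1 \<le> C'\<close> by (intro mult_left_mono) auto
        ultimately show "C * norm b / e\<^sup>2 \<le> C' * real (n + 1)" by linarith
      qed auto
      finally show ?thesis .
    qed
    show "star (a * v) * w = star v * (a * w)" for v w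
      by (simp add: star_mult a mult.assoc)
  qed simp_all
  moreover have "norm (a * a) = norm a * norm a"
    using cstar_identity[of a] unfolding a power2_eq_square .
  ultimately have "norm a * norm a \<le> e\<^sup>2 * norm a" by simp
  hence "norm a \<le> e\<^sup>2"
    by (cases "a = 0") (simp, rule mult_right_le_imp_le[of _ "norm a"], simp_all only: zero_less_norm_iff not_False_eq_True)
  hence "(norm b)\<^sup>2 \<le> e\<^sup>2" unfolding a_def norm_mult_star .
  thus ?thesis using less_imp_le[OF e] by (rule power2_le_imp_le)
qed

text \<open>Approximation from the span. The norm on K is thus the operator norm of its action on T,
  and an element of K is determined by its action.\<close>

lemma K_norm_le:
  assumes b: "b \<in> K" and e: "0 \<le> e" and bound: "\<And>z. z \<in> T \<Longrightarrow> norm (b * z) \<le> e * norm z"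
  shows "norm b \<le> e"
proof (rule field_le_epsilon)
  fix \<delta> :: real assume \<delta>: "0 < \<delta>"
  obtain c where c: "c \<in> cspan (ketbras T)" "dist c b < \<delta> / 2"
    using b \<delta> unfolding K_def closure_approachable by (meson half_gt_zero)
  have cb: "norm (c - b) \<le> \<delta> / 2" using c(2) by (simp add: dist_norm)
  have "norm c \<le> e + \<delta> / 2"
  proof (rule span_ketbras_norm_le[OF c(1)])
    fix z assume z: "z \<in> T"
    have "norm (c * z) \<le> norm (b * z) + norm ((c - b) * z)"
      using norm_triangle_ineq[of "b * z" "(c - b) * z"] by (simp add: algebra_simps)
    also have "\<dots> \<le> e * norm z + \<delta> / 2 * norm z"
      using bound[OF z] order_trans[OF norm_mult_ineq mult_right_mono[OF cb norm_ge_zero]]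
      by (intro add_mono) auto
    finally show "norm (c * z) \<le> (e + \<delta> / 2) * norm z" by (simp add: algebra_simps)
  qed (use e \<delta> in simp)
  moreover have "norm b \<le> norm c + norm (c - b)"
    using norm_triangle_ineq4[of c "c - b"] by simp
  ultimately show "norm b \<le> e + \<delta>" using cb by linarith
qed

lemma K_eqI:
  assumes "b \<in> K" "c \<in> K" "\<And>z. z \<in> T \<Longrightarrow> b * z = c * z"
  shows "b = c"
  using K_norm_le[of "b - c" 0] cvec.subspace_diff[OF K_subspace assms(1,2)] assms(3)
  by (simp add: left_diff_distrib)

text \<open>One vector at a time: the next step treats the residue y + u y and composes on the left,
  1 + u' = (1 + w)(1 + u). Being a contraction, the new left factor preserves the earlier
  estimates.\<close>

lemma ex_approx_unit_list:
  assumes "set ys \<subseteq> T" "0 < e"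
  shows "\<exists>u\<in>K. (\<forall>v. norm (v + u * v) \<le> norm v) \<and> (\<forall>y\<in>set ys. norm (y + u * y) \<le> e)"
  using assms(1)
proof (induction ys)
  case Nil
  show ?case by (rule bexI[of _ 0]) (auto intro: cvec.subspace_0[OF K_subspace])
next
  case (Cons y ys)
  then obtain u where u: "u \<in> K" "\<And>v. norm (v + u * v) \<le> norm v"
    "\<And>y. y \<in> set ys \<Longrightarrow> norm (y + u * y) \<le> e" by auto
  define z where "z = y + u * y"
  have z: "z \<in> T" unfolding z_def
    using Cons.prems by (intro cvec.subspace_add[OF sub] K_mult_T u) auto
  obtain p where p: "\<And>v. norm (v + poly_act p (z * star z) (z * star z) * v) \<le> norm v"
    "norm (z + poly_act p (z * star z) (z * star z) * z) \<le> e"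
    by (fact ex_approx_unit[OF assms(2), of z])
  define w where "w = poly_act p (z * star z) (z * star z)"
  have w: "w \<in> K" unfolding w_def
    by (intro poly_act_closed K_subspace K_mult ketbra_in_K z)
  define u' where "u' = u + w + w * u"
  have u': "v + u' * v = (v + u * v) + w * (v + u * v)" for v
    by (simp add: u'_def algebra_simps)
  show ?case
  proof (rule bexI[of _ u'], intro conjI allI ballI)
    show "u' \<in> K" unfolding u'_def by (intro cvec.subspace_add[OF K_subspace] K_mult u w)
    show "norm (v + u' * v) \<le> norm v" for v
      unfolding u' using p(1)[of "v + u * v"] u(2)[of v] by (simp add: w_def)
    show "norm (x + u' * x) \<le> e" if "x \<in> set (y # ys)" for x
    proof (cases "x = y")
      case True
      thus ?thesis unfolding u' using p(2) by (simp add: w_def z_def)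
    next
      case False
      thus ?thesis unfolding u' using p(1)[of "x + u * x"] u(3)[of x] that by (simp add: w_def)
    qed
  qed
qed

end

section \<open>The induced map on compact operators\<close>

lemma cspan_list_sums:
  fixes g :: "'x::complex_vector \<Rightarrow> 'y \<Rightarrow> 'z::complex_vector"
  assumes W: "csubspace W" and g: "\<And>c x y. x \<in> W \<Longrightarrow> y \<in> W' \<Longrightarrow> g (c *\<^sub>C x) y = c *\<^sub>C g x y"
    and f: "f \<in> cspan {g x y |x y. x \<in> W \<and> y \<in> W'}"
  obtains s where "set s \<subseteq> W \<times> W'" "f = (\<Sum>(x, y)\<leftarrow>s. g x y)"
proof -
  have "\<exists>s. set s \<subseteq> W \<times> W' \<and> f = (\<Sum>(x, y)\<leftarrow>s. g x y)"
    using f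
  proof (induction rule: cvec.span_induct_alt)
    case base
    show ?case by (rule exI[of _ "[]"]) simp
  next
    case (step c h f')
    then obtain x y s where "h = g x y" "x \<in> W" "y \<in> W'" "set s \<subseteq> W \<times> W'"
      "f' = (\<Sum>(x, y)\<leftarrow>s. g x y)" by blast
    thus ?case
      by (intro exI[of _ "(c *\<^sub>C x, y) # s"]) (auto simp: g cvec.subspace_scale[OF W])
  qed
  thus ?thesis using that by blast
qed

text \<open>Just what transports compact operators along \<tau>. It applies to X with t and to a
  tensor power with \<open>rep_power\<close>, without first proving that the tensor power is a
  correspondence.\<close>

locale corr_embedding =
  fixes E :: "('x::complex_vector, 'a::cstar_algebra) corr" and \<tau> :: "'x \<Rightarrow> 'd::cstar_algebra"
  assumes space: "csubspace (corr_space E)"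
    and linear: "clinear_on (corr_space E) \<tau>"
    and inj: "inj_on \<tau> (corr_space E)"
    and range_closed: "closed (\<tau> ` corr_space E)"
    and norm_eq: "\<And>x. x \<in> corr_space E \<Longrightarrow> corr_norm E x = norm (\<tau> x)"
    and rank_one_closed: "\<And>x y z. x \<in> corr_space E \<Longrightarrow> y \<in> corr_space E \<Longrightarrow> z \<in> corr_space E \<Longrightarrow>
        corr_ract E x (corr_ip E y z) \<in> corr_space E"
    and rank_one: "\<And>x y z. x \<in> corr_space E \<Longrightarrow> y \<in> corr_space E \<Longrightarrow> z \<in> corr_space E \<Longrightarrow>
        \<tau> (corr_ract E x (corr_ip E y z)) = \<tau> x * star (\<tau> y) * \<tau> z"
    and ip_eqI: "\<And>x y x' y'. x \<in> corr_space E \<Longrightarrow> y \<in> corr_space E \<Longrightarrow> x' \<in> corr_space E \<Longrightarrow>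
        y' \<in> corr_space E \<Longrightarrow> star (\<tau> x) * \<tau> y = star (\<tau> x') * \<tau> y' \<Longrightarrow>
        corr_ip E x y = corr_ip E x' y'"
begin

lemmas lin = clinear_onD[OF linear space]

abbreviation W where "W \<equiv> corr_space E"

sublocale ternary_space "\<tau> ` W"
proof
  show "csubspace (\<tau> ` W)"
    using space
    by (auto intro!: cvec.subspaceI simp: lin(1)[symmetric] lin(2)[symmetric] cvec.subspace_add
        cvec.subspace_scale)
      (metis cvec.subspace_0 imageI lin(3))
  show "x * star y * z \<in> \<tau> ` W" if "x \<in> \<tau> ` W" "y \<in> \<tau> ` W" "z \<in> \<tau> ` W" for x y z
    using that rank_one rank_one_closed by (auto simp flip: rank_one)
qed (rule range_closed)

lemma theta_sum:
  assumes "set s \<subseteq> W \<times> W" "z \<in> W"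
  shows "(\<Sum>(x, y)\<leftarrow>s. theta E x y) z \<in> W"
    "\<tau> ((\<Sum>(x, y)\<leftarrow>s. theta E x y) z) = (\<Sum>(x, y)\<leftarrow>s. \<tau> x * star (\<tau> y)) * \<tau> z"
  using assms
proof (induction s)
  case Nil
  { case 1 show ?case by (simp add: zero_fun_def cvec.subspace_0[OF space]) }
  { case 2 show ?case by (simp add: zero_fun_def lin) }
next
  case (Cons p s)
  obtain x y where p: "p = (x, y)" by force
  have xy: "x \<in> W" "y \<in> W" "set s \<subseteq> W \<times> W" if "set (p # s) \<subseteq> W \<times> W" using that by (auto simp: p)
  { case 1 thus ?case using xy[OF 1(1)] Cons.IH(1)
      by (simp add: p theta_def cvec.subspace_add[OF space] rank_one_closed) }
  { case 2 thus ?case using xy[OF 2(1)] Cons.IH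
      by (simp add: p theta_def lin(1) rank_one_closed rank_one distrib_right) }
qed

lemma ketbra_sum_span:
  assumes "set s \<subseteq> W \<times> W"
  shows "(\<Sum>(x, y)\<leftarrow>s. \<tau> x * star (\<tau> y)) \<in> cspan (ketbras (\<tau> ` W))"
  using assms
  by (intro csubspace_sum_list cvec.subspace_span) (auto simp: ketbras_def intro!: cvec.span_base)

lemma span_ketbras_obtain:
  assumes "b \<in> cspan (ketbras (\<tau> ` W))"
  obtains s where "set s \<subseteq> W \<times> W" "b = (\<Sum>(x, y)\<leftarrow>s. \<tau> x * star (\<tau> y))"
proof -
  have scale: "\<tau> (c *\<^sub>C x) * star (\<tau> y) = c *\<^sub>C (\<tau> x * star (\<tau> y))" if "x \<in> W" "y \<in> W" for c x y
    using that by (simp add: lin scaleC_mult_left)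
  have "ketbras (\<tau> ` W) = {\<tau> x * star (\<tau> y) |x y. x \<in> W \<and> y \<in> W}"
    by (auto simp: ketbras_def)
  hence mem: "b \<in> cspan {\<tau> x * star (\<tau> y) |x y. x \<in> W \<and> y \<in> W}" using assms by simp
  show thesis
    by (rule cspan_list_sums[OF space scale mem], assumption, assumption, rule that)
qed

text \<open>The predicate whose unique solution is selected in the definition of \<^const>\<open>psi\<close>.\<close>

definition psi_rel :: "('x \<Rightarrow> 'x) \<Rightarrow> 'd \<Rightarrow> bool"
  where "psi_rel R d \<longleftrightarrow> (\<exists>s :: nat \<Rightarrow> ('x \<times> 'x) list.
    (\<forall>k. set (s k) \<subseteq> W \<times> W) \<and> op_tendsto E (\<lambda>k. \<Sum>(x, y)\<leftarrow>s k. theta E x y) R \<and>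
    (\<lambda>k. \<Sum>(x, y)\<leftarrow>s k. \<tau> x * star (\<tau> y)) \<longlonglongrightarrow> d)"

lemma corr_norm_theta_sum:
  assumes "set s \<subseteq> W \<times> W" "z \<in> W" "R z \<in> W"
  shows "corr_norm E ((\<Sum>(x, y)\<leftarrow>s. theta E x y) z - R z) =
    norm ((\<Sum>(x, y)\<leftarrow>s. \<tau> x * star (\<tau> y)) * \<tau> z - \<tau> (R z))"
  using theta_sum[OF assms(1,2)] assms(3) by (simp add: norm_eq lin cvec.subspace_diff[OF space])

text \<open>The approximating sequence disappears: limits of sums of ketbras are exactly the
  elements of K, and their norm distance dominates the operator distance. Hence \<open>psi\<close>
  inverts the action of K on the range of \<tau>.\<close>

lemma psi_rel_iff:
  assumes R: "\<And>z. z \<in> W \<Longrightarrow> R z \<in> W"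
  shows "psi_rel R d \<longleftrightarrow> d \<in> K \<and> (\<forall>z\<in>W. d * \<tau> z = \<tau> (R z))"
proof
  assume "psi_rel R d"
  then obtain s where s: "\<And>k. set (s k) \<subseteq> W \<times> W"
    and op: "op_tendsto E (\<lambda>k. \<Sum>(x, y)\<leftarrow>s k. theta E x y) R"
    and lim: "(\<lambda>k. \<Sum>(x, y)\<leftarrow>s k. \<tau> x * star (\<tau> y)) \<longlonglongrightarrow> d"
    by (auto simp: psi_rel_def)
  let ?b = "\<lambda>k. \<Sum>(x, y)\<leftarrow>s k. \<tau> x * star (\<tau> y)"
  have "d \<in> K"
    unfolding K_def closure_sequential by (intro exI[of _ ?b] conjI allI ketbra_sum_span s lim)
  moreover have "d * \<tau> z = \<tau> (R z)" if z: "z \<in> W" for z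
  proof (rule LIMSEQ_unique)
    show "(\<lambda>k. ?b k * \<tau> z) \<longlonglongrightarrow> d * \<tau> z" by (intro tendsto_intros lim)
    show "(\<lambda>k. ?b k * \<tau> z) \<longlonglongrightarrow> \<tau> (R z)"
    proof (rule LIMSEQ_I)
      fix e :: real assume e: "0 < e"
      \<comment> \<open>The operator estimate is relative to the norm of \<tau> z, which may be 0;
        hence the summand 1.\<close>
      define \<epsilon> where "\<epsilon> = e / (norm (\<tau> z) + 1)"
      have \<epsilon>: "0 < \<epsilon>" using e by (simp add: \<epsilon>_def add_nonneg_pos)
      have "\<epsilon> * norm (\<tau> z) < \<epsilon> * (norm (\<tau> z) + 1)" using \<epsilon> by simp
      also have "\<dots> = e" using norm_ge_zero[of "\<tau> z"] by (simp add: \<epsilon>_def add_nonneg_eq_0_iff)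
      finally have less: "\<epsilon> * norm (\<tau> z) < e" .
      obtain N where N: "\<And>k x. k \<ge> N \<Longrightarrow> x \<in> W \<Longrightarrow>
          corr_norm E ((\<Sum>(x, y)\<leftarrow>s k. theta E x y) x - R x) \<le> \<epsilon> * corr_norm E x"
        using op \<epsilon> unfolding op_tendsto_def by blast
      have "norm (?b k * \<tau> z - \<tau> (R z)) < e" if "k \<ge> N" for k
        using N[OF that z] less by (simp add: corr_norm_theta_sum[OF s z, of R] R z norm_eq z)
      thus "\<exists>N. \<forall>k\<ge>N. norm (?b k * \<tau> z - \<tau> (R z)) < e" by blast
    qed
  qed
  ultimately show "d \<in> K \<and> (\<forall>z\<in>W. d * \<tau> z = \<tau> (R z))" by blast
next
  assume d: "d \<in> K \<and> (\<forall>z\<in>W. d * \<tau> z = \<tau> (R z))"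
  then obtain b where b: "\<And>k. b k \<in> cspan (ketbras (\<tau> ` W))" "b \<longlonglongrightarrow> d"
    by (auto simp: K_def closure_sequential)
  have "\<forall>k. \<exists>s. set s \<subseteq> W \<times> W \<and> b k = (\<Sum>(x, y)\<leftarrow>s. \<tau> x * star (\<tau> y))"
    by (rule allI, rule span_ketbras_obtain[OF b(1)]) blast
  from choice[OF this] obtain s
    where s: "\<And>k. set (s k) \<subseteq> W \<times> W" "\<And>k. b k = (\<Sum>(x, y)\<leftarrow>s k. \<tau> x * star (\<tau> y))"
    by blast
  have "op_tendsto E (\<lambda>k. \<Sum>(x, y)\<leftarrow>s k. theta E x y) R"
    unfolding op_tendsto_def
  proof (intro allI impI)
    fix e :: real assume "0 < e"
    then obtain N where N: "\<And>k. k \<ge> N \<Longrightarrow> norm (b k - d) < e"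
      using LIMSEQ_D[OF b(2)] by blast
    have "corr_norm E ((\<Sum>(x, y)\<leftarrow>s k. theta E x y) z - R z) \<le> e * corr_norm E z"
      if "k \<ge> N" "z \<in> W" for k z
    proof -
      have "norm (b k * \<tau> z - \<tau> (R z)) = norm ((b k - d) * \<tau> z)"
        using d that by (simp add: left_diff_distrib)
      also have "\<dots> \<le> e * norm (\<tau> z)"
        using N[OF that(1)] by (intro order_trans[OF norm_mult_ineq] mult_right_mono) auto
      finally show ?thesis
        using that by (simp add: corr_norm_theta_sum[OF s(1), of _ R] R norm_eq s(2))
    qed
    thus "\<exists>N. \<forall>k\<ge>N. \<forall>z\<in>W. corr_norm E ((\<Sum>(x, y)\<leftarrow>s k. theta E x y) z - R z) \<le> e * corr_norm E z"
      by blast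
  qed
  moreover have "b = (\<lambda>k. \<Sum>(x, y)\<leftarrow>s k. \<tau> x * star (\<tau> y))" using s(2) by auto
  ultimately show "psi_rel R d" unfolding psi_rel_def using s(1) b(2) by blast
qed

lemma psi_eqI:
  assumes R: "\<And>z. z \<in> W \<Longrightarrow> R z \<in> W" and d: "d \<in> K" "\<And>z. z \<in> W \<Longrightarrow> d * \<tau> z = \<tau> (R z)"
  shows "psi E \<tau> R = d"
  unfolding psi_def psi_rel_def[symmetric]
proof (rule the_equality)
  note iff = psi_rel_iff[of R, OF R]
  show "psi_rel R d" using d iff[of d] by simp
  fix d' assume "psi_rel R d'"
  hence d': "d' \<in> K" "\<And>z. z \<in> W \<Longrightarrow> d' * \<tau> z = \<tau> (R z)" using iff[of d'] by simp_all
  show "d' = d"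
  proof (rule K_eqI[OF d'(1) d(1)])
    fix z assume "z \<in> \<tau> ` W"
    then obtain x where "x \<in> W" "z = \<tau> x" by blast
    thus "d' * z = d * z" using d(2) d'(2) by simp
  qed
qed

text \<open>Convergence in operator norm makes the finite rank sums Cauchy as operators;
  \<open>span_ketbras_norm_le\<close> turns this into a Cauchy sequence in the norm of the
  algebra.\<close>

lemma compacts_psi_rel:
  assumes "R \<in> compacts E"
  obtains d where "psi_rel R d"
proof -
  have R: "R z \<in> W" if "z \<in> W" for z
    using assms that by (auto simp: compacts_def adjointables_def)
  obtain S where S: "\<And>k. S k \<in> cspan {theta E x y |x y. x \<in> W \<and> y \<in> W}"
    and op: "op_tendsto E S R"
    using assms by (auto simp: compacts_def)
  \<comment> \<open>Linearity of \<open>corr_ract\<close> is not among the assumptions of the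
    locale; homogeneity is read off after applying the injective \<tau>.\<close>
  have theta_scale: "theta E (c *\<^sub>C x) y = c *\<^sub>C theta E x y" if "x \<in> W" "y \<in> W" for c x y
  proof
    fix z
    show "theta E (c *\<^sub>C x) y z = (c *\<^sub>C theta E x y) z"
    proof (cases "z \<in> W")
      case True
      note mem = rank_one_closed[OF that(1,2) True]
      note cx = cvec.subspace_scale[OF space that(1), of c]
      have "\<tau> (corr_ract E (c *\<^sub>C x) (corr_ip E y z)) = \<tau> (c *\<^sub>C corr_ract E x (corr_ip E y z))"
        by (simp only: rank_one[OF cx that(2) True] rank_one[OF that(1,2) True] lin(2)[OF that(1)]
            lin(2)[OF mem] scaleC_mult_left)
      hence "corr_ract E (c *\<^sub>C x) (corr_ip E y z) = c *\<^sub>C corr_ract E x (corr_ip E y z)"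
        by (rule inj_onD[OF inj _ rank_one_closed[OF cx that(2) True] cvec.subspace_scale[OF space mem]])
      thus ?thesis using True by (simp add: theta_def scaleC_fun_def)
    qed (simp add: theta_def scaleC_fun_def)
  qed
  have "\<forall>k. \<exists>s. set s \<subseteq> W \<times> W \<and> S k = (\<Sum>(x, y)\<leftarrow>s. theta E x y)"
    by (rule allI, rule cspan_list_sums[OF space theta_scale S]) blast+
  from choice[OF this] obtain s
    where s: "\<And>k. set (s k) \<subseteq> W \<times> W" "\<And>k. S k = (\<Sum>(x, y)\<leftarrow>s k. theta E x y)"
    by blast
  define b where "b k = (\<Sum>(x, y)\<leftarrow>s k. \<tau> x * star (\<tau> y))" for k
  have "Cauchy b"
  proof (rule CauchyI)
    fix e :: real assume e: "0 < e"
    hence "0 < e / 4" by simp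
    then obtain N where N: "\<And>k x. k \<ge> N \<Longrightarrow> x \<in> W \<Longrightarrow> corr_norm E (S k x - R x) \<le> e / 4 * corr_norm E x"
      using op unfolding op_tendsto_def by blast
    have bN: "norm (b k * \<tau> x - \<tau> (R x)) \<le> e / 4 * norm (\<tau> x)" if "k \<ge> N" "x \<in> W" for k x
      using N[OF that] by (simp add: corr_norm_theta_sum[OF s(1) that(2), of R] R norm_eq that s(2) b_def)
    have half: "norm (b j - b k) \<le> e / 2" if "j \<ge> N" "k \<ge> N" for j k
    proof (rule span_ketbras_norm_le)
      show "b j - b k \<in> cspan (ketbras (\<tau> ` W))"
        unfolding b_def by (intro cvec.subspace_diff[OF cvec.subspace_span] ketbra_sum_span s)
      fix z assume "z \<in> \<tau> ` W"
      then obtain x where x: "x \<in> W" "z = \<tau> x" by blast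
      have "(b j - b k) * z = (b j * \<tau> x - \<tau> (R x)) - (b k * \<tau> x - \<tau> (R x))"
        by (simp add: x left_diff_distrib)
      hence "norm ((b j - b k) * z) \<le> e / 4 * norm z + e / 4 * norm z"
        using norm_triangle_ineq4 order_trans add_mono[OF bN[OF that(1) x(1)] bN[OF that(2) x(1)]]
        unfolding x(2) by metis
      thus "norm ((b j - b k) * z) \<le> e / 2 * norm z" by simp
    qed (use e in simp)
    have "norm (b j - b k) < e" if "j \<ge> N" "k \<ge> N" for j k
      using half[OF that] e by linarith
    thus "\<exists>M. \<forall>m\<ge>M. \<forall>n\<ge>M. norm (b m - b n) < e" by blast
  qed
  then obtain d where "b \<longlonglongrightarrow> d"
    unfolding Cauchy_convergent_iff convergent_def by blast
  moreover have "S = (\<lambda>k. \<Sum>(x, y)\<leftarrow>s k. theta E x y)" using s(2) by auto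
  ultimately have "psi_rel R d"
    unfolding psi_rel_def b_def using s(1) op by blast
  thus ?thesis by (rule that)
qed

lemma psi_compact:
  assumes "R \<in> compacts E"
  shows "psi E \<tau> R \<in> K" "\<And>z. z \<in> W \<Longrightarrow> psi E \<tau> R * \<tau> z = \<tau> (R z)"
proof -
  have R: "R z \<in> W" if "z \<in> W" for z
    using assms that by (auto simp: compacts_def adjointables_def)
  obtain d where "psi_rel R d" by (rule compacts_psi_rel[OF assms])
  hence d: "d \<in> K" "\<And>z. z \<in> W \<Longrightarrow> d * \<tau> z = \<tau> (R z)"
    using psi_rel_iff[of R d, OF R] by simp_all
  have "psi E \<tau> R = d" by (rule psi_eqI[of R, OF R d])
  thus "psi E \<tau> R \<in> K" "\<And>z. z \<in> W \<Longrightarrow> psi E \<tau> R * \<tau> z = \<tau> (R z)"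
    using d by simp_all
qed

text \<open>K is closed under \<open>star\<close>, so \<open>star d\<close> preserves the range of
  \<tau> as well and provides the adjoint of R; \<open>ip_eqI\<close> carries the adjoint relation
  back to E.\<close>

lemma compactI:
  assumes d: "d \<in> K" and R: "\<And>z. z \<in> W \<Longrightarrow> R z \<in> W" "\<And>z. z \<notin> W \<Longrightarrow> R z = 0"
    and dR: "\<And>z. z \<in> W \<Longrightarrow> d * \<tau> z = \<tau> (R z)"
  shows "R \<in> compacts E"
proof -
  have "psi_rel R d" using psi_rel_iff[of R d, OF R(1)] d dR by simp
  then obtain s where s: "\<And>k. set (s k) \<subseteq> W \<times> W" "op_tendsto E (\<lambda>k. \<Sum>(x, y)\<leftarrow>s k. theta E x y) R"
    unfolding psi_rel_def by blast
  have "(\<Sum>(x, y)\<leftarrow>s k. theta E x y) \<in> cspan {theta E x y |x y. x \<in> W \<and> y \<in> W}" for k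
  proof (intro csubspace_sum_list cvec.subspace_span cvec.span_base)
    fix p assume "p \<in> set (s k)"
    then obtain x y where "p = (x, y)" "x \<in> W" "y \<in> W" using s(1)[of k] by blast
    thus "(case p of (x, y) \<Rightarrow> theta E x y) \<in> {theta E x y |x y. x \<in> W \<and> y \<in> W}" by auto
  qed
  moreover have "R \<in> adjointables E"
  proof -
    define R' where "R' z = inv_into W \<tau> (star d * \<tau> z)" for z
    have R': "R' z \<in> W" "\<tau> (R' z) = star d * \<tau> z" if "z \<in> W" for z
    proof -
      have "star d * \<tau> z \<in> \<tau> ` W" using that by (intro K_mult_T K_star d) auto
      thus "R' z \<in> W" "\<tau> (R' z) = star d * \<tau> z"
        unfolding R'_def by (rule inv_into_into, rule f_inv_into_f)
    qed
    have adj: "corr_ip E (R x) y = corr_ip E x (R' y)" if "x \<in> W" "y \<in> W" for x y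
    proof -
      have "star (\<tau> (R x)) * \<tau> y = star (d * \<tau> x) * \<tau> y"
        using dR[OF that(1)] by simp
      also have "\<dots> = star (\<tau> x) * \<tau> (R' y)"
        by (simp only: star_mult R'(2)[OF that(2)] mult.assoc)
      finally show ?thesis by (intro ip_eqI R(1) R'(1) that)
    qed
    show ?thesis
      unfolding adjointables_def mem_Collect_eq
      by (intro conjI ballI allI impI exI[of _ R'] R R'(1) adj)
  qed
  ultimately show ?thesis
    unfolding compacts_def mem_Collect_eq
    by (intro conjI exI[of _ "\<lambda>k. \<Sum>(x, y)\<leftarrow>s k. theta E x y"] allI s(2))
qed

lemma psi_compacts_eq: "psi E \<tau> ` compacts E = K"
proof
  show "psi E \<tau> ` compacts E \<subseteq> K" using psi_compact(1) by blast
  show "K \<subseteq> psi E \<tau> ` compacts E"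
  proof
    fix d assume d: "d \<in> K"
    define R where "R z = (if z \<in> W then inv_into W \<tau> (d * \<tau> z) else 0)" for z
    have R: "R z \<in> W" "d * \<tau> z = \<tau> (R z)" if "z \<in> W" for z
    proof -
      have "d * \<tau> z \<in> \<tau> ` W" using that by (intro K_mult_T d) auto
      thus "R z \<in> W" "d * \<tau> z = \<tau> (R z)"
        using that by (simp_all add: R_def inv_into_into f_inv_into_f)
    qed
    have "R \<in> compacts E" by (rule compactI[of d R, OF d R(1) _ R(2)]) (auto simp: R_def)
    moreover have "psi E \<tau> R = d" by (rule psi_eqI[of R, OF R(1) d R(2)])
    ultimately show "d \<in> psi E \<tau> ` compacts E" by blast
  qed
qed

end

section \<open>Injective representations\<close>

text \<open>By the C*-identity \<open>corr_norm\<close> is the ambient norm, so completeness amounts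
  to closedness of V.\<close>

lemma cstar_correspondence_subspaceI:
  fixes V :: "'a::cstar_algebra set"
  assumes V: "csubspace V" "closed V" and B: "cstar_subalgebra B"
    and VB: "\<And>v b. v \<in> V \<Longrightarrow> b \<in> B \<Longrightarrow> v * b \<in> V" and BV: "\<And>b v. b \<in> B \<Longrightarrow> v \<in> V \<Longrightarrow> b * v \<in> V"
    and VV: "\<And>v w. v \<in> V \<Longrightarrow> w \<in> V \<Longrightarrow> star v * w \<in> B"
  shows "cstar_correspondence
    \<lparr>corr_space = V, corr_alg = B, corr_ract = (*), corr_ip = (\<lambda>x y. star x * y), corr_lact = (*)\<rparr>"
    (is "cstar_correspondence ?E")
proof
  have norm: "corr_norm ?E x = norm x" for x
    by (simp add: corr_norm_def cstar_identity)
  show "\<exists>x\<in>corr_space ?E. (\<lambda>k. corr_norm ?E (s k - x)) \<longlonglongrightarrow> 0"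
    if s: "\<And>k. s k \<in> corr_space ?E"
      and C: "\<And>e. e > 0 \<Longrightarrow> \<exists>N. \<forall>j\<ge>N. \<forall>k\<ge>N. corr_norm ?E (s j - s k) < e" for s :: "nat \<Rightarrow> 'a"
  proof -
    have "Cauchy s" using C unfolding norm by (intro CauchyI) blast
    then obtain l where l: "s \<longlonglongrightarrow> l" unfolding Cauchy_convergent_iff convergent_def by blast
    have "l \<in> V" using closed_sequentially[OF V(2) _ l] s by simp
    moreover have "(\<lambda>k. norm (s k - l)) \<longlonglongrightarrow> 0" by (intro tendsto_norm_zero LIM_zero l)
    ultimately show ?thesis unfolding norm by auto
  qed
  show "cpositive (corr_ip ?E x x)" for x
    by (auto simp: cpositive_def)
  show "x = 0" if "corr_ip ?E x x = 0" for x
    using that star_mult_eq_0 by simp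
qed (simp_all add: V B VB BV VV clinear_on_def distrib_left distrib_right scaleC_mult_left
    scaleC_mult_right mult.assoc star_mult star_star)

locale injective_rep = X: cstar_correspondence X
  for X :: "('x::complex_vector, 'a::cstar_algebra) corr" +
  fixes \<pi> :: "'a \<Rightarrow> 'd::cstar_algebra" and t :: "'x \<Rightarrow> 'd"
  assumes rep: "corr_representation X \<pi> t" and inj_pi: "inj_on \<pi> (corr_alg X)"
begin

abbreviation A where "A \<equiv> corr_alg X"
abbreviation W where "W \<equiv> corr_space X"

lemmas A_facts = cstar_subalgebraD[OF X.alg]

lemma pi_hom: "star_hom_on A \<pi>" and t_linear: "clinear_on W t"
  using rep by (auto simp: corr_representation_def)

lemmas pi_facts = star_hom_onD[OF pi_hom]
lemmas pi_lin = clinear_onD[OF pi_facts(1) A_facts(1)]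
lemmas t_lin = clinear_onD[OF t_linear X.space]
lemmas norm_pi = star_hom_isometric[OF pi_hom X.alg inj_pi]

lemma pi_t: "a \<in> A \<Longrightarrow> x \<in> W \<Longrightarrow> \<pi> a * t x = t (corr_lact X a x)"
  and star_t_t: "x \<in> W \<Longrightarrow> y \<in> W \<Longrightarrow> star (t x) * t y = \<pi> (corr_ip X x y)"
  using rep by (auto simp: corr_representation_def phi_def)

text \<open>Compatibility with the right action is not part of a representation. The difference d of
  both sides is annihilated by every \<open>star (t z)\<close>, and d* d is a combination of such
  products.\<close>

lemma t_pi:
  assumes x: "x \<in> W" and a: "a \<in> A"
  shows "t x * \<pi> a = t (corr_ract X x a)"
proof -
  let ?y = "corr_ract X x a"
  have y: "?y \<in> W" using x a by (rule X.ract_closed)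
  have mem: "corr_ip X z x \<in> A" if "z \<in> W" for z using that x by (rule X.ip_closed)
  have 1: "star (t z) * t ?y = star (t z) * (t x * \<pi> a)" if z: "z \<in> W" for z
  proof -
    have "star (t z) * t ?y = \<pi> (corr_ip X z x * a)"
      by (simp only: star_t_t[OF z y] X.ip_ract[OF z x a])
    also have "\<dots> = star (t z) * (t x * \<pi> a)"
      by (simp only: pi_facts(2)[OF mem[OF z] a] star_t_t[OF z x, symmetric] mult.assoc)
    finally show ?thesis .
  qed
  let ?d = "t x * \<pi> a - t ?y"
  have 2: "star (t z) * ?d = 0" if z: "z \<in> W" for z
    using 1[OF z] by (simp add: right_diff_distrib)
  have "star ?d * ?d = star (\<pi> a) * (star (t x) * ?d) - star (t ?y) * ?d"
    by (simp add: star_diff star_mult left_diff_distrib mult.assoc)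
  also have "\<dots> = 0" by (simp add: 2 x y)
  finally have "?d = 0" by (rule star_mult_eq_0)
  thus ?thesis by simp
qed

lemma norm_t: "x \<in> W \<Longrightarrow> norm (t x) = corr_norm X x"
proof -
  assume x: "x \<in> W"
  have "(norm (t x))\<^sup>2 = norm (corr_ip X x x)"
    by (simp only: cstar_identity[symmetric] star_t_t[OF x x] norm_pi[OF X.ip_closed[OF x x]])
  thus ?thesis unfolding corr_norm_def by (metis norm_ge_zero real_sqrt_abs abs_of_nonneg)
qed

lemma t_eq_0: "x \<in> W \<Longrightarrow> t x = 0 \<Longrightarrow> x = 0"
  using norm_t[of x] X.ip_definite[of x] by (simp add: corr_norm_def)

lemma inj_t: "inj_on t W"
proof (rule inj_onI)
  fix x y assume xy: "x \<in> W" "y \<in> W" "t x = t y"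
  have "x - y = 0"
    using t_eq_0[OF cvec.subspace_diff[OF X.space xy(1,2)]] t_lin(5)[OF xy(1,2)] xy(3) by simp
  thus "x = y" by simp
qed

lemma range_t_closed: "closed (t ` W)"
  unfolding closed_sequential_limits
proof (intro allI impI, elim conjE)
  fix f l assume f: "\<forall>n. f n \<in> t ` W" and l: "f \<longlonglongrightarrow> l"
  have "\<forall>n. \<exists>x. x \<in> W \<and> f n = t x" using f by blast
  from choice[OF this] obtain s where s: "\<And>n. s n \<in> W" "\<And>n. f n = t (s n)" by blast
  have norm: "corr_norm X (s j - x) = norm (f j - t x)" if "x \<in> W" for j x
    using that s by (simp add: norm_t[symmetric] cvec.subspace_diff[OF X.space] t_lin)
  have "Cauchy f" using l by (rule LIMSEQ_imp_Cauchy)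
  hence "\<exists>N. \<forall>j\<ge>N. \<forall>k\<ge>N. corr_norm X (s j - s k) < e" if "e > 0" for e
    using that s by (simp add: norm Cauchy_iff)
  then obtain x where x: "x \<in> W" "(\<lambda>k. corr_norm X (s k - x)) \<longlonglongrightarrow> 0"
    using X.complete[of s] s(1) by blast
  have "(\<lambda>k. f k - t x) \<longlonglongrightarrow> 0"
    using x(2) unfolding norm[OF x(1)] by (rule tendsto_norm_zero_cancel)
  hence "f \<longlonglongrightarrow> t x" by (rule LIM_zero_cancel)
  hence "l = t x" using l LIMSEQ_unique by blast
  thus "l \<in> t ` W" using x(1) by blast
qed

lemma range_pi_subspace: "csubspace (\<pi> ` A)"
proof (rule cvec.subspaceI)
  show "0 \<in> \<pi> ` A" using pi_lin(3) cvec.subspace_0[OF A_facts(1)] by (metis imageI)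
  show "x + y \<in> \<pi> ` A" if "x \<in> \<pi> ` A" "y \<in> \<pi> ` A" for x y
    using that by (auto simp: pi_lin(1)[symmetric] cvec.subspace_add[OF A_facts(1)])
  show "c *\<^sub>C x \<in> \<pi> ` A" if "x \<in> \<pi> ` A" for c x
    using that by (auto simp: pi_lin(2)[symmetric] cvec.subspace_scale[OF A_facts(1)])
qed

lemma range_t_subspace: "csubspace (t ` W)"
proof (rule cvec.subspaceI)
  show "0 \<in> t ` W" using t_lin(3) cvec.subspace_0[OF X.space] by (metis imageI)
  show "x + y \<in> t ` W" if "x \<in> t ` W" "y \<in> t ` W" for x y
    using that by (auto simp: t_lin(1)[symmetric] cvec.subspace_add[OF X.space])
  show "c *\<^sub>C x \<in> t ` W" if "x \<in> t ` W" for c x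
    using that by (auto simp: t_lin(2)[symmetric] cvec.subspace_scale[OF X.space])
qed

lemma range_pi_closed: "closed (\<pi> ` A)"
  unfolding closed_sequential_limits
proof (intro allI impI, elim conjE)
  fix f l assume f: "\<forall>n. f n \<in> \<pi> ` A" and l: "f \<longlonglongrightarrow> l"
  have "\<forall>n. \<exists>x. x \<in> A \<and> f n = \<pi> x" using f by blast
  from choice[OF this] obtain s where s: "\<And>n. s n \<in> A" "\<And>n. f n = \<pi> (s n)" by blast
  have norm: "norm (s j - x) = norm (f j - \<pi> x)" if "x \<in> A" for j x
    using that s by (simp add: norm_pi[symmetric] cvec.subspace_diff[OF A_facts(1)] pi_lin)
  have "Cauchy f" using l by (rule LIMSEQ_imp_Cauchy)
  hence "Cauchy s" by (simp add: norm[OF s(1)] s(2)[symmetric] Cauchy_iff)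
  then obtain x where x: "s \<longlonglongrightarrow> x" unfolding Cauchy_convergent_iff convergent_def by blast
  have xA: "x \<in> A" using closed_sequentially[OF A_facts(2) _ x] s(1) by blast
  have "(\<lambda>k. f k - \<pi> x) \<longlonglongrightarrow> 0"
    using tendsto_norm_zero[OF LIM_zero[OF x]] unfolding norm[OF xA] by (rule tendsto_norm_zero_cancel)
  hence "f \<longlonglongrightarrow> \<pi> x" by (rule LIM_zero_cancel)
  hence "l = \<pi> x" using l LIMSEQ_unique by blast
  thus "l \<in> \<pi> ` A" using xA by blast
qed

lemma range_pi_subalgebra: "cstar_subalgebra (\<pi> ` A)"
  unfolding cstar_subalgebra_def
  using range_pi_subspace range_pi_closed A_facts(3,4)
  by (auto simp flip: pi_facts(2,3))

sublocale XE: corr_embedding X t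
proof
  fix x y z assume xyz: "x \<in> W" "y \<in> W" "z \<in> W"
  show "corr_ract X x (corr_ip X y z) \<in> W"
    by (intro X.ract_closed X.ip_closed xyz)
  show "t (corr_ract X x (corr_ip X y z)) = t x * star (t y) * t z"
    using xyz by (simp only: t_pi[symmetric] X.ip_closed star_t_t[symmetric] mult.assoc)
next
  fix x y x' y' assume "x \<in> W" "y \<in> W" "x' \<in> W" "y' \<in> W" "star (t x) * t y = star (t x') * t y'"
  thus "corr_ip X x y = corr_ip X x' y'"
    by (intro inj_onD[OF inj_pi]) (simp_all add: star_t_t X.ip_closed)
qed (simp_all add: X.space t_linear inj_t range_t_closed norm_t)

section \<open>Products of t along tuples\<close>

abbreviation el where "el \<equiv> elementary_map t"

text \<open>\<open>elementary_map\<close> sends the empty list to 0 and not to a unit; hence the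
  nonemptiness conditions from here on.\<close>

lemma el_Cons: "v \<noteq> [] \<Longrightarrow> el (x # v) = t x * el v"
  by (cases v) auto

lemma el_append: "u \<noteq> [] \<Longrightarrow> v \<noteq> [] \<Longrightarrow> el (u @ v) = el u * el v"
proof (induction u)
  case (Cons x u)
  thus ?case by (cases u) (simp_all add: el_Cons mult.assoc)
qed simp

lemma pi_el:
  assumes "a \<in> A" "u \<noteq> []" "set u \<subseteq> W"
  obtains v where "length v = length u" "set v \<subseteq> W" "\<pi> a * el u = el v"
proof (cases u)
  case (Cons x us)
  show ?thesis
  proof (rule that[of "corr_lact X a x # us"])
    show "\<pi> a * el u = el (corr_lact X a x # us)"
      using assms Cons by (cases us) (simp_all add: pi_t mult.assoc[symmetric])
  qed (use assms Cons X.lact_closed in auto)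
qed (use assms in simp)

lemma el_pi:
  assumes "a \<in> A" "u \<noteq> []" "set u \<subseteq> W"
  obtains v where "length v = length u" "set v \<subseteq> W" "el u * \<pi> a = el v"
proof (cases u rule: rev_cases)
  case (snoc us x)
  show ?thesis
  proof (rule that[of "us @ [corr_ract X x a]"])
    show "el u * \<pi> a = el (us @ [corr_ract X x a])"
      using assms snoc by (cases "us = []") (simp_all add: t_pi mult.assoc el_append)
  qed (use assms snoc X.ract_closed in auto)
qed (use assms in simp)

text \<open>The innermost product \<open>star (t x) * t y\<close> lies in \<pi>(A) and is absorbed
  by the next vector of v, which is the recursion of \<open>tensor_ip\<close>.\<close>

lemma star_el_el:
  assumes "length u = length v" "u \<noteq> []" "set u \<subseteq> W" "set v \<subseteq> W"
  shows "tensor_ip X u v \<in> A \<and> star (el u) * el v = \<pi> (tensor_ip X u v)"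
  using assms
proof (induction u arbitrary: v)
  case (Cons x us)
  then obtain y vs where v: "v = y # vs" by (cases v) auto
  have xy: "x \<in> W" "y \<in> W" "set us \<subseteq> W" "set vs \<subseteq> W" "length us = length vs"
    using Cons.prems by (auto simp: v)
  have ip: "corr_ip X x y \<in> A" using xy by (intro X.ip_closed)
  show ?case
  proof (cases us)
    case Nil
    thus ?thesis using xy ip by (simp add: v star_t_t)
  next
    case us: (Cons x' us')
    then obtain y' vs' where vs: "vs = y' # vs'" using xy(5) by (cases vs) auto
    let ?w = "corr_lact X (corr_ip X x y) y' # vs'"
    have "\<pi> (corr_ip X x y) * el vs = el ?w"
      using xy ip by (cases vs') (simp_all add: vs pi_t mult.assoc[symmetric])
    hence "star (el (x # us)) * el v = star (el us) * el ?w"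
      using xy us vs by (simp add: v el_Cons star_mult star_t_t[symmetric] mult.assoc)
    moreover have "tensor_ip X (x # us) v = tensor_ip X us ?w"
      by (simp add: us v vs)
    moreover have "tensor_ip X us ?w \<in> A \<and> star (el us) * el ?w = \<pi> (tensor_ip X us ?w)"
      using xy vs us ip X.lact_closed by (intro Cons.IH) auto
    ultimately show ?thesis by simp
  qed
qed simp

end

section \<open>Representations on tensor powers\<close>

locale fixed_power = injective_rep X \<pi> t
  for X :: "('x::complex_vector, 'a::cstar_algebra) corr"
    and \<pi> :: "'a \<Rightarrow> 'd::cstar_algebra" and t :: "'x \<Rightarrow> 'd" +
  fixes n :: nat
  assumes n: "1 \<le> n"
begin

abbreviation Tup where "Tup \<equiv> tuples X n"

lemma TupD: "u \<in> Tup \<Longrightarrow> u \<noteq> [] \<and> length u = n \<and> set u \<subseteq> W"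
  using n by (auto simp: tuples_def)

definition S :: "'x list list \<Rightarrow> 'd" where "S s = (\<Sum>u\<leftarrow>s. el u)"

text \<open>The range of t^n, as \<open>range_rep_power\<close> confirms once the tensor power is
  identified.\<close>

definition En :: "'d set" where "En = closure (cspan (el ` Tup))"

lemma En_subspace: "csubspace En" and En_closed: "closed En"
  by (simp_all add: En_def)

lemma el_En: "u \<in> Tup \<Longrightarrow> el u \<in> En"
  unfolding En_def by (intro closed_span_base) auto

lemma S_En: "set s \<subseteq> Tup \<Longrightarrow> S s \<in> En"
  unfolding S_def by (intro csubspace_sum_list En_subspace el_En) auto

lemma En_obtain:
  assumes "d \<in> En"
  obtains s where "\<And>k. set (s k) \<subseteq> Tup" "(\<lambda>k. S (s k)) \<longlonglongrightarrow> d"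
proof -
  obtain f where f: "\<And>k. f k \<in> cspan (el ` Tup)" "f \<longlonglongrightarrow> d"
    using assms by (auto simp: En_def closure_sequential)
  have "\<exists>s. set s \<subseteq> Tup \<and> x = S s" if "x \<in> cspan (el ` Tup)" for x
    using that
  proof (induction rule: cvec.span_induct_alt)
    case base
    show ?case by (rule exI[of _ "[]"]) (simp add: S_def)
  next
    case (step c x y)
    then obtain u s where us: "u \<in> Tup" "x = el u" "set s \<subseteq> Tup" "y = S s" by blast
    obtain u1 us' where u: "u = u1 # us'" using TupD[OF us(1)] by (cases u) auto
    have w: "u1 \<in> W" "(c *\<^sub>C u1) # us' \<in> Tup"
      using us(1) cvec.subspace_scale[OF X.space] by (auto simp: u tuples_def)
    have "c *\<^sub>C el u = el ((c *\<^sub>C u1) # us')"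
      using w(1) by (cases us') (simp_all add: u t_lin scaleC_mult_left)
    thus ?case using us w by (intro exI[of _ "((c *\<^sub>C u1) # us') # s"]) (simp add: S_def)
  qed
  hence "\<forall>k. \<exists>s. set s \<subseteq> Tup \<and> f k = S s" using f(1) by blast
  from choice[OF this] obtain s where s: "\<And>k. set (s k) \<subseteq> Tup" "\<And>k. f k = S (s k)" by blast
  have "(\<lambda>k. S (s k)) = f" using s(2) by auto
  thus ?thesis using that[of s] s(1) f(2) by simp
qed

lemma star_el_el': "u \<in> Tup \<Longrightarrow> v \<in> Tup \<Longrightarrow> tensor_ip X u v \<in> A"
  "u \<in> Tup \<Longrightarrow> v \<in> Tup \<Longrightarrow> star (el u) * el v = \<pi> (tensor_ip X u v)"
  using star_el_el[of u v] TupD[of u] TupD[of v] by simp_all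

lemma star_En: "x \<in> En \<Longrightarrow> star x \<in> closure (cspan ((\<lambda>u. star (el u)) ` Tup))"
  unfolding En_def by (rule closed_span_star) (auto intro: closed_span_base)

lemma star_En_En: "x \<in> En \<Longrightarrow> y \<in> En \<Longrightarrow> star x * y \<in> \<pi> ` A"
proof (rule closed_span_mult[OF range_pi_subspace range_pi_closed])
  assume "x \<in> En" thus "star x \<in> closure (cspan ((\<lambda>u. star (el u)) ` Tup))" by (rule star_En)
  assume "y \<in> En" thus "y \<in> closure (cspan (el ` Tup))" by (simp add: En_def)
  fix a b assume "a \<in> (\<lambda>u. star (el u)) ` Tup" "b \<in> el ` Tup"
  then obtain u v where "u \<in> Tup" "v \<in> Tup" "a = star (el u)" "b = el v" by blast
  thus "a * b \<in> \<pi> ` A" using star_el_el' by simp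
qed

lemma En_pi: "x \<in> En \<Longrightarrow> a \<in> \<pi> ` A \<Longrightarrow> x * a \<in> En"
proof (rule closed_span_mult[OF En_subspace En_closed])
  assume "x \<in> En" thus "x \<in> closure (cspan (el ` Tup))" by (simp add: En_def)
  assume "a \<in> \<pi> ` A" thus "a \<in> closure (cspan (\<pi> ` A))" by (rule closed_span_base)
  fix c b assume "c \<in> el ` Tup" "b \<in> \<pi> ` A"
  then obtain u a' where u: "u \<in> Tup" "a' \<in> A" "c = el u" "b = \<pi> a'" by blast
  obtain v where v: "length v = length u" "set v \<subseteq> W" "el u * \<pi> a' = el v"
    using el_pi[OF u(2)] TupD[OF u(1)] by blast
  have "v \<in> Tup" using v TupD[OF u(1)] by (simp add: tuples_def)
  thus "c * b \<in> En" using el_En[of v] u v by simp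
qed

text \<open>The difference lies in the closed span of the \<open>el u\<close> and is orthogonal to
  each of them, hence to itself. This is why pairings with elementary tensors determine a
  vector.\<close>

lemma En_eqI:
  assumes "d \<in> En" "d' \<in> En" "\<And>u. u \<in> Tup \<Longrightarrow> star (el u) * d = star (el u) * d'"
  shows "d = d'"
proof -
  have dd: "d - d' \<in> En" by (intro cvec.subspace_diff En_subspace assms)
  have "star (d - d') * (d - d') \<in> {0}"
  proof (rule closed_span_mult[OF _ _ _ star_En[OF dd] closed_span_base])
    show "csubspace {0::'d}" by (rule cvec.subspace_single_0)
    show "a * b \<in> {0}" if "a \<in> (\<lambda>u. star (el u)) ` Tup" "b \<in> {d - d'}" for a b
      using that assms(3) by (auto simp: right_diff_distrib)
  qed auto
  hence "d - d' = 0" using star_mult_eq_0[of "d - d'"] by simp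
  thus ?thesis by simp
qed

section \<open>The tensor power as a closed subspace of the target algebra\<close>

definition \<rho> where "\<rho> = inv_into A \<pi>"

lemma rho: "x \<in> \<pi> ` A \<Longrightarrow> \<rho> x \<in> A" "x \<in> \<pi> ` A \<Longrightarrow> \<pi> (\<rho> x) = x" "a \<in> A \<Longrightarrow> \<rho> (\<pi> a) = a"
  unfolding \<rho>_def by (rule inv_into_into, assumption) (simp_all add: f_inv_into_f inv_into_f_f[OF inj_pi])

lemma rho_eqI: "a \<in> A \<Longrightarrow> \<pi> a = x \<Longrightarrow> a = \<rho> x"
  using rho(3)[of a] by simp

lemma rho_diff: "x \<in> \<pi> ` A \<Longrightarrow> y \<in> \<pi> ` A \<Longrightarrow> \<rho> (x - y) = \<rho> x - \<rho> y"
  by (elim imageE) (simp add: rho pi_lin(5)[symmetric] cvec.subspace_diff[OF A_facts(1)])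

lemma rho_add: "x \<in> \<pi> ` A \<Longrightarrow> y \<in> \<pi> ` A \<Longrightarrow> \<rho> (x + y) = \<rho> x + \<rho> y"
  by (elim imageE) (simp add: rho pi_lin(1)[symmetric] cvec.subspace_add[OF A_facts(1)])

lemma rho_scale: "x \<in> \<pi> ` A \<Longrightarrow> \<rho> (c *\<^sub>C x) = c *\<^sub>C \<rho> x"
  by (elim imageE) (simp add: rho pi_lin(2)[symmetric] cvec.subspace_scale[OF A_facts(1)])

lemma rho_mult: "x \<in> \<pi> ` A \<Longrightarrow> a \<in> A \<Longrightarrow> \<rho> (x * \<pi> a) = \<rho> x * a"
  by (elim imageE) (simp add: rho pi_facts(2)[symmetric] A_facts(3))

lemma norm_rho: "x \<in> \<pi> ` A \<Longrightarrow> norm (\<rho> x) = norm x"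
  by (elim imageE) (simp add: rho norm_pi)

lemma rho_tendsto:
  assumes "\<And>k. f k \<in> \<pi> ` A" "f \<longlonglongrightarrow> l"
  shows "(\<lambda>k. \<rho> (f k)) \<longlonglongrightarrow> \<rho> l"
proof -
  have l: "l \<in> \<pi> ` A" using closed_sequentially[OF range_pi_closed assms] .
  have "(\<lambda>k. norm (f k - l)) \<longlonglongrightarrow> 0" by (intro tendsto_norm_zero LIM_zero assms)
  moreover have "norm (f k - l) = norm (\<rho> (f k) - \<rho> l)" for k
    by (simp only: rho_diff[OF assms(1) l, symmetric] norm_rho[OF cvec.subspace_diff[OF range_pi_subspace assms(1) l]])
  ultimately have "(\<lambda>k. norm (\<rho> (f k) - \<rho> l)) \<longlonglongrightarrow> 0" by simp
  hence "(\<lambda>k. \<rho> (f k) - \<rho> l) \<longlonglongrightarrow> 0" by (rule tendsto_norm_zero_cancel)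
  thus ?thesis by (rule LIM_zero_cancel)
qed

text \<open>The element of \<open>tensor_power X n\<close> that \<open>t\<^sup>n\<close> maps to \<open>d\<close>.\<close>

definition zeta :: "'d \<Rightarrow> 'x list \<Rightarrow> 'a"
  where "zeta d u = (if u \<in> Tup then \<rho> (star (el u) * d) else 0)"

lemma pi_zeta: "d \<in> En \<Longrightarrow> u \<in> Tup \<Longrightarrow> \<pi> (zeta d u) = star (el u) * d"
  and zeta_mem: "d \<in> En \<Longrightarrow> u \<in> Tup \<Longrightarrow> zeta d u \<in> A"
  by (simp_all add: zeta_def rho star_En_En[OF el_En])

lemma zeta_inj: "d \<in> En \<Longrightarrow> d' \<in> En \<Longrightarrow> zeta d = zeta d' \<Longrightarrow> d = d'"
  by (rule En_eqI) (simp_all flip: pi_zeta)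

lemma tensor_vec_eq: "set s \<subseteq> Tup \<Longrightarrow> tensor_vec X n s = zeta (S s)"
proof
  fix u assume s: "set s \<subseteq> Tup"
  show "tensor_vec X n s u = zeta (S s) u"
  proof (cases "u \<in> Tup")
    case True
    have mem: "(\<Sum>v\<leftarrow>s. tensor_ip X u v) \<in> A"
      using s True by (intro csubspace_sum_list A_facts) (auto intro!: star_el_el')
    have "\<pi> (\<Sum>v\<leftarrow>s. tensor_ip X u v) = (\<Sum>v\<leftarrow>s. \<pi> (tensor_ip X u v))"
      using s True by (intro clinear_on_sum_list[OF pi_facts(1) A_facts(1)]) (auto intro!: star_el_el')
    also have "\<dots> = (\<Sum>v\<leftarrow>s. star (el u) * el v)"
      using s True by (intro arg_cong[where f = sum_list] map_cong) (auto simp: star_el_el')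
    also have "\<dots> = star (el u) * S s" by (simp add: S_def sum_list_const_mult)
    finally show ?thesis using rho_eqI[OF mem] True by (simp add: tensor_vec_def zeta_def)
  qed (simp add: tensor_vec_def zeta_def)
qed

lemma zeta_diff: "d \<in> En \<Longrightarrow> d' \<in> En \<Longrightarrow> zeta (d - d') = zeta d - zeta d'"
  by (rule ext) (simp add: zeta_def right_diff_distrib rho_diff star_En_En el_En)

lemma zeta_add: "d \<in> En \<Longrightarrow> d' \<in> En \<Longrightarrow> zeta (d + d') = zeta d + zeta d'"
  by (rule ext) (simp add: zeta_def distrib_left rho_add star_En_En el_En)

lemma zeta_scale: "d \<in> En \<Longrightarrow> zeta (c *\<^sub>C d) = c *\<^sub>C zeta d"
  by (rule ext) (simp add: zeta_def scaleC_mult_right rho_scale star_En_En el_En scaleC_fun_def)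

lemma sum_zeta:
  assumes "set s \<subseteq> Tup" "d \<in> En"
  shows "(\<Sum>u\<leftarrow>s. zeta d u) = \<rho> (star (S s) * d)"
proof -
  have mem: "zeta d u \<in> A" if "u \<in> set s" for u using assms that by (auto intro: zeta_mem)
  have "\<pi> (\<Sum>u\<leftarrow>s. zeta d u) = (\<Sum>u\<leftarrow>s. \<pi> (zeta d u))"
    by (rule clinear_on_sum_list[OF pi_facts(1) A_facts(1) mem])
  also have "\<dots> = (\<Sum>u\<leftarrow>s. star (el u) * d)"
    using assms by (intro arg_cong[where f = sum_list] map_cong) (auto simp: pi_zeta)
  also have "\<dots> = star (S s) * d" by (simp add: S_def star_sum_list sum_list_mult_const)
  finally show ?thesis
    by (intro rho_eqI csubspace_sum_list A_facts(1) mem)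
qed

lemma tensor_dist_eq:
  assumes "set s \<subseteq> Tup" "set r \<subseteq> Tup"
  shows "tensor_dist X n s r = norm (S s - S r)"
proof -
  define d where "d = S s - S r"
  have d: "d \<in> En" unfolding d_def by (intro cvec.subspace_diff En_subspace S_En assms)
  have mem: "star (S s) * d \<in> \<pi> ` A" "star (S r) * d \<in> \<pi> ` A" "star d * d \<in> \<pi> ` A"
    by (intro star_En_En S_En d assms)+
  have "tensor_vec X n s - tensor_vec X n r = zeta d"
    by (simp add: tensor_vec_eq assms d_def zeta_diff S_En)
  hence "tensor_dist X n s r = sqrt (norm (\<rho> (star (S s) * d) - \<rho> (star (S r) * d)))"
    by (simp add: tensor_dist_def sum_zeta assms d)
  also have "\<rho> (star (S s) * d) - \<rho> (star (S r) * d) = \<rho> (star d * d)"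
    using mem by (simp add: rho_diff[symmetric] d_def star_diff left_diff_distrib)
  also have "sqrt (norm \<dots>) = norm d"
    using mem by (simp add: norm_rho cstar_identity)
  finally show ?thesis by (simp add: d_def)
qed

lemma zeta_tendsto:
  assumes "\<And>k. f k \<in> En" "f \<longlonglongrightarrow> d"
  shows "(\<lambda>k. zeta (f k) u) \<longlonglongrightarrow> zeta d u"
proof (cases "u \<in> Tup")
  case True
  have "(\<lambda>k. \<rho> (star (el u) * f k)) \<longlonglongrightarrow> \<rho> (star (el u) * d)"
    by (intro rho_tendsto star_En_En el_En True assms tendsto_mult_left)
  thus ?thesis using True by (simp add: zeta_def)
qed (simp add: zeta_def)

text \<open>\<open>tensor_dist\<close> is the norm distance in the complete target algebra, so the
  abstract completion becomes a limit there: Cauchy sums converge to some d, and the pointwise limit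
  has to be \<open>zeta d\<close>.\<close>

lemma tensor_tendsto_iff:
  "tensor_tendsto X n s \<zeta> \<longleftrightarrow>
    (\<forall>k. set (s k) \<subseteq> Tup) \<and> (\<exists>d. (\<lambda>k. S (s k)) \<longlonglongrightarrow> d \<and> \<zeta> = zeta d)"
proof (cases "\<forall>k. set (s k) \<subseteq> Tup")
  case s: True
  have vec: "tensor_vec X n (s k) = zeta (S (s k))" for k using s by (simp add: tensor_vec_eq)
  have dist: "tensor_dist X n (s j) (s k) = norm (S (s j) - S (s k))" for j k
    using s by (simp add: tensor_dist_eq)
  have "tensor_tendsto X n s \<zeta> \<longleftrightarrow> Cauchy (\<lambda>k. S (s k)) \<and> (\<forall>u. (\<lambda>k. zeta (S (s k)) u) \<longlonglongrightarrow> \<zeta> u)"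
    using s by (simp add: tensor_tendsto_def vec dist Cauchy_iff)
  also have "\<dots> \<longleftrightarrow> (\<exists>d. (\<lambda>k. S (s k)) \<longlonglongrightarrow> d \<and> \<zeta> = zeta d)"
  proof
    assume L: "Cauchy (\<lambda>k. S (s k)) \<and> (\<forall>u. (\<lambda>k. zeta (S (s k)) u) \<longlonglongrightarrow> \<zeta> u)"
    then obtain d where d: "(\<lambda>k. S (s k)) \<longlonglongrightarrow> d"
      unfolding Cauchy_convergent_iff convergent_def by blast
    have "\<zeta> u = zeta d u" for u
    proof (rule LIMSEQ_unique)
      show "(\<lambda>k. zeta (S (s k)) u) \<longlonglongrightarrow> \<zeta> u" using L by simp
      show "(\<lambda>k. zeta (S (s k)) u) \<longlonglongrightarrow> zeta d u"
        by (rule zeta_tendsto[OF _ d]) (simp add: S_En s)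
    qed
    hence "\<zeta> = zeta d" by (rule ext)
    thus "\<exists>d. (\<lambda>k. S (s k)) \<longlonglongrightarrow> d \<and> \<zeta> = zeta d" using d by blast
  next
    assume "\<exists>d. (\<lambda>k. S (s k)) \<longlonglongrightarrow> d \<and> \<zeta> = zeta d"
    then obtain d where d: "(\<lambda>k. S (s k)) \<longlonglongrightarrow> d" "\<zeta> = zeta d" by blast
    have "(\<lambda>k. zeta (S (s k)) u) \<longlonglongrightarrow> \<zeta> u" for u
      unfolding d(2) by (rule zeta_tendsto[OF _ d(1)]) (simp add: S_En s)
    thus "Cauchy (\<lambda>k. S (s k)) \<and> (\<forall>u. (\<lambda>k. zeta (S (s k)) u) \<longlonglongrightarrow> \<zeta> u)"
      using LIMSEQ_imp_Cauchy[OF d(1)] by simp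
  qed
  finally show ?thesis using s by simp
qed (auto simp: tensor_tendsto_def)

lemma tensor_tendsto_zeta_iff:
  assumes "d \<in> En"
  shows "tensor_tendsto X n s (zeta d) \<longleftrightarrow> (\<forall>k. set (s k) \<subseteq> Tup) \<and> (\<lambda>k. S (s k)) \<longlonglongrightarrow> d"
proof
  assume "tensor_tendsto X n s (zeta d)"
  then obtain d' where s: "\<forall>k. set (s k) \<subseteq> Tup" and d': "(\<lambda>k. S (s k)) \<longlonglongrightarrow> d'" "zeta d = zeta d'"
    unfolding tensor_tendsto_iff by blast
  have "d' \<in> En" by (rule closed_sequentially[OF En_closed _ d'(1)]) (simp add: S_En s)
  hence "d = d'" using zeta_inj[OF assms _ d'(2)] by simp
  thus "(\<forall>k. set (s k) \<subseteq> Tup) \<and> (\<lambda>k. S (s k)) \<longlonglongrightarrow> d" using s d' by simp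
next
  assume "(\<forall>k. set (s k) \<subseteq> Tup) \<and> (\<lambda>k. S (s k)) \<longlonglongrightarrow> d"
  thus "tensor_tendsto X n s (zeta d)" unfolding tensor_tendsto_iff by blast
qed

abbreviation "P \<equiv> tensor_power X n"

lemma power_space: "corr_space P = zeta ` En"
proof
  show "corr_space P \<subseteq> zeta ` En"
  proof
    fix \<zeta> assume "\<zeta> \<in> corr_space P"
    then obtain s where "tensor_tendsto X n s \<zeta>" by (auto simp: tensor_power_def)
    then obtain d where s: "\<forall>k. set (s k) \<subseteq> Tup" and d: "(\<lambda>k. S (s k)) \<longlonglongrightarrow> d" "\<zeta> = zeta d"
      unfolding tensor_tendsto_iff by blast
    have "d \<in> En" by (rule closed_sequentially[OF En_closed _ d(1)]) (simp add: S_En s)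
    thus "\<zeta> \<in> zeta ` En" using d(2) by blast
  qed
  show "zeta ` En \<subseteq> corr_space P"
  proof
    fix \<zeta> assume "\<zeta> \<in> zeta ` En"
    then obtain d where d: "d \<in> En" "\<zeta> = zeta d" by blast
    obtain s where "\<And>k. set (s k) \<subseteq> Tup" "(\<lambda>k. S (s k)) \<longlonglongrightarrow> d" by (fact En_obtain[OF d(1)])
    hence "tensor_tendsto X n s \<zeta>" unfolding tensor_tendsto_iff d(2) by blast
    thus "\<zeta> \<in> corr_space P" by (auto simp: tensor_power_def)
  qed
qed

text \<open>As \<open>zeta\<close> is injective on \<open>En\<close>, all sequences that represent
  \<open>zeta d\<close> have sums converging to d.\<close>

lemma rep_power_zeta:
  assumes "d \<in> En"
  shows "rep_power X t n (zeta d) = d"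
  unfolding rep_power_def tensor_tendsto_zeta_iff[OF assms] S_def[symmetric]
proof (rule the_equality)
  obtain s where "\<And>k. set (s k) \<subseteq> Tup" "(\<lambda>k. S (s k)) \<longlonglongrightarrow> d" by (fact En_obtain[OF assms])
  thus "\<exists>s. ((\<forall>k. set (s k) \<subseteq> Tup) \<and> (\<lambda>k. S (s k)) \<longlonglongrightarrow> d) \<and> (\<lambda>k. S (s k)) \<longlonglongrightarrow> d" by blast
  fix d' assume "\<exists>s. ((\<forall>k. set (s k) \<subseteq> Tup) \<and> (\<lambda>k. S (s k)) \<longlonglongrightarrow> d) \<and> (\<lambda>k. S (s k)) \<longlonglongrightarrow> d'"
  thus "d' = d" using LIMSEQ_unique by blast
qed

lemma power_ip:
  assumes d: "d \<in> En" and d': "d' \<in> En"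
  shows "corr_ip P (zeta d) (zeta d') = \<rho> (star d * d')"
proof -
  have lim: "(\<lambda>k. \<Sum>u\<leftarrow>s k. zeta d' u) \<longlonglongrightarrow> \<rho> (star d * d')"
    if s: "\<forall>k. set (s k) \<subseteq> Tup" "(\<lambda>k. S (s k)) \<longlonglongrightarrow> d" for s
  proof -
    have "(\<lambda>k. \<rho> (star (S (s k)) * d')) \<longlonglongrightarrow> \<rho> (star d * d')"
      by (intro rho_tendsto star_En_En S_En d' tendsto_mult_right tendsto_star s(2))
        (use s(1) in simp)
    thus ?thesis using s(1) d' by (simp add: sum_zeta)
  qed
  have "(THE a. \<exists>s. tensor_tendsto X n s (zeta d) \<and> (\<lambda>k. \<Sum>u\<leftarrow>s k. zeta d' u) \<longlonglongrightarrow> a) = \<rho> (star d * d')"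
    unfolding tensor_tendsto_zeta_iff[OF d]
  proof (rule the_equality)
    obtain s where s: "\<And>k. set (s k) \<subseteq> Tup" "(\<lambda>k. S (s k)) \<longlonglongrightarrow> d" by (fact En_obtain[OF d])
    show "\<exists>s. ((\<forall>k. set (s k) \<subseteq> Tup) \<and> (\<lambda>k. S (s k)) \<longlonglongrightarrow> d) \<and>
        (\<lambda>k. \<Sum>u\<leftarrow>s k. zeta d' u) \<longlonglongrightarrow> \<rho> (star d * d')"
      by (intro exI[of _ s] conjI allI s lim)
    fix a assume "\<exists>s. ((\<forall>k. set (s k) \<subseteq> Tup) \<and> (\<lambda>k. S (s k)) \<longlonglongrightarrow> d) \<and>
        (\<lambda>k. \<Sum>u\<leftarrow>s k. zeta d' u) \<longlonglongrightarrow> a"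
    then obtain s where "\<forall>k. set (s k) \<subseteq> Tup" "(\<lambda>k. S (s k)) \<longlonglongrightarrow> d"
      "(\<lambda>k. \<Sum>u\<leftarrow>s k. zeta d' u) \<longlonglongrightarrow> a" by blast
    thus "a = \<rho> (star d * d')" using LIMSEQ_unique lim by blast
  qed
  thus ?thesis by (simp add: tensor_power_def)
qed

lemma power_ract:
  assumes d: "d \<in> En" and a: "a \<in> A"
  shows "corr_ract P (zeta d) a = zeta (d * \<pi> a)"
proof -
  have "zeta d u * a = zeta (d * \<pi> a) u" for u
    using rho_mult[OF star_En_En[OF el_En d] a]
    by (simp add: zeta_def mult.assoc)
  thus ?thesis by (simp add: tensor_power_def)
qed

sublocale PE: corr_embedding P "rep_power X t n"
proof
  show "csubspace (corr_space P)"
    unfolding power_space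
  proof (rule cvec.subspaceI)
    show "0 \<in> zeta ` En"
      using zeta_scale[OF cvec.subspace_0[OF En_subspace], of 0] cvec.subspace_0[OF En_subspace]
      by (metis cvec.scale_zero_left imageI)
    show "x + y \<in> zeta ` En" if "x \<in> zeta ` En" "y \<in> zeta ` En" for x y
      using that by (auto simp: zeta_add[symmetric] cvec.subspace_add[OF En_subspace])
    show "c *\<^sub>C x \<in> zeta ` En" if "x \<in> zeta ` En" for c x
      using that by (auto simp: zeta_scale[symmetric] cvec.subspace_scale[OF En_subspace])
  qed
  show "clinear_on (corr_space P) (rep_power X t n)"
    unfolding power_space clinear_on_def
    by (auto simp: zeta_add[symmetric] zeta_scale[symmetric] rep_power_zeta
        cvec.subspace_add[OF En_subspace] cvec.subspace_scale[OF En_subspace])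
  show "inj_on (rep_power X t n) (corr_space P)"
    unfolding power_space by (rule inj_onI) (auto simp: rep_power_zeta)
  have "rep_power X t n ` corr_space P = En"
    unfolding power_space by (simp add: image_image rep_power_zeta)
  thus "closed (rep_power X t n ` corr_space P)" by (simp add: En_closed)
  show "corr_norm P x = norm (rep_power X t n x)" if "x \<in> corr_space P" for x
    using that unfolding power_space
    by (elim imageE) (simp add: corr_norm_def power_ip rep_power_zeta norm_rho star_En_En cstar_identity)
  fix x y assume "x \<in> corr_space P" "y \<in> corr_space P"
  then obtain a b where ab: "a \<in> En" "b \<in> En" "x = zeta a" "y = zeta b"
    unfolding power_space by blast
  have ip_mem: "star c * d \<in> \<pi> ` A" if "c \<in> En" "d \<in> En" for c d by (rule star_En_En[OF that])
  { fix z assume "z \<in> corr_space P"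
    then obtain c where c: "c \<in> En" "z = zeta c" unfolding power_space by blast
    have eq: "corr_ract P x (corr_ip P y z) = zeta (a * (star b * c))"
      using ip_mem[OF ab(2) c(1)] by (simp add: ab c power_ip power_ract rho)
    have mem: "a * (star b * c) \<in> En" by (intro En_pi ip_mem ab c)
    show "corr_ract P x (corr_ip P y z) \<in> corr_space P"
      unfolding eq power_space using mem by (rule imageI)
    show "rep_power X t n (corr_ract P x (corr_ip P y z)) =
        rep_power X t n x * star (rep_power X t n y) * rep_power X t n z"
      unfolding eq by (simp add: mem rep_power_zeta ab c mult.assoc) }
  { fix x' y' assume "x' \<in> corr_space P" "y' \<in> corr_space P"
    then obtain a' b' where ab': "a' \<in> En" "b' \<in> En" "x' = zeta a'" "y' = zeta b'"
      unfolding power_space by blast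
    assume "star (rep_power X t n x) * rep_power X t n y = star (rep_power X t n x') * rep_power X t n y'"
    thus "corr_ip P x y = corr_ip P x' y'"
      by (simp add: ab ab' rep_power_zeta power_ip) }
qed

lemma range_rep_power: "rep_power X t n ` corr_space P = En"
  unfolding power_space by (simp add: image_image rep_power_zeta)

lemma psi_compacts: "psi P (rep_power X t n) ` compacts P = closure (cspan (ketbras En))"
  using PE.psi_compacts_eq PE.K_def by (simp add: range_rep_power)

lemma psi_compacts_subset:
  assumes C: "csubspace C" "closed C" and "\<And>u v. u \<in> Tup \<Longrightarrow> v \<in> Tup \<Longrightarrow> el u * star (el v) \<in> C"
  shows "psi P (rep_power X t n) ` compacts P \<subseteq> C"
proof -
  have "x * star y \<in> C" if xy: "x \<in> En" "y \<in> En" for x y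
  proof (rule closed_span_mult[OF C _ _ star_En[OF xy(2)]])
    show "x \<in> closure (cspan (el ` Tup))" using xy by (simp add: En_def)
    fix a b assume "a \<in> el ` Tup" "b \<in> (\<lambda>u. star (el u)) ` Tup"
    thus "a * b \<in> C" using assms(3) by blast
  qed
  hence "ketbras En \<subseteq> C" unfolding ketbras_def by blast
  thus ?thesis unfolding psi_compacts by (rule closed_span_least[OF C])
qed

lemma el_star_el_mem: "u \<in> Tup \<Longrightarrow> v \<in> Tup \<Longrightarrow> el u * star (el v) \<in> psi P (rep_power X t n) ` compacts P"
  unfolding psi_compacts by (rule closed_span_base) (use el_En in \<open>auto simp: ketbras_def\<close>)

end

section \<open>The core and the bimodule structure\<close>

context injective_rep
begin

text \<open>The products of degree zero and positive length. \<pi>(A), the case of length 0, is kept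
  apart because the empty product is 0 here.\<close>

definition core :: "'d set" where
  "core = {el u * star (el v) |u v. u \<noteq> [] \<and> length u = length v \<and> set u \<subseteq> W \<and> set v \<subseteq> W}"

abbreviation "AI \<equiv> A_inf X \<pi> t"
abbreviation "XI \<equiv> X_inf X \<pi> t"

lemma coreI: "u \<noteq> [] \<Longrightarrow> length u = length v \<Longrightarrow> set u \<subseteq> W \<Longrightarrow> set v \<subseteq> W \<Longrightarrow> el u * star (el v) \<in> core"
  by (auto simp: core_def)

lemma star_coreI:
  assumes "u \<noteq> []" "length u = length v" "set u \<subseteq> W" "set v \<subseteq> W"
  shows "star (el u * star (el v)) \<in> core"
proof -
  have "v \<noteq> []" using assms by auto
  thus ?thesis using coreI[of v u] assms by (simp add: star_mult star_star)
qed

text \<open>By \<open>psi_compacts\<close>, the n-th tensor power contributes the closed span of x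
  y* over the range of t^n, which is generated by the core elements of length n. This removes
  \<open>tensor_power\<close> from the remaining arguments.\<close>

lemma A_inf_eq: "AI = closure (cspan (\<pi> ` A \<union> core))"
proof
  let ?D = "closure (cspan (\<pi> ` A \<union> core))"
  show "AI \<subseteq> ?D"
    unfolding A_inf_def
  proof (rule closed_span_least)
    have "psi (tensor_power X n) (rep_power X t n) ` compacts (tensor_power X n) \<subseteq> ?D" if n: "n \<ge> 1" for n
    proof -
      interpret fixed_power X \<pi> t n by standard (rule n)
      show ?thesis
      proof (rule psi_compacts_subset)
        fix u v assume "u \<in> Tup" "v \<in> Tup"
        hence "el u * star (el v) \<in> core"
          using TupD[of u] TupD[of v] by (intro coreI) auto
        thus "el u * star (el v) \<in> ?D" by (intro closed_span_base) simp
      qed simp_all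
    qed
    moreover have "\<pi> ` A \<subseteq> ?D" by (auto intro: closed_span_base)
    ultimately show "\<pi> ` A \<union> (\<Union>n\<in>{1..}. psi (tensor_power X n) (rep_power X t n) ` compacts (tensor_power X n)) \<subseteq> ?D"
      by auto
  qed simp_all
  show "?D \<subseteq> AI"
  proof (rule closed_span_least)
    show "\<pi> ` A \<union> core \<subseteq> AI"
    proof
      fix x assume "x \<in> \<pi> ` A \<union> core"
      thus "x \<in> AI"
      proof
        assume "x \<in> core"
        then obtain u v where uv: "x = el u * star (el v)" "u \<noteq> []" "length u = length v" "set u \<subseteq> W" "set v \<subseteq> W"
          by (auto simp: core_def)
        have len: "1 \<le> length u" using uv(2) by (simp add: Suc_le_eq)
        interpret fixed_power X \<pi> t "length u" by standard (rule len)
        have "x \<in> psi P (rep_power X t (length u)) ` compacts P"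
          unfolding uv(1) using uv(3-5) by (intro el_star_el_mem) (simp_all add: tuples_def)
        moreover have "length u \<in> {1..}" using n by simp
        ultimately show ?thesis unfolding A_inf_def by (intro closed_span_base) blast
      qed (auto simp: A_inf_def intro: closed_span_base)
    qed
  qed (simp_all add: A_inf_def)
qed

lemma A_inf_subspace: "csubspace AI" and A_inf_closed: "closed AI"
  by (simp_all add: A_inf_def)

lemma X_inf_subspace: "csubspace XI" and X_inf_closed: "closed XI"
  by (simp_all add: X_inf_def)

lemma pi_A_inf: "a \<in> A \<Longrightarrow> \<pi> a \<in> AI" and core_A_inf: "c \<in> core \<Longrightarrow> c \<in> AI"
  unfolding A_inf_eq by (auto intro: closed_span_base)

lemma core_cases:
  assumes "c \<in> core"
  obtains u v where "c = el u * star (el v)" "u \<noteq> []" "length u = length v" "set u \<subseteq> W" "set v \<subseteq> W"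
  using assms by (auto simp: core_def)

lemma A_inf_star: "a \<in> AI \<Longrightarrow> star a \<in> AI"
  unfolding A_inf_eq
proof (rule closed_span_star)
  fix x assume "x \<in> \<pi> ` A \<union> core"
  thus "star x \<in> closure (cspan (\<pi> ` A \<union> core))"
  proof
    assume "x \<in> core"
    then obtain u v where "x = el u * star (el v)" "u \<noteq> []" "length u = length v" "set u \<subseteq> W" "set v \<subseteq> W"
      by (rule core_cases)
    hence "star x \<in> core" using star_coreI[of u v] by simp
    thus ?thesis by (intro closed_span_base) simp
  next
    assume "x \<in> \<pi> ` A"
    hence "star x \<in> \<pi> ` A" by (rule cstar_subalgebraD(4)[OF range_pi_subalgebra])
    thus ?thesis by (intro closed_span_base) simp
  qed
qed simp_all

lemma pi_core: "a \<in> A \<Longrightarrow> c \<in> core \<Longrightarrow> \<pi> a * c \<in> core"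
proof (elim core_cases)
  fix u v assume a: "a \<in> A" and c: "c = el u * star (el v)" "u \<noteq> []" "length u = length v" "set u \<subseteq> W" "set v \<subseteq> W"
  obtain w where w: "length w = length u" "set w \<subseteq> W" "\<pi> a * el u = el w"
    by (rule pi_el[OF a c(2,4)])
  have "w \<noteq> []" using w(1) c(2) by auto
  thus "\<pi> a * c \<in> core" using w c coreI[of w v] by (simp flip: mult.assoc)
qed

lemma core_pi:
  assumes a: "a \<in> A" and c: "c \<in> core"
  shows "c * \<pi> a \<in> AI"
proof -
  obtain u v where uv: "c = el u * star (el v)" "u \<noteq> []" "length u = length v" "set u \<subseteq> W" "set v \<subseteq> W"
    using c by (rule core_cases)
  have "star c \<in> core" using uv star_coreI[of u v] by simp
  hence "\<pi> (star a) * star c \<in> core" by (rule pi_core[OF A_facts(4)[OF a]])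
  hence "star (\<pi> (star a) * star c) \<in> AI" by (intro A_inf_star core_A_inf)
  thus ?thesis by (simp add: pi_facts(3)[OF a] star_mult star_star)
qed

text \<open>Split w after as many vectors as v has: \<open>star (el v) * el w1\<close> lies in
  \<pi>(A) and is absorbed into a neighbouring tuple. The opposite length relation is reduced to
  this one by adjoints in \<open>A_inf_mult\<close>.\<close>

lemma core_core_le:
  assumes u: "u \<noteq> []" "length u = length v" "set u \<subseteq> W" "set v \<subseteq> W"
    and w: "length w = length z" "set w \<subseteq> W" "set z \<subseteq> W" and le: "length v \<le> length w"
  shows "(el u * star (el v)) * (el w * star (el z)) \<in> AI"
proof -
  define w1 w2 where "w1 = take (length v) w" and "w2 = drop (length v) w"
  have len1: "length v = length w1" using le by (simp add: w1_def)
  have sets: "set w1 \<subseteq> W" "set w2 \<subseteq> W"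
    using w(2) set_take_subset[of "length v" w] set_drop_subset[of "length v" w] by (auto simp: w1_def w2_def)
  have v: "v \<noteq> []" using u by auto
  hence w1: "w1 \<noteq> []" using len1 by auto
  define a where "a = tensor_ip X v w1"
  have a: "a \<in> A" "star (el v) * el w1 = \<pi> a"
    using star_el_el[OF len1 v u(4) sets(1)] by (auto simp: a_def)
  have ww: "w = w1 @ w2" by (simp add: w1_def w2_def)
  show ?thesis
  \<comment> \<open>For an empty remainder \<open>el w2\<close> is 0 and cannot take up \<pi>(a),
    which goes into u instead.\<close>
  proof (cases "w2 = []")
    case True
    have "(el u * star (el v)) * (el w * star (el z)) = el u * ((star (el v) * el w1) * star (el z))"
      by (simp add: ww True mult.assoc)
    also have "\<dots> = (el u * \<pi> a) * star (el z)" by (simp add: a mult.assoc)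
    finally have eq: "(el u * star (el v)) * (el w * star (el z)) = (el u * \<pi> a) * star (el z)" .
    obtain u' where u': "length u' = length u" "set u' \<subseteq> W" "el u * \<pi> a = el u'"
      by (rule el_pi[OF a(1) u(1,3)])
    have "length z = length u'" "u' \<noteq> []" using True ww w len1 u u' by auto
    thus ?thesis unfolding eq u'(3) by (intro core_A_inf coreI u' w) simp_all
  next
    case False
    have "(el u * star (el v)) * (el w * star (el z)) = el u * ((star (el v) * el w1) * el w2 * star (el z))"
      by (simp add: ww el_append w1 False mult.assoc)
    also have "\<dots> = el u * ((\<pi> a * el w2) * star (el z))" by (simp add: a)
    finally have eq: "(el u * star (el v)) * (el w * star (el z)) = el u * ((\<pi> a * el w2) * star (el z))" .
    obtain w' where w': "length w' = length w2" "set w' \<subseteq> W" "\<pi> a * el w2 = el w'"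
      by (rule pi_el[OF a(1) False sets(2)])
    have ne: "w' \<noteq> []" using w' False by auto
    have "el u * (el w' * star (el z)) = el (u @ w') * star (el z)"
      using u ne by (simp add: el_append mult.assoc)
    moreover have "length (u @ w') = length z" using w' w u len1 ww by simp
    ultimately show ?thesis unfolding eq w'(3)
      using u w w' by (auto intro!: core_A_inf coreI)
  qed
qed

lemma A_inf_mult:
  assumes "a \<in> AI" "b \<in> AI"
  shows "a * b \<in> AI"
proof (rule closed_span_mult[OF A_inf_subspace A_inf_closed _ assms[unfolded A_inf_eq]])
  fix x y assume "x \<in> \<pi> ` A \<union> core" "y \<in> \<pi> ` A \<union> core"
  then consider a b where "a \<in> A" "b \<in> A" "x = \<pi> a" "y = \<pi> b"
    | a where "a \<in> A" "x = \<pi> a" "y \<in> core" | b where "b \<in> A" "x \<in> core" "y = \<pi> b"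
    | "x \<in> core" "y \<in> core" by blast
  thus "x * y \<in> AI"
  proof cases
    case 1
    thus ?thesis using pi_A_inf[OF A_facts(3)[OF 1(1,2)]] pi_facts(2)[OF 1(1,2)] by simp
  next
    case 2
    thus ?thesis using core_A_inf[OF pi_core[OF 2(1,3)]] by simp
  next
    case 3
    thus ?thesis using core_pi[OF 3(1,2)] by simp
  next
    case 4
    obtain u v where x: "x = el u * star (el v)" "u \<noteq> []" "length u = length v" "set u \<subseteq> W" "set v \<subseteq> W"
      using 4(1) by (rule core_cases)
    obtain w z where y: "y = el w * star (el z)" "w \<noteq> []" "length w = length z" "set w \<subseteq> W" "set z \<subseteq> W"
      using 4(2) by (rule core_cases)
    show ?thesis
    proof (cases "length v \<le> length w")
      case True
      show ?thesis unfolding x(1) y(1) by (rule core_core_le[OF x(2-5) y(3-5) True])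
    next
      case False
      have ne: "z \<noteq> []" using y by auto
      have le: "length w \<le> length v" using False by simp
      have "(el z * star (el w)) * (el v * star (el u)) \<in> AI"
        by (rule core_core_le[OF ne y(3)[symmetric] y(5,4) x(3)[symmetric] x(5,4) le])
      hence "star ((el z * star (el w)) * (el v * star (el u))) \<in> AI" by (rule A_inf_star)
      thus ?thesis by (simp add: x(1) y(1) star_mult star_star mult.assoc)
    qed
  qed
qed

lemma A_inf_subalgebra: "cstar_subalgebra AI"
  by (simp add: cstar_subalgebra_def A_inf_subspace A_inf_closed A_inf_mult A_inf_star)

lemma t_A_inf_X_inf: "x \<in> W \<Longrightarrow> a \<in> AI \<Longrightarrow> t x * a \<in> XI"
  unfolding X_inf_def by (rule closed_span_base) blast

lemma X_inf_A_inf: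
  assumes "x \<in> XI" "a \<in> AI"
  shows "x * a \<in> XI"
proof (rule closed_span_mult[OF X_inf_subspace X_inf_closed _ assms(1)[unfolded X_inf_def] closed_span_base[OF assms(2)]])
  fix y b assume "y \<in> {t x * a |x a. x \<in> W \<and> a \<in> AI}" "b \<in> AI"
  then obtain x c where "y = t x * c" "x \<in> W" "c \<in> AI" "b \<in> AI" by blast
  thus "y * b \<in> XI" using t_A_inf_X_inf[OF _ A_inf_mult[of c b]] by (simp add: mult.assoc)
qed

lemma X_inf_star:
  assumes "x \<in> XI"
  shows "star x \<in> closure (cspan {a * star (t x) |x a. x \<in> W \<and> a \<in> AI})"
proof (rule closed_span_star[OF _ _ _ assms[unfolded X_inf_def]])
  fix y assume "y \<in> {t x * a |x a. x \<in> W \<and> a \<in> AI}"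
  then obtain x c where "y = t x * c" "x \<in> W" "c \<in> AI" by blast
  hence "star y = star c * star (t x)" "x \<in> W" "star c \<in> AI" by (auto simp: star_mult A_inf_star)
  thus "star y \<in> closure (cspan {a * star (t x) |x a. x \<in> W \<and> a \<in> AI})"
    by (intro closed_span_base) blast
qed simp_all

text \<open>When a core element multiplies t(x), the first vector of v pairs with x to an element of
  \<pi>(A), and the first vector of u moves to the front; what remains between them is a shorter
  core element or nothing.\<close>

lemma A_inf_X_inf:
  assumes "a \<in> AI" "x \<in> XI"
  shows "a * x \<in> XI"
proof (rule closed_span_mult[OF X_inf_subspace X_inf_closed _ assms[unfolded A_inf_eq X_inf_def]])
  fix y b assume "y \<in> {t x * a |x a. x \<in> W \<and> a \<in> closure (cspan (\<pi> ` A \<union> core))}"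
  then obtain x c where y: "y = t x * c" "x \<in> W" "c \<in> AI" unfolding A_inf_eq by blast
  assume "b \<in> \<pi> ` A \<union> core"
  thus "b * y \<in> XI"
  proof
    assume "b \<in> \<pi> ` A"
    then obtain a where a: "a \<in> A" "b = \<pi> a" by blast
    have "b * y = t (corr_lact X a x) * c"
      by (simp add: a y pi_t mult.assoc[symmetric])
    thus ?thesis using t_A_inf_X_inf[OF X.lact_closed[OF a(1) y(2)] y(3)] by simp
  next
    assume "b \<in> core"
    then obtain u v where uv: "b = el u * star (el v)" "u \<noteq> []" "length u = length v" "set u \<subseteq> W" "set v \<subseteq> W"
      by (rule core_cases)
    then obtain u1 us v1 vs where Cons: "u = u1 # us" "v = v1 # vs"
      by (metis length_0_conv list.exhaust)
    have mem: "u1 \<in> W" "set us \<subseteq> W" "v1 \<in> W" "set vs \<subseteq> W" "length us = length vs"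
      using uv Cons by auto
    have ip: "\<pi> (corr_ip X v1 x) \<in> AI" by (intro pi_A_inf X.ip_closed mem y)
    show ?thesis
    proof (cases "us = []")
      case True
      hence "vs = []" using mem by simp
      hence "b * y = t u1 * (\<pi> (corr_ip X v1 x) * c)"
        using True mem y by (simp add: uv(1) Cons y(1) star_t_t[symmetric] mult.assoc)
      thus ?thesis using t_A_inf_X_inf[OF mem(1) A_inf_mult[OF ip y(3)]] by simp
    next
      case False
      hence "vs \<noteq> []" using mem by auto
      hence "b * y = t u1 * ((el us * star (el vs)) * (\<pi> (corr_ip X v1 x) * c))"
        using False mem y by (simp add: uv(1) Cons y(1) star_t_t[symmetric] mult.assoc el_Cons star_mult)
      moreover have "el us * star (el vs) \<in> AI"
        using False mem by (intro core_A_inf coreI)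
      ultimately show ?thesis
        using t_A_inf_X_inf[OF mem(1) A_inf_mult[OF _ A_inf_mult[OF ip y(3)]]] by simp
    qed
  qed
qed

lemma X_inf_ip:
  assumes "x \<in> XI" "y \<in> XI"
  shows "star x * y \<in> AI"
proof (rule closed_span_mult[OF A_inf_subspace A_inf_closed _ X_inf_star[OF assms(1)] assms(2)[unfolded X_inf_def]])
  fix a b assume "a \<in> {a * star (t x) |x a. x \<in> W \<and> a \<in> AI}" "b \<in> {t x * a |x a. x \<in> W \<and> a \<in> AI}"
  then obtain c x d y where ab: "a = c * star (t x)" "b = t y * d" "x \<in> W" "y \<in> W" "c \<in> AI" "d \<in> AI" by blast
  have "a * b = c * (\<pi> (corr_ip X x y) * d)"
    by (simp add: ab star_t_t[symmetric] mult.assoc)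
  thus "a * b \<in> AI" by (simp add: ab A_inf_mult pi_A_inf X.ip_closed)
qed

text \<open>On core elements, multiplying by \<open>t x\<close> and \<open>star (t y)\<close>
  lengthens both tuples by one and so keeps the degree zero. This is the source of the left inner
  product x y* on \<open>X_inf\<close>.\<close>

lemma t_A_inf_star_t:
  assumes "a \<in> AI" "x \<in> W" "y \<in> W"
  shows "t x * a * star (t y) \<in> AI"
proof -
  \<comment> \<open>The preimage of AI as target reduces the triple product to a product of two
    closed spans.\<close>
  have "t x * a \<in> {b. b * star (t y) \<in> AI}"
  proof (rule closed_span_mult[OF _ _ _ closed_span_base assms(1)[unfolded A_inf_eq]])
    show "csubspace {b. b * star (t y) \<in> AI}"
      by (rule cvec.subspaceI)
        (auto simp: distrib_right scaleC_mult_left cvec.subspace_0[OF A_inf_subspace]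
          cvec.subspace_add[OF A_inf_subspace] cvec.subspace_scale[OF A_inf_subspace])
    have "closed ((\<lambda>b. b * star (t y)) -` AI)"
      by (intro continuous_closed_vimage A_inf_closed continuous_intros)
    thus "closed {b. b * star (t y) \<in> AI}" by (simp add: vimage_def)
    show "t x \<in> {t x}" by simp
    fix c b assume c: "c \<in> {t x}" and "b \<in> \<pi> ` A \<union> core"
    from this(2) show "c * b \<in> {b. b * star (t y) \<in> AI}"
    proof
      assume "b \<in> \<pi> ` A"
      then obtain a where a: "a \<in> A" "b = \<pi> a" by blast
      have "el [corr_ract X x a] * star (el [y]) \<in> core"
        using a assms X.ract_closed by (intro coreI) auto
      thus ?thesis using c a assms core_A_inf by (simp add: t_pi)
    next
      assume "b \<in> core"
      then obtain u v where uv: "b = el u * star (el v)" "u \<noteq> []" "length u = length v" "set u \<subseteq> W" "set v \<subseteq> W"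
        by (rule core_cases)
      have ne: "v \<noteq> []" using uv by auto
      have "el (x # u) * star (el (y # v)) \<in> core"
        using uv assms by (intro coreI) auto
      thus ?thesis using c core_A_inf by (simp add: uv el_Cons[OF uv(2)] el_Cons[OF ne] star_mult mult.assoc)
    qed
  qed
  thus ?thesis by simp
qed

lemma X_inf_lip:
  assumes "x \<in> XI" "y \<in> XI"
  shows "x * star y \<in> AI"
proof (rule closed_span_mult[OF A_inf_subspace A_inf_closed _ assms(1)[unfolded X_inf_def] X_inf_star[OF assms(2)]])
  fix a b assume "b \<in> {a * star (t x) |x a. x \<in> W \<and> a \<in> AI}" "a \<in> {t x * a |x a. x \<in> W \<and> a \<in> AI}"
  then obtain c x d y where ab: "b = c * star (t x)" "a = t y * d" "x \<in> W" "y \<in> W" "c \<in> AI" "d \<in> AI" by blast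
  have "a * b = t y * (d * c) * star (t x)"
    by (simp add: ab mult.assoc)
  thus "a * b \<in> AI" by (simp only: t_A_inf_star_t[OF A_inf_mult[OF ab(6,5)] ab(4,3)])
qed

text \<open>\<open>A_inf\<close> may have no unit. An approximate unit for \<open>star (t x)\<close>
  is a polynomial in t(x)* t(x) without constant term, hence lies in \<pi>(A); adjoints move it to
  the right of t(x).\<close>

lemma t_X_inf:
  assumes x: "x \<in> W"
  shows "t x \<in> XI"
proof -
  have "t x \<in> closure XI"
    unfolding closure_approachable
  proof (intro allI impI)
    fix e :: real assume "0 < e"
    hence e: "0 < e / 2" by simp
    let ?k = "star (t x) * star (star (t x))"
    obtain p where p: "norm (star (t x) + poly_act p ?k ?k * star (t x)) \<le> e / 2"
      by (rule ex_approx_unit[OF e])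
    define b where "b = star (poly_act p ?k ?k)"
    have k: "?k \<in> \<pi> ` A" using x by (simp add: star_star star_t_t X.ip_closed)
    have "poly_act p ?k ?k \<in> \<pi> ` A"
      by (intro poly_act_closed[OF range_pi_subspace] cstar_subalgebraD(3)[OF range_pi_subalgebra] k)
    hence "b \<in> \<pi> ` A" unfolding b_def by (rule cstar_subalgebraD(4)[OF range_pi_subalgebra])
    hence "b \<in> AI" using pi_A_inf by blast
    hence mem: "- (t x * b) \<in> XI" by (intro cvec.subspace_neg X_inf_subspace t_A_inf_X_inf x)
    have "norm (t x + t x * b) \<le> e / 2"
      using p norm_star[of "star (t x) + poly_act p ?k ?k * star (t x)"]
      by (simp only: star_add star_mult star_star b_def)
    hence "dist (- (t x * b)) (t x) < e"
      using \<open>0 < e\<close> by (simp add: dist_norm norm_minus_commute[of "- (t x * b)"])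
    thus "\<exists>y\<in>XI. dist y (t x) < e" using mem by blast
  qed
  thus ?thesis using X_inf_closed by simp
qed

end

section \<open>Faithfulness of the core and minimality\<close>

context injective_rep
begin

abbreviation "K1 \<equiv> XE.K"

lemma pi_K1:
  assumes a: "a \<in> \<pi> ` A" and k: "k \<in> K1"
  shows "a * k \<in> K1"
proof (rule closed_span_mult[OF XE.K_subspace XE.K_closed _ closed_span_base[OF a] k[unfolded XE.K_def]])
  fix b c assume "b \<in> \<pi> ` A" "c \<in> ketbras (t ` W)"
  then obtain a' x y where abc: "b = \<pi> a'" "a' \<in> A" "c = t x * star (t y)" "x \<in> W" "y \<in> W"
    by (auto simp: ketbras_def)
  have "b * c = t (corr_lact X a' x) * star (t y)"
    by (simp add: abc pi_t[symmetric] mult.assoc)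
  thus "b * c \<in> K1" using abc by (simp add: XE.ketbra_in_K X.lact_closed)
qed

lemma K1_pi:
  assumes a: "a \<in> \<pi> ` A" and k: "k \<in> K1"
  shows "k * a \<in> K1"
proof -
  have "star (star a * star k) \<in> K1"
    by (intro XE.K_star pi_K1 k cstar_subalgebraD(4)[OF range_pi_subalgebra] a)
  thus ?thesis by (simp add: star_mult star_star)
qed

text \<open>K1 is an ideal of \<pi>(A) + K1, so modulo K1 only a matters. This replaces a passage to
  the quotient by K1.\<close>

lemma poly_act_K1:
  assumes a: "a \<in> \<pi> ` A" and k: "k \<in> K1"
  shows "poly_act p (a + k) (a + k) - poly_act p a a \<in> K1"
proof (induction p)
  case 0
  show ?case by (simp add: cvec.subspace_0[OF XE.K_subspace])
next
  case (pCons r p)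
  let ?c = "a + k"
  let ?d = "poly_act p ?c ?c - poly_act p a a"
  have pa: "poly_act p a a \<in> \<pi> ` A"
    by (intro poly_act_closed[OF range_pi_subspace] cstar_subalgebraD(3)[OF range_pi_subalgebra] a)
  have "poly_act (pCons r p) ?c ?c - poly_act (pCons r p) a a =
      r *\<^sub>R k + (a * ?d + k * ?d + k * poly_act p a a)"
    by (simp add: algebra_simps)
  also have "\<dots> \<in> K1"
    unfolding scaleR_scaleC
    by (intro cvec.subspace_add[OF XE.K_subspace] cvec.subspace_scale[OF XE.K_subspace]
        pi_K1 K1_pi XE.K_mult a k pa pCons.IH)
  finally show ?case .
qed

text \<open>Every core element factors as y d with y in t(X), so 1 + u makes l small as soon as it
  makes finitely many such y small.\<close>

lemma span_core_approx:
  assumes "l \<in> cspan core"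
  shows "\<exists>ys M. set ys \<subseteq> t ` W \<and> 0 \<le> M \<and>
    (\<forall>u e. (\<forall>y\<in>set ys. norm (y + u * y) \<le> e) \<longrightarrow> norm (l + u * l) \<le> M * e)"
  using assms
proof (induction rule: cvec.span_induct_alt)
  case base
  show ?case by (intro exI[of _ "[]"] exI[of _ 0]) simp
next
  case (step c x l)
  obtain u v where uv: "x = el u * star (el v)" "u \<noteq> []" "length u = length v" "set u \<subseteq> W" "set v \<subseteq> W"
    using step.hyps(1) by (rule core_cases)
  obtain y d where y: "y \<in> t ` W" "x = y * d"
  proof (cases u)
    case (Cons z us)
    show ?thesis
    proof (cases "us = []")
      case True
      thus ?thesis using that[of "t z" "star (el v)"] uv Cons by simp
    next
      case False
      thus ?thesis using that[of "t z" "el us * star (el v)"] uv Cons by (simp add: el_Cons mult.assoc)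
    qed
  qed (use uv in simp)
  obtain ys M where ys: "set ys \<subseteq> t ` W" "0 \<le> M"
    "\<forall>u e. (\<forall>y\<in>set ys. norm (y + u * y) \<le> e) \<longrightarrow> norm (l + u * l) \<le> M * e"
    using step.IH by blast
  have "norm ((c *\<^sub>C x + l) + w * (c *\<^sub>C x + l)) \<le> (cmod c * norm d + M) * e"
    if w: "\<forall>z\<in>set (y # ys). norm (z + w * z) \<le> e" for w e
  proof -
    have "(c *\<^sub>C x + l) + w * (c *\<^sub>C x + l) = c *\<^sub>C ((y + w * y) * d) + (l + w * l)"
      by (simp add: y distrib_left distrib_right scaleC_mult_right scaleC_add_right mult.assoc)
    also have "norm \<dots> \<le> cmod c * norm ((y + w * y) * d) + norm (l + w * l)"
      by (rule order_trans[OF norm_triangle_ineq]) (simp add: norm_scaleC)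
    also have "\<dots> \<le> cmod c * (e * norm d) + M * e"
    proof (intro add_mono mult_left_mono)
      show "norm ((y + w * y) * d) \<le> e * norm d"
        using w by (intro order_trans[OF norm_mult_ineq] mult_right_mono) auto
      show "norm (l + w * l) \<le> M * e" using ys(3) w by simp
    qed simp
    finally show ?thesis by (simp add: algebra_simps)
  qed
  moreover have "0 \<le> cmod c * norm d + M" "set (y # ys) \<subseteq> t ` W" using ys y by simp_all
  ultimately show ?case by blast
qed

end

locale injective_covariant_rep = injective_rep X \<pi> t
  for X :: "('x::complex_vector, 'a::cstar_algebra) corr"
    and \<pi> :: "'a \<Rightarrow> 'd::cstar_algebra" and t :: "'x \<Rightarrow> 'd" +
  assumes inj_X: "injective_corr X" and cov: "covariant X \<pi> t"
begin

text \<open>Injectivity makes the kernel of \<open>phi\<close> zero, so every a that acts as a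
  compact operator belongs to \<open>katsura_ideal\<close>; \<open>psi_eqI\<close> evaluates
  \<open>psi\<close> there to k.\<close>

lemma covariance:
  assumes a: "a \<in> A" and k: "k \<in> K1" and eq: "\<And>x. x \<in> W \<Longrightarrow> \<pi> a * t x = k * t x"
  shows "\<pi> a = k"
proof -
  have phi: "phi X a x \<in> W" "k * t x = t (phi X a x)" if "x \<in> W" for x
    using that a X.lact_closed[OF a that] by (simp_all add: phi_def eq[symmetric] pi_t)
  have "phi X a \<in> compacts X"
    by (rule XE.compactI[OF k phi(1) _ phi(2)]) (simp_all add: phi_def)
  moreover have "a * b = 0" if "b \<in> ker_phi X" for b
  proof -
    have "phi X 0 = 0"
      unfolding phi_def using clinear_onD(3)[OF X.lact_linear A_facts(1)] by (simp add: fun_eq_iff)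
    hence "phi X b = phi X 0" "b \<in> A" using that by (simp_all add: ker_phi_def)
    hence "b = 0"
      using inj_onD[OF inj_X[unfolded injective_corr_def]] cvec.subspace_0[OF A_facts(1)] by blast
    thus ?thesis by simp
  qed
  ultimately have "a \<in> katsura_ideal X"
    using a by (simp add: katsura_ideal_def)
  hence "\<pi> a = psi X t (phi X a)" using cov by (simp add: covariant_def)
  also have "\<dots> = k" by (rule XE.psi_eqI[OF phi(1) k phi(2)])
  finally show ?thesis .
qed

text \<open>The action of the *-algebra \<open>\<pi>(A) + K1\<close> on \<open>t(X)\<close> is injective by covariance; the cutoff
  functions turn this into isometry, as for *-homomorphisms.\<close>

lemma norm_le_action:
  assumes c: "c \<in> \<pi> ` A" and k: "k \<in> K1"
    and bound: "\<And>x. x \<in> W \<Longrightarrow> norm ((c + k) * t x) \<le> \<delta> * norm (t x)" and \<delta>: "0 \<le> \<delta>"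
  shows "norm (c + k) \<le> \<delta>"
proof (rule ccontr)
  note PA = cstar_subalgebraD[OF range_pi_subalgebra]
  let ?g = "c + k"
  assume "\<not> norm ?g \<le> \<delta>"
  hence less: "\<delta> < norm ?g" by simp
  hence pos: "0 < norm ?g" using \<delta> by linarith
  \<comment> \<open>Passing to g* g gives a self-adjoint element, as the cutoff requires, and keeps
    the decomposition into a part a in \<pi>(A) and a part l in K1.\<close>
  define a where "a = star c * c"
  define l where "l = star c * k + star k * c + star k * k"
  define s where "s = a + l"
  have a: "a \<in> \<pi> ` A" "star a = a"
    by (simp_all add: a_def PA c star_mult star_star)
  have l: "l \<in> K1"
    unfolding l_def
    by (intro cvec.subspace_add[OF XE.K_subspace] pi_K1 K1_pi XE.K_mult XE.K_star PA c k)
  have s_eq: "s = star ?g * ?g"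
    by (simp add: s_def a_def l_def star_add algebra_simps)
  have s: "star s = s" by (simp add: s_eq star_mult star_star)
  have ns: "norm s = norm ?g * norm ?g"
    by (simp add: s_eq cstar_identity power2_eq_square)
  define \<epsilon> where "\<epsilon> = norm ?g * \<delta>"
  have \<epsilon>: "0 \<le> \<epsilon>" "\<epsilon> < norm s"
    using less pos \<delta> by (simp_all add: \<epsilon>_def ns)
  have s_bound: "norm (s * v) \<le> \<epsilon> * norm v" if "v \<in> t ` W" for v
  proof -
    have "norm (s * v) \<le> norm (star ?g) * norm (?g * v)"
      unfolding s_eq mult.assoc by (rule norm_mult_ineq)
    also have "\<dots> \<le> norm ?g * (\<delta> * norm v)"
      using that bound by (auto intro!: mult_left_mono)
    finally show ?thesis by (simp add: \<epsilon>_def mult.assoc)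
  qed
  have sT: "s * v \<in> t ` W" if "v \<in> t ` W" for v
  proof -
    have "a * v \<in> t ` W" using a(1) that by (auto simp: pi_t X.lact_closed)
    moreover have "l * v \<in> t ` W" by (rule XE.K_mult_T[OF l that])
    ultimately show ?thesis
      unfolding s_def distrib_right by (rule cvec.subspace_add[OF range_t_subspace])
  qed
  \<comment> \<open>Strictly between the action bound of s and its norm: the cutoff fs acts as zero
    on t(X), yet cannot vanish because s - fs has norm at most r.\<close>
  define r where "r = (\<epsilon> + norm s) / 2"
  have r: "0 \<le> r" "\<epsilon> < r" "r < norm s" using \<epsilon> by (simp_all add: r_def)
  \<comment> \<open>Large enough for s and a at once: the same polynomials are applied to both,
    which places fs - fa in K1.\<close>
  define m where "m = max (norm s) (norm a) + 1"
  have m: "r \<le> m" "norm s < m" "norm a < m" using r by (simp_all add: m_def)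
  obtain q where q: "\<And>n z. \<bar>z\<bar> \<le> m \<Longrightarrow> \<bar>z * poly (q n) z - (z - max (- r) (min r z))\<bar> \<le> 1 / real (n + 1)"
    by (fact ex_cutoff_polys[OF r(1) m(1)])
  obtain fs where fs: "(\<lambda>n. poly_act (q n) s s) \<longlonglongrightarrow> fs" "norm (s - fs) \<le> r"
    using cutoff_convergent[OF r(1) s m(2) q] by blast
  obtain fa where fa: "(\<lambda>n. poly_act (q n) a a) \<longlonglongrightarrow> fa" "norm (a - fa) \<le> r"
    using cutoff_convergent[OF r(1) a(2) m(3) q] by blast
  have fa_mem: "fa \<in> \<pi> ` A"
    by (rule closed_sequentially[OF range_pi_closed _ fa(1)])
      (intro poly_act_closed[OF range_pi_subspace] PA(3) a)
  have diff_mem: "fs - fa \<in> K1"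
    by (rule closed_sequentially[OF XE.K_closed _ tendsto_diff[OF fs(1) fa(1)]])
      (unfold s_def, rule poly_act_K1[OF a(1) l])
  have zero: "fs * t x = 0" if x: "x \<in> W" for x
  proof -
    have "norm (fs * t x) \<le> 0"
    proof (rule LIMSEQ_le)
      show "(\<lambda>n. norm (poly_act (q n) s s * t x)) \<longlonglongrightarrow> norm (fs * t x)"
        by (intro tendsto_norm tendsto_mult_right fs)
      have "(\<lambda>n. 1 / real (n + 1)) \<longlonglongrightarrow> 0"
        using LIMSEQ_inverse_real_of_nat unfolding inverse_eq_divide Suc_eq_plus1 .
      from tendsto_mult_left_zero[OF this]
      show "(\<lambda>n. 1 / real (n + 1) * norm (t x)) \<longlonglongrightarrow> 0" .
      have "norm (poly_act (q n) s s * t x) \<le> 1 / real (n + 1) * norm (t x)" for n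
      proof -
        have "norm (poly_act (pCons 0 (q n)) s (t x)) \<le> 1 / real (n + 1) * norm (t x)"
        proof (rule poly_act_bound[OF range_t_subspace range_t_closed sT s s_bound \<epsilon>(1) r(2)])
          fix z :: real assume z: "\<bar>z\<bar> \<le> r"
          have "\<bar>z\<bar> \<le> m" using z m by linarith
          from q[OF this, of n] z show "\<bar>poly (pCons 0 (q n)) z\<bar> \<le> 1 / real (n + 1)"
            unfolding poly_pCons by linarith
        qed (use x in simp_all)
        also have "poly_act (pCons 0 (q n)) s (t x) = poly_act (q n) s s * t x"
          by (simp flip: poly_act_mult_self poly_act_mult_right)
        finally show ?thesis .
      qed
      thus "\<exists>N. \<forall>n\<ge>N. norm (poly_act (q n) s s * t x) \<le> 1 / real (n + 1) * norm (t x)" by blast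
    qed
    thus ?thesis by simp
  qed
  obtain a' where a': "a' \<in> A" "fa = \<pi> a'" using fa_mem by blast
  \<comment> \<open>As fs acts as zero, fa and fa - fs have the same action; covariance upgrades
    this to equality.\<close>
  have "\<pi> a' = fa - fs"
  proof (rule covariance[OF a'(1)])
    have "- (fs - fa) \<in> K1" by (rule cvec.subspace_neg[OF XE.K_subspace diff_mem])
    thus "fa - fs \<in> K1" by simp
    show "\<pi> a' * t x = (fa - fs) * t x" if "x \<in> W" for x
      using zero[OF that] by (simp add: a' left_diff_distrib)
  qed
  hence "fs = 0" by (simp add: a')
  thus False using fs(2) r(3) by simp
qed

lemma A_inf_action_injective:
  assumes d: "d \<in> AI" and zero: "\<And>x. x \<in> W \<Longrightarrow> d * t x = 0"
  shows "d = 0"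
proof -
  have zero_X: "d * y = 0" if "y \<in> XI" for y
  proof -
    have "d * y \<in> {0}"
    proof (rule closed_span_mult[OF _ _ _ _ that[unfolded X_inf_def]])
      show "csubspace {0::'d}" by (rule cvec.subspace_single_0)
      show "d \<in> closure (cspan {d})" by (rule closed_span_base) simp
      show "a * b \<in> {0}" if "a \<in> {d}" "b \<in> {t x * a |x a. x \<in> W \<and> a \<in> AI}" for a b
        using that zero by (auto simp flip: mult.assoc)
    qed simp
    thus ?thesis by simp
  qed
  \<comment> \<open>d annihilates all of \<open>X_inf\<close>, in particular d* t(x). The
    annihilator is therefore closed under adjoints, which yields u d = 0 and not only d u =
    0.\<close>
  have star_zero: "star d * t x = 0" if x: "x \<in> W" for x
  proof -
    have "star d * t x \<in> XI" by (intro A_inf_X_inf A_inf_star d t_X_inf x)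
    hence "star (star d * t x) * (star d * t x) = 0"
      using zero_X by (simp add: star_mult star_star mult.assoc)
    thus ?thesis by (rule star_mult_eq_0)
  qed
  have K_d: "u * d = 0" if u: "u \<in> K1" for u
  proof -
    have "star d * star u \<in> {0}"
    proof (rule closed_span_mult[OF _ _ _ _ XE.K_star[OF u, unfolded XE.K_def]])
      show "csubspace {0::'d}" by (rule cvec.subspace_single_0)
      show "star d \<in> closure (cspan {star d})" by (rule closed_span_base) simp
      show "a * b \<in> {0}" if "a \<in> {star d}" "b \<in> ketbras (t ` W)" for a b
        using that star_zero by (auto simp: ketbras_def simp flip: mult.assoc)
    qed simp
    hence "star (u * d) = star 0" by (simp add: star_mult)
    thus ?thesis by (metis star_star)
  qed
  have "norm d \<le> 0 + e" if e: "0 < e" for e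
  proof -
    \<comment> \<open>The estimates below end with norm d \<le> 4 \<epsilon> = e/2.\<close>
    define \<epsilon> where "\<epsilon> = e / 8"
    have \<epsilon>: "0 < \<epsilon>" using e by (simp add: \<epsilon>_def)
    obtain b where b: "b \<in> cspan (\<pi> ` A \<union> core)" "dist b d < \<epsilon>"
      using d \<epsilon> unfolding A_inf_eq closure_approachable by blast
    obtain c l where cl: "b = c + l" "c \<in> \<pi> ` A" "l \<in> cspan core"
    proof -
      have "cspan (\<pi> ` A \<union> core) = {x + y |x y. x \<in> \<pi> ` A \<and> y \<in> cspan core}"
        unfolding cvec.span_Un using range_pi_subspace by (simp add: cvec.span_eq_iff[THEN iffD2])
      thus ?thesis using b(1) that by blast
    qed
    have db: "norm (d - b) \<le> \<epsilon>" using b(2) by (simp add: dist_norm norm_minus_commute)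
    obtain ys M where ys: "set ys \<subseteq> t ` W" "0 \<le> M"
      "\<forall>u e. (\<forall>y\<in>set ys. norm (y + u * y) \<le> e) \<longrightarrow> norm (l + u * l) \<le> M * e"
      using span_core_approx[OF cl(3)] by blast
    have "0 < \<epsilon> / (M + 1)" using \<epsilon> ys(2) by simp
    then obtain u where u: "u \<in> K1" "\<forall>v. norm (v + u * v) \<le> norm v"
      "\<forall>y\<in>set ys. norm (y + u * y) \<le> \<epsilon> / (M + 1)"
      using XE.ex_approx_unit_list[OF ys(1)] by blast
    have "norm (l + u * l) \<le> M * (\<epsilon> / (M + 1))" using ys(3) u(3) by blast
    also have "\<dots> \<le> \<epsilon>" using ys(2) \<epsilon> by (simp add: field_simps)
    finally have lu: "norm (l + u * l) \<le> \<epsilon>" .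
    have ud: "u * d = 0" by (rule K_d[OF u(1)])
    define g where "g = c + u * c"
    \<comment> \<open>Because u d = 0, the difference is (1 + u)(d - b) + (1 + u) l. The first term
      is small since 1 + u is a contraction, the second by the choice of u.\<close>
    have "d - g = (d - b) + (u * (d - b) + (l + u * l)) - u * d"
      by (simp add: g_def cl(1) algebra_simps)
    hence dg_eq: "d - g = ((d - b) + u * (d - b)) + (l + u * l)" by (simp add: ud)
    have dg: "norm (d - g) \<le> 2 * \<epsilon>"
      unfolding dg_eq
      using norm_triangle_ineq[of "(d - b) + u * (d - b)" "l + u * l"] u(2)[rule_format, of "d - b"] db lu
      by linarith
    have "norm g \<le> 2 * \<epsilon>"
      unfolding g_def
    proof (rule norm_le_action[OF cl(2) K1_pi[OF cl(2) u(1)]])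
      fix x assume x: "x \<in> W"
      have "(c + u * c) * t x = - ((d - g) * t x)"
        using zero[OF x] by (simp add: g_def left_diff_distrib)
      hence "norm ((c + u * c) * t x) = norm ((d - g) * t x)" by simp
      also have "\<dots> \<le> 2 * \<epsilon> * norm (t x)"
        using dg by (intro order_trans[OF norm_mult_ineq] mult_right_mono) auto
      finally show "norm ((c + u * c) * t x) \<le> 2 * \<epsilon> * norm (t x)" .
    qed (use \<epsilon> in simp)
    hence "norm d \<le> 4 * \<epsilon>" using dg norm_triangle_ineq[of "d - g" g] by simp
    thus ?thesis using e by (simp add: \<epsilon>_def)
  qed
  hence "norm d \<le> 0" by (rule field_le_epsilon)
  thus ?thesis by simp
qed

section \<open>The bimodule and its minimality\<close>

lemma subcorr_pimsner: "subcorr (pimsner_dilation X \<pi> t) Y B =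
    \<lparr>corr_space = Y, corr_alg = B, corr_ract = (*), corr_ip = (\<lambda>x y. star x * y), corr_lact = (*)\<rparr>"
  by (simp add: subcorr_def pimsner_dilation_def)

lemma pimsner_bimodule: "hilbert_bimodule (pimsner_dilation X \<pi> t)"
  unfolding hilbert_bimodule_def
proof (intro conjI exI[of _ "\<lambda>x y. x * star y"])
  show "cstar_correspondence (pimsner_dilation X \<pi> t)"
    unfolding pimsner_dilation_def
    by (intro cstar_correspondence_subspaceI X_inf_subspace X_inf_closed A_inf_subalgebra
        X_inf_A_inf A_inf_X_inf X_inf_ip)
  have "cpositive (x * star x) \<and> (x * star x = 0 \<longrightarrow> x = 0)" for x :: 'd
  proof
    show "cpositive (x * star x)" unfolding cpositive_def by (rule exI[of _ "star x"]) (simp add: star_star)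
    show "x * star x = 0 \<longrightarrow> x = 0" using norm_mult_star[of x] by auto
  qed
  thus "\<forall>x\<in>corr_space (pimsner_dilation X \<pi> t). cpositive (x * star x) \<and> (x * star x = 0 \<longrightarrow> x = 0)"
    by blast
qed (simp_all add: pimsner_dilation_def X_inf_lip clinear_on_def distrib_right scaleC_mult_left
    mult.assoc star_mult star_star)

lemma X_subcorrespondence:
  "is_subcorrespondence (t ` W) (\<pi> ` A) (pimsner_dilation X \<pi> t)"
  unfolding is_subcorrespondence_def
proof (intro conjI)
  show "t ` W \<subseteq> corr_space (pimsner_dilation X \<pi> t)" using t_X_inf by (auto simp: pimsner_dilation_def)
  show "\<pi> ` A \<subseteq> corr_alg (pimsner_dilation X \<pi> t)" using pi_A_inf by (auto simp: pimsner_dilation_def)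
  show "cstar_correspondence (subcorr (pimsner_dilation X \<pi> t) (t ` W) (\<pi> ` A))"
    unfolding subcorr_pimsner
    by (intro cstar_correspondence_subspaceI range_t_subspace range_t_closed range_pi_subalgebra)
      (auto simp: t_pi pi_t star_t_t X.ract_closed X.lact_closed X.ip_closed)
qed

lemma X_isomorphism:
  "corr_isomorphism X (subcorr (pimsner_dilation X \<pi> t) (t ` W) (\<pi> ` A)) \<pi> t"
  unfolding corr_isomorphism_def subcorr_pimsner
  using pi_hom t_linear inj_pi inj_t
  by (simp add: inj_on_imp_bij_betw t_pi pi_t star_t_t)

text \<open>B is determined first, since left inner products force the whole core into B. Then Y is
  closed and contains t(X) \<open>A_inf\<close>, hence equals \<open>X_inf\<close>.\<close>

lemma pimsner_minimal:
  assumes B: "cstar_subalgebra B" "\<pi> ` A \<subseteq> B" "B \<subseteq> AI" and Y: "t ` W \<subseteq> Y" "Y \<subseteq> XI"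
    and bimod: "hilbert_bimodule (subcorr (pimsner_dilation X \<pi> t) Y B)"
  shows "Y = XI \<and> B = AI"
proof -
  note B' = cstar_subalgebraD[OF B(1)]
  let ?Y = "subcorr (pimsner_dilation X \<pi> t) Y B"
  interpret Y: cstar_correspondence ?Y using bimod by (simp add: hilbert_bimodule_def)
  have "\<exists>lip. (\<forall>x\<in>corr_space ?Y. \<forall>y\<in>corr_space ?Y. lip x y \<in> corr_alg ?Y) \<and>
    (\<forall>x\<in>corr_space ?Y. \<forall>y\<in>corr_space ?Y. \<forall>z\<in>corr_space ?Y.
      corr_lact ?Y (lip x y) z = corr_ract ?Y x (corr_ip ?Y y z))"
    using bimod unfolding hilbert_bimodule_def by (elim conjE exE, intro exI conjI)
  then obtain lip where "\<forall>x\<in>corr_space ?Y. \<forall>y\<in>corr_space ?Y. lip x y \<in> corr_alg ?Y"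
    "\<forall>x\<in>corr_space ?Y. \<forall>y\<in>corr_space ?Y. \<forall>z\<in>corr_space ?Y.
      corr_lact ?Y (lip x y) z = corr_ract ?Y x (corr_ip ?Y y z)"
    by (elim exE conjE)
  hence lip: "\<forall>x\<in>Y. \<forall>y\<in>Y. lip x y \<in> B"
    "\<forall>x\<in>Y. \<forall>y\<in>Y. \<forall>z\<in>Y. lip x y * z = x * (star y * z)"
    by (simp_all add: subcorr_pimsner)
  have Y_B: "y * b \<in> Y" if "y \<in> Y" "b \<in> B" for y b
    using Y.ract_closed[of y b] that by (simp add: subcorr_pimsner)
  have Y_sub: "csubspace Y" using Y.space by (simp add: subcorr_pimsner)
  have ketbra: "x * star y \<in> B" if xy: "x \<in> Y" "y \<in> Y" for x y
  proof -
    have "lip x y - x * star y = 0"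
    proof (rule A_inf_action_injective)
      have "lip x y \<in> AI" using lip(1) xy B(3) by blast
      moreover have "x \<in> XI" "y \<in> XI" using xy Y(2) by blast+
      ultimately show "lip x y - x * star y \<in> AI"
        by (intro cvec.subspace_diff[OF A_inf_subspace] X_inf_lip)
      fix z assume "z \<in> W"
      hence "t z \<in> Y" using Y(1) by blast
      hence "lip x y * t z = x * (star y * t z)" using lip(2) xy by blast
      thus "(lip x y - x * star y) * t z = 0" by (simp only: left_diff_distrib mult.assoc) simp
    qed
    hence "lip x y = x * star y" by simp
    moreover have "lip x y \<in> B" using lip(1) xy by blast
    ultimately show ?thesis by simp
  qed
  \<comment> \<open>The induction needs \<open>ketbra\<close> on Y and not only on t(X):
    \<open>t x\<close> times the shorter product is in Y because Y is a right B-module.\<close>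
  have el_B: "el u * star (el v) \<in> B" if "u \<noteq> []" "length u = length v" "set u \<subseteq> W" "set v \<subseteq> W" for u v
    using that(2,1,3,4)
  proof (induction u v rule: list_induct2)
    case (Cons x us y vs)
    have xy: "t x \<in> Y" "t y \<in> Y" using Cons.prems Y(1) by auto
    show ?case
    proof (cases "us = []")
      case True
      thus ?thesis using Cons.hyps xy ketbra by simp
    next
      case False
      hence ne: "vs \<noteq> []" using Cons.hyps by auto
      have "el us * star (el vs) \<in> B" using Cons False by simp
      from ketbra[OF Y_B[OF xy(1) this] xy(2)] show ?thesis by (simp add: el_Cons[OF False] el_Cons[OF ne] star_mult mult.assoc)
    qed
  qed simp
  have "core \<subseteq> B"
  proof
    fix c assume "c \<in> core"
    then obtain u v where "c = el u * star (el v)" "u \<noteq> []" "length u = length v" "set u \<subseteq> W" "set v \<subseteq> W"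
      by (rule core_cases)
    thus "c \<in> B" using el_B[of u v] by simp
  qed
  hence "AI \<subseteq> B" unfolding A_inf_eq using B(2) by (intro closed_span_least[OF B'(1,2)] Un_least)
  hence BA: "B = AI" using B(3) by blast
  \<comment> \<open>Completeness of Y is stated for \<open>corr_norm\<close>, which is the ambient
    norm here.\<close>
  have "closed Y"
    unfolding closed_sequential_limits
  proof (intro allI impI, elim conjE)
    fix f l assume f: "\<forall>n. f n \<in> Y" and l: "f \<longlonglongrightarrow> l"
    have norm: "corr_norm ?Y x = norm x" for x
      by (simp add: subcorr_pimsner corr_norm_def cstar_identity)
    have "Cauchy f" using l by (rule LIMSEQ_imp_Cauchy)
    hence "\<exists>N. \<forall>j\<ge>N. \<forall>k\<ge>N. corr_norm ?Y (f j - f k) < e" if "e > 0" for e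
      using that by (simp add: norm Cauchy_iff)
    moreover have "f k \<in> corr_space ?Y" for k using f by (simp add: subcorr_pimsner)
    ultimately obtain y where y: "y \<in> corr_space ?Y" "(\<lambda>k. corr_norm ?Y (f k - y)) \<longlonglongrightarrow> 0"
      using Y.complete[of f] by blast
    have "(\<lambda>k. f k - y) \<longlonglongrightarrow> 0" using y(2) unfolding norm by (rule tendsto_norm_zero_cancel)
    hence "f \<longlonglongrightarrow> y" by (rule LIM_zero_cancel)
    hence "l = y" using l LIMSEQ_unique by blast
    thus "l \<in> Y" using y(1) by (simp add: subcorr_pimsner)
  qed
  moreover have "{t x * a |x a. x \<in> W \<and> a \<in> AI} \<subseteq> Y"
    using Y(1) Y_B unfolding BA by blast
  ultimately have "XI \<subseteq> Y"
    unfolding X_inf_def by (intro closed_span_least[OF Y_sub])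
  thus ?thesis using BA Y(2) by blast
qed

end

theorem theorem3p7:
  fixes X :: "('x::complex_vector, 'a::cstar_algebra) corr"
    and \<pi> :: "'a \<Rightarrow> 'd::cstar_algebra"
    and t :: "'x \<Rightarrow> 'd"
  assumes "cstar_correspondence X"
    and "injective_corr X"
    and "corr_representation X \<pi> t"
    and "inj_on \<pi> (corr_alg X)"
    and "covariant X \<pi> t"
    and "admits_gauge_action X \<pi> t"
  shows "hilbert_bimodule (pimsner_dilation X \<pi> t)
    \<and> is_subcorrespondence (t ` corr_space X) (\<pi> ` corr_alg X) (pimsner_dilation X \<pi> t)
    \<and> corr_isomorphism X
        (subcorr (pimsner_dilation X \<pi> t) (t ` corr_space X) (\<pi> ` corr_alg X)) \<pi> t
    \<and> (\<forall>B Y. cstar_subalgebra B \<longrightarrow> \<pi> ` corr_alg X \<subseteq> B \<longrightarrow> B \<subseteq> A_inf X \<pi> t \<longrightarrow>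
          t ` corr_space X \<subseteq> Y \<longrightarrow> Y \<subseteq> X_inf X \<pi> t \<longrightarrow>
          is_subcorrespondence Y B (pimsner_dilation X \<pi> t) \<longrightarrow>
          hilbert_bimodule (subcorr (pimsner_dilation X \<pi> t) Y B) \<longrightarrow>
          Y = X_inf X \<pi> t \<and> B = A_inf X \<pi> t)"
proof -
  interpret cstar_correspondence X by fact
  interpret injective_covariant_rep X \<pi> t
    by standard (fact assms)+
  show ?thesis
    using pimsner_bimodule X_subcorrespondence X_isomorphism pimsner_minimal by simp
qed

end
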